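(* For $T\ge 1$ let $p=p(T)$ and let $U_t=(U_{t1},\ldots,U_{tp})^\prime$, $1\leq t\leq T$, be i.i.d. random vectors. Assume the null hypothesis $\mathcal{H}_0$ that the components $U_{t1},\ldots,U_{tp}$ are i.i.d. (with a distribution not depending on $T$), and that $EU_{11}=0$, $EU_{11}^2=\sigma^2>0$ and $EU_{11}^4<\infty$. Let $\hat\sigma^2$ denote a consistent estimator of $\sigma^2$, and write $\hat\sigma^4=(\hat\sigma^2)^2$. Let $\mathcal{F}=\mathcal{F}(T)\subset\{1,\ldots,\lfloor p/2\rfloor\}$ be a set of indices of fundamental frequencies with $f=|\mathcal{F}|\ge 2$, and let $S_\xi^2$ be the empirical variance of the components of $\xi=T^{-1}\sum_{t=1}^TI_{U_t}(\boldsymbol\theta)$. (i) For fixed $f$, as $T\to\infty$, $$\Lambda_{\mathrm{fin}}:=(f-1)\,T S_\xi^2/\hat\sigma^4\stackrel{d}{\to}\chi^2_{f-1}.$$ (ii) If additionally $EU_{11}^8<\infty$, and $f=f(T)\to\infty$ and $f/T\to0$ (instead of $f$ being fixed), then, as $T\to\infty$, $$\Lambda_{\mathrm{inf}}:=\left(TS_\xi^2/\hat\sigma^4-1\right)\sqrt{(f-1)/2}\stackrel{d}{\to}N(0,1).$$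
   Context: For a vector $Z=(Z_1,\ldots,Z_n)^\prime$ with mean $\bar Z=\frac1n\sum_{k=1}^n Z_k$, the empirical variance of its components is $S_Z^2=\frac{1}{n-1}\sum_{k=1}^n(Z_k-\bar Z)^2$. For $Z=(Z_1,\ldots,Z_p)^\prime$ the periodogram is $$I_Z(\theta)=\frac1p\left|\sum_{k=1}^pZ_ke^{-\mathrm{i}k\theta}\right|^2,\qquad \mathrm{i}=\sqrt{-1}.$$ The fundamental frequencies are $\theta_\ell=\frac{2\pi\ell}{p}$, $1\leq\ell\leq\lfloor p/2\rfloor$. For a set $\mathcal{F}\subset\{1,\ldots,\lfloor p/2\rfloor\}$, $\boldsymbol\theta=\{\theta_\ell\colon\ell\in\mathcal{F}\}$ and $I_Z(\boldsymbol\theta)$ is the vector $(I_Z(\theta_\ell))_{\ell\in\mathcal{F}}\in\mathbb{R}^f$. Both $\mathcal{F}$ (hence $f$) and $p$ may depend on $T$.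
   Formalization: In (i) the index p/2 (frequency π) must not lie in F for all large T, since it doubles a limiting variance. In (ii) the estimator must satisfy √f(σ̂²−σ²)→0 in probability, since mere consistency is not enough. The claim is false without these conditions. *)

theory Defs
  imports "HOL-Probability.Probability"
begin

definition iid_vars ::
    "'a measure \<Rightarrow> 'b measure \<Rightarrow> ('i \<Rightarrow> 'a \<Rightarrow> 'b) \<Rightarrow> 'i set \<Rightarrow> bool" where
  "iid_vars M N X I \<longleftrightarrow>
     prob_space.indep_vars M (\<lambda>_. N) X I \<and>
     (\<forall>i\<in>I. \<forall>j\<in>I. distr M N (X i) = distr M N (X j))"

text \<open>The probability space may change with \<open>n\<close>, so that triangular arrays are covered.\<close>

definition conv_in_prob ::
    "(nat \<Rightarrow> 'a measure) \<Rightarrow> (nat \<Rightarrow> 'a \<Rightarrow> real) \<Rightarrow> real \<Rightarrow> bool" where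
  "conv_in_prob M X c \<longleftrightarrow>
     (\<forall>\<epsilon>>0. (\<lambda>n. measure (M n) {\<omega> \<in> space (M n). \<bar>X n \<omega> - c\<bar> > \<epsilon>}) \<longlonglongrightarrow> 0)"

definition conv_in_distr ::
    "(nat \<Rightarrow> 'a measure) \<Rightarrow> (nat \<Rightarrow> 'a \<Rightarrow> real) \<Rightarrow> real measure \<Rightarrow> bool" where
  "conv_in_distr M X \<nu> \<longleftrightarrow> weak_conv_m (\<lambda>n. distr (M n) borel (X n)) \<nu>"

definition chi_square_distribution :: "nat \<Rightarrow> real measure" where
  "chi_square_distribution d =
     distr (PiM {..<d} (\<lambda>_. std_normal_distribution)) borel (\<lambda>z. \<Sum>i<d. (z i)\<^sup>2)"

text \<open>Vectors are indexed by a finite set \<open>A\<close>, because the components of \<open>\<xi>\<close> are indexed by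
  the set of selected frequencies rather than by an initial segment.\<close>

definition emp_mean :: "'i set \<Rightarrow> ('i \<Rightarrow> real) \<Rightarrow> real" where
  "emp_mean A z = (1 / real (card A)) * (\<Sum>i\<in>A. z i)"

definition emp_variance :: "'i set \<Rightarrow> ('i \<Rightarrow> real) \<Rightarrow> real" where
  "emp_variance A z = (1 / (real (card A) - 1)) * (\<Sum>i\<in>A. (z i - emp_mean A z)\<^sup>2)"

definition periodogram :: "nat \<Rightarrow> (nat \<Rightarrow> real) \<Rightarrow> real \<Rightarrow> real" where
  "periodogram p z \<theta> =
     (1 / real p) * (cmod (\<Sum>k=1..p. of_real (z k) * exp (- (\<i> * of_nat k * of_real \<theta>))))\<^sup>2"

definition fund_freq :: "nat \<Rightarrow> nat \<Rightarrow> real" where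
  "fund_freq p l = 2 * pi * real l / real p"

text \<open>Below, \<open>u t k\<close> is a realisation of the \<open>k\<close>-th component of the \<open>t\<close>-th vector, and \<open>F\<close> is
  the set of indices of the selected fundamental frequencies.\<close>

definition xi :: "nat \<Rightarrow> nat \<Rightarrow> (nat \<Rightarrow> nat \<Rightarrow> real) \<Rightarrow> nat \<Rightarrow> real" where
  "xi T p u l = (1 / real T) * (\<Sum>t=1..T. periodogram p (u t) (fund_freq p l))"

definition S_xi2 :: "nat \<Rightarrow> nat \<Rightarrow> nat set \<Rightarrow> (nat \<Rightarrow> nat \<Rightarrow> real) \<Rightarrow> real" where
  "S_xi2 T p F u = emp_variance F (xi T p u)"

text \<open>The last argument \<open>s2\<close> is the value of the estimator of the variance.\<close>

definition Lambda_fin ::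
    "nat \<Rightarrow> nat \<Rightarrow> nat set \<Rightarrow> (nat \<Rightarrow> nat \<Rightarrow> real) \<Rightarrow> real \<Rightarrow> real" where
  "Lambda_fin T p F u s2 = (real (card F) - 1) * (real T * S_xi2 T p F u) / s2\<^sup>2"

definition Lambda_inf ::
    "nat \<Rightarrow> nat \<Rightarrow> nat set \<Rightarrow> (nat \<Rightarrow> nat \<Rightarrow> real) \<Rightarrow> real \<Rightarrow> real" where
  "Lambda_inf T p F u s2 =
     (real T * S_xi2 T p F u / s2\<^sup>2 - 1) * sqrt ((real (card F) - 1) / 2)"

text \<open>Two side conditions are needed when these statistics are studied asymptotically.
  At the Nyquist index \<open>l = p / 2\<close> (\<open>p\<close> even) the sum defining the periodogram is real and the
  limiting variance of \<open>xi\<close> is doubled; for a fixed number of frequencies this changes the limit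
  of \<open>Lambda_fin\<close>. If the number of frequencies diverges, the error of \<open>s2\<close> enters
  \<open>Lambda_inf\<close> multiplied by \<open>sqrt (card F)\<close>, so consistency of \<open>s2\<close> alone does not
  suffice.\<close>

end

theory Submission
  imports Defs
begin

text \<open>The diagonal part of a periodogram is the same at all frequencies, so only the off-diagonal part,
  a quadratic form without diagonal in the independent components, enters \<open>S_xi2\<close>. In the coordinates
  of a Helmert matrix, \<open>(f - 1) T S_xi2 / \<sigma>\<^sup>4\<close> is the squared length of a normalised sum of \<open>T\<close>
  independent centred vectors in dimension \<open>d = f - 1\<close>. By the orthogonality of the trigonometric
  system their covariance matrix is exactly the identity, up to a rank-one term of norm at most one
  caused by the Nyquist frequency. Quadratic forms of this type satisfy a moment comparison between
  order two and order four, uniformly in \<open>p\<close>. Replacing the vectors by Gaussian ones, one at a time, and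
  expanding \<open>exp (\<i> s |x|\<^sup>2)\<close> to second order therefore changes the characteristic function of the
  squared length by a quantity that is explicit in \<open>s\<close>, \<open>d\<close> and \<open>T\<close>. It vanishes for fixed \<open>d\<close> and also for
  \<open>s = \<tau> / sqrt (2 d)\<close> with \<open>d / T \<longlonglongrightarrow> 0\<close>. For Gaussian vectors the law is exactly chi-square, and the
  central limit theorem for the chi-square distribution gives the second limit. The error of the
  variance estimator is removed by Slutsky's argument.\<close>

section \<open>Moments of linear and quadratic forms\<close>

text \<open>Since \<open>d\<close> may grow with \<open>T\<close>, every estimate has to display its
  dependence on the dimension. Replacing one vector \<open>v\<close> in \<open>x + h * v\<close>,
  \<open>h = 1 / sqrt T\<close>, changes the squared length by \<open>a + b\<close> with
  \<open>a = 2 * h * dot d x v\<close> and \<open>b = h^2 * dot d v v\<close>. For sums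
  \<open>x\<close> of squared length of order \<open>d\<close>, \<open>a\<close> is of order
  sqrt(d/T) and \<open>b\<close> of order d/T. Expanding to second order in \<open>a\<close> but
  only to first order in \<open>b\<close> leaves errors of order (d/T) * sqrt(d/T) or smaller times
  \<open>s^2\<close> or \<open>|s|^3\<close>; over \<open>T\<close> replacements this is d *
  sqrt(d/T), and with \<open>s^2\<close> of order 1/d only sqrt(d/T) survives. This is where f/T ->
  0 enters. The constant \<open>C\<close> depends only on the fourth moment and the variance of the
  components: adding an independent centred summand increases a squared L4 norm additively, as for
  variances, so no power of \<open>p\<close>, \<open>d\<close> or \<open>T\<close> accumulates. The
  rank-one covariance term costs \<open>dot d r r * (|s| + 4 * s^2)\<close> in total. For fixed
  \<open>f\<close> it has to vanish, which is the case once the Nyquist index is excluded; for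
  growing \<open>f\<close> it tends to 0 together with \<open>s\<close>.\<close>

lemma abs_monomial_le:
  fixes x y :: real
  assumes "i + j \<le> 4"
  shows "\<bar>x ^ i * y ^ j\<bar> \<le> 1 + x ^ 4 + y ^ 4"
proof -
  define m where "m = max 1 (max \<bar>x\<bar> \<bar>y\<bar>)"
  have "\<bar>x ^ i * y ^ j\<bar> = \<bar>x\<bar> ^ i * \<bar>y\<bar> ^ j"
    by (simp add: abs_mult power_abs)
  also have "\<dots> \<le> m ^ i * m ^ j"
    by (intro mult_mono power_mono) (auto simp: m_def)
  also have "\<dots> = m ^ (i + j)" by (simp add: power_add)
  also have "\<dots> \<le> m ^ 4"
    by (rule power_increasing[OF assms]) (simp add: m_def)
  also have "\<dots> \<le> 1 + x ^ 4 + y ^ 4"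
    by (auto simp: m_def max_def)
  finally show ?thesis .
qed

lemma integrable_monomial:
  fixes X Y :: "'a \<Rightarrow> real"
  assumes "finite_measure M" "X \<in> borel_measurable M" "Y \<in> borel_measurable M"
    and "integrable M (\<lambda>\<omega>. X \<omega> ^ 4)" "integrable M (\<lambda>\<omega>. Y \<omega> ^ 4)" "i + j \<le> 4"
  shows "integrable M (\<lambda>\<omega>. X \<omega> ^ i * Y \<omega> ^ j)"
proof (rule Bochner_Integration.integrable_bound)
  interpret finite_measure M by fact
  show "integrable M (\<lambda>\<omega>. 1 + X \<omega> ^ 4 + Y \<omega> ^ 4)"
    using assms by auto
  show "AE \<omega> in M. norm (X \<omega> ^ i * Y \<omega> ^ j) \<le> norm (1 + X \<omega> ^ 4 + Y \<omega> ^ 4)"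
    using abs_monomial_le[OF assms(6)] by (auto intro: order_trans)
qed (use assms in measurable)

lemma integrable_power_le4:
  fixes X :: "'a \<Rightarrow> real"
  assumes "finite_measure M" "X \<in> borel_measurable M"
    and "integrable M (\<lambda>\<omega>. X \<omega> ^ 4)" "i \<le> 4"
  shows "integrable M (\<lambda>\<omega>. X \<omega> ^ i)"
  using integrable_monomial[of M X X i 0] assms by simp

lemma integral_squares_le:
  fixes X Y :: "'a \<Rightarrow> real"
  assumes "finite_measure M" "X \<in> borel_measurable M" "Y \<in> borel_measurable M"
    and int: "integrable M (\<lambda>\<omega>. X \<omega> ^ 4)" "integrable M (\<lambda>\<omega>. Y \<omega> ^ 4)"
    and a: "(LINT \<omega>|M. X \<omega> ^ 4) \<le> a\<^sup>2" "0 \<le> a" and b: "(LINT \<omega>|M. Y \<omega> ^ 4) \<le> b\<^sup>2" "0 \<le> b"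
  shows "(LINT \<omega>|M. X \<omega> ^ 2 * Y \<omega> ^ 2) \<le> a * b"
proof -
  have le: "(LINT \<omega>|M. X \<omega> ^ 2 * Y \<omega> ^ 2) \<le> (a + e) * (b + e)" if e: "e > 0" for e
  proof -
    \<comment> \<open>The weight that is optimal for the given bounds in the inequality of
      arithmetic and geometric means. The shift by \<open>e\<close> keeps it positive and finite
      when \<open>a\<close> or \<open>b\<close> is 0; \<open>e\<close> tends to 0 at the
      end.\<close>
    define c where "c = (b + e) / (a + e)"
    have c: "c > 0" using a b e by (simp add: c_def)
    have "x ^ 2 * y ^ 2 \<le> (c * x ^ 4 + y ^ 4 / c) / 2" for x y :: real
    proof -
      have "0 \<le> (c * x ^ 2 - y ^ 2)\<^sup>2 / c" using c by simp
      also have "\<dots> = c * x ^ 4 + y ^ 4 / c - 2 * (x ^ 2 * y ^ 2)"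
        using c by (simp add: power2_eq_square field_simps power4_eq_xxxx)
      finally show ?thesis by simp
    qed
    then have "(LINT \<omega>|M. X \<omega> ^ 2 * Y \<omega> ^ 2) \<le> (LINT \<omega>|M. (c * X \<omega> ^ 4 + Y \<omega> ^ 4 / c) / 2)"
      using assms by (intro integral_mono integrable_monomial) auto
    also have "\<dots> = (c * (LINT \<omega>|M. X \<omega> ^ 4) + (LINT \<omega>|M. Y \<omega> ^ 4) / c) / 2"
      using int by simp
    also have "\<dots> \<le> (c * (a + e)\<^sup>2 + (b + e)\<^sup>2 / c) / 2"
      using c e a b
      by (intro divide_right_mono add_mono mult_left_mono order_trans[OF a(1)] order_trans[OF b(1)]
          power_mono) auto
    also have "\<dots> = (a + e) * (b + e)"
      using a b e by (simp add: c_def power2_eq_square)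
    finally show ?thesis .
  qed
  have "((\<lambda>e. (a + e) * (b + e)) \<longlongrightarrow> (a + 0) * (b + 0)) (at_right 0)"
    by (intro tendsto_intros)
  moreover have "eventually (\<lambda>e. (LINT \<omega>|M. X \<omega> ^ 2 * Y \<omega> ^ 2) \<le> (a + e) * (b + e)) (at_right 0)"
    using le by (auto simp: eventually_at_right_less intro: eventually_at_rightI[of 0 1])
  ultimately show ?thesis
    using tendsto_lowerbound[of "\<lambda>e. (a + e) * (b + e)" "a * b" "at_right 0"] by simp
qed

text \<open>Independence of the pair \<open>(X, Y)\<close> and \<open>U\<close> is stated through functions of the pair because
  \<open>indep_var\<close> requires both variables to have the same type.\<close>

locale affine_step = prob_space +
  fixes X Y U :: "'a \<Rightarrow> real"
  assumes ind: "\<And>g. g \<in> borel_measurable (borel \<Otimes>\<^sub>M borel) \<Longrightarrow>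
      indep_var borel (\<lambda>\<omega>. g (X \<omega>, Y \<omega>) :: real) borel U"
    and int_X: "integrable M (\<lambda>\<omega>. X \<omega> ^ 4)"
    and int_Y: "integrable M (\<lambda>\<omega>. Y \<omega> ^ 4)"
    and int_U: "integrable M (\<lambda>\<omega>. U \<omega> ^ 4)"
    and centred: "expectation U = 0"
begin

lemma meas: "X \<in> borel_measurable M" "Y \<in> borel_measurable M" "U \<in> borel_measurable M"
  using indep_var_rv1[OF ind[of fst]] indep_var_rv1[OF ind[of snd]] indep_var_rv2[OF ind[of fst]]
  by auto

lemma integrable_powers:
  assumes "i + j \<le> 4" "k \<le> 4"
  shows "integrable M (\<lambda>\<omega>. X \<omega> ^ i * Y \<omega> ^ j)" "integrable M (\<lambda>\<omega>. U \<omega> ^ k)"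
  using assms meas int_X int_Y int_U
  by (auto intro!: integrable_monomial integrable_power_le4 finite_measure_axioms)

lemma product:
  assumes "i + j \<le> 4" "k \<le> 4"
  shows "integrable M (\<lambda>\<omega>. X \<omega> ^ i * Y \<omega> ^ j * U \<omega> ^ k)"
    and "expectation (\<lambda>\<omega>. X \<omega> ^ i * Y \<omega> ^ j * U \<omega> ^ k) =
      expectation (\<lambda>\<omega>. X \<omega> ^ i * Y \<omega> ^ j) * expectation (\<lambda>\<omega>. U \<omega> ^ k)"
proof -
  have "indep_var borel (id \<circ> (\<lambda>\<omega>. (\<lambda>(x, y). x ^ i * y ^ j) (X \<omega>, Y \<omega>))) borel ((\<lambda>u. u ^ k) \<circ> U)"
    by (intro indep_var_compose[OF ind]) measurable
  then have "indep_var borel (\<lambda>\<omega>. X \<omega> ^ i * Y \<omega> ^ j) borel (\<lambda>\<omega>. U \<omega> ^ k)"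
    by (simp add: comp_def)
  note * = indep_var_integrable[OF this] indep_var_lebesgue_integral[OF this]
  show "integrable M (\<lambda>\<omega>. X \<omega> ^ i * Y \<omega> ^ j * U \<omega> ^ k)"
    and "expectation (\<lambda>\<omega>. X \<omega> ^ i * Y \<omega> ^ j * U \<omega> ^ k) =
      expectation (\<lambda>\<omega>. X \<omega> ^ i * Y \<omega> ^ j) * expectation (\<lambda>\<omega>. U \<omega> ^ k)"
    using * integrable_powers[OF assms] by auto
qed

lemma mean: "integrable M (\<lambda>\<omega>. X \<omega> + U \<omega> * Y \<omega>)"
    "expectation (\<lambda>\<omega>. X \<omega> + U \<omega> * Y \<omega>) = expectation X"
  using product[of 0 1 1] integrable_powers[of 1 0 1] centred by (auto simp: mult.commute)

lemma second_moment: "expectation (\<lambda>\<omega>. (X \<omega> + U \<omega> * Y \<omega>)\<^sup>2) =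
    expectation (\<lambda>\<omega>. (X \<omega>)\<^sup>2) + expectation (\<lambda>\<omega>. (U \<omega>)\<^sup>2) * expectation (\<lambda>\<omega>. (Y \<omega>)\<^sup>2)"
proof -
  have "(\<lambda>\<omega>. (X \<omega> + U \<omega> * Y \<omega>)\<^sup>2) =
    (\<lambda>\<omega>. (X \<omega> ^ 2 * Y \<omega> ^ 0 * U \<omega> ^ 0 + 2 * (X \<omega> ^ 1 * Y \<omega> ^ 1 * U \<omega> ^ 1))
      + X \<omega> ^ 0 * Y \<omega> ^ 2 * U \<omega> ^ 2)"
    by (auto simp: power2_eq_square algebra_simps)
  then show ?thesis
    using product[of 2 0 0] product[of 1 1 1] product[of 0 2 2] centred by simp
qed

text \<open>Here \<open>a\<close> and \<open>b\<close> bound squared L4 norms. As \<open>U\<close>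
  is centred, the term with \<open>X^3\<close> drops out, and what remains fits under a square.
  Squared L4 norms thus add like variances, with factor \<open>5 * m\<close> on the new term only,
  so an induction over the variables does not let constants accumulate.\<close>

lemma fourth_moment:
  assumes m: "expectation (\<lambda>\<omega>. U \<omega> ^ 4) \<le> m" "1 \<le> m"
    and a: "expectation (\<lambda>\<omega>. X \<omega> ^ 4) \<le> a\<^sup>2" "0 \<le> a"
    and b: "expectation (\<lambda>\<omega>. Y \<omega> ^ 4) \<le> b\<^sup>2" "0 \<le> b"
  shows "integrable M (\<lambda>\<omega>. (X \<omega> + U \<omega> * Y \<omega>) ^ 4)"
    and "expectation (\<lambda>\<omega>. (X \<omega> + U \<omega> * Y \<omega>) ^ 4) \<le> (a + 5 * m * b)\<^sup>2"
proof -
  let ?p = "\<lambda>i j k \<omega>. X \<omega> ^ i * Y \<omega> ^ j * U \<omega> ^ k"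
  have eq: "(\<lambda>\<omega>. (X \<omega> + U \<omega> * Y \<omega>) ^ 4) =
    (\<lambda>\<omega>. ?p 4 0 0 \<omega> + 4 * ?p 3 1 1 \<omega> + 6 * ?p 2 2 2 \<omega> + 4 * ?p 1 3 3 \<omega> + ?p 0 4 4 \<omega>)"
    by (rule ext) (simp add: power2_eq_square power3_eq_cube power4_eq_xxxx algebra_simps)
  show "integrable M (\<lambda>\<omega>. (X \<omega> + U \<omega> * Y \<omega>) ^ 4)"
    unfolding eq by (intro Bochner_Integration.integrable_add integrable_mult_right product) auto
  have "expectation (\<lambda>\<omega>. (X \<omega> + U \<omega> * Y \<omega>) ^ 4) =
    expectation (?p 4 0 0) + 4 * expectation (?p 3 1 1) + 6 * expectation (?p 2 2 2)
      + 4 * expectation (?p 1 3 3) + expectation (?p 0 4 4)"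
    unfolding eq
    using product(1)[of 4 0 0] product(1)[of 3 1 1] product(1)[of 2 2 2] product(1)[of 1 3 3]
      product(1)[of 0 4 4] by simp
  also have "\<dots> = expectation (\<lambda>\<omega>. X \<omega> ^ 4)
      + 6 * (expectation (\<lambda>\<omega>. X \<omega> ^ 2 * Y \<omega> ^ 2) * expectation (\<lambda>\<omega>. U \<omega> ^ 2))
      + 4 * (expectation (\<lambda>\<omega>. X \<omega> ^ 1 * Y \<omega> ^ 3) * expectation (\<lambda>\<omega>. U \<omega> ^ 3))
      + expectation (\<lambda>\<omega>. Y \<omega> ^ 4) * expectation (\<lambda>\<omega>. U \<omega> ^ 4)"
    using product(2)[of 4 0 0] product(2)[of 3 1 1] product(2)[of 2 2 2] product(2)[of 1 3 3]
      product(2)[of 0 4 4] centred by (simp add: prob_space)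
  \<comment> \<open>Odd powers are absorbed into even ones: \<open>|X * Y^3|\<close> into half of
    \<open>X^2 * Y^2 + Y^4\<close>, and \<open>|U^3|\<close> into \<open>1 + U^4\<close>, whose mean
    is at most \<open>2 * m\<close>.\<close>
  also have "\<dots> \<le> a\<^sup>2 + 6 * ((a * b) * m) + 4 * ((a * b + b\<^sup>2) / 2 * (2 * m)) + b\<^sup>2 * m"
  proof (intro add_mono mult_left_mono)
    have sq: "expectation (\<lambda>\<omega>. X \<omega> ^ 2 * Y \<omega> ^ 2) \<le> a * b"
      by (intro integral_squares_le finite_measure_axioms meas int_X int_Y a b)
    have "expectation (\<lambda>\<omega>. U \<omega> ^ 2) \<le> expectation (\<lambda>\<omega>. (1 + U \<omega> ^ 4) / 2)"
    proof (rule integral_mono)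
      show "U \<omega> ^ 2 \<le> (1 + U \<omega> ^ 4) / 2" for \<omega>
        using zero_le_power2[of "U \<omega> ^ 2 - 1"] by (simp add: power2_diff)
    qed (use integrable_powers[of 0 0 2] int_U in auto)
    also have "\<dots> \<le> m" using int_U m by (simp add: prob_space)
    finally have U2: "expectation (\<lambda>\<omega>. U \<omega> ^ 2) \<le> m" .
    show "expectation (\<lambda>\<omega>. X \<omega> ^ 2 * Y \<omega> ^ 2) * expectation (\<lambda>\<omega>. U \<omega> ^ 2) \<le> a * b * m"
      using a b by (intro mult_mono sq U2 integral_nonneg_AE) auto
    have "\<bar>expectation (\<lambda>\<omega>. X \<omega> ^ 1 * Y \<omega> ^ 3)\<bar> \<le> expectation (\<lambda>\<omega>. \<bar>X \<omega> ^ 1 * Y \<omega> ^ 3\<bar>)"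
      by (rule integral_abs_bound)
    also have "\<dots> \<le> expectation (\<lambda>\<omega>. (X \<omega> ^ 2 * Y \<omega> ^ 2 + Y \<omega> ^ 4) / 2)"
    proof (rule integral_mono)
      show "\<bar>X \<omega> ^ 1 * Y \<omega> ^ 3\<bar> \<le> (X \<omega> ^ 2 * Y \<omega> ^ 2 + Y \<omega> ^ 4) / 2" for \<omega>
      proof -
        have "0 \<le> (\<bar>X \<omega> * Y \<omega>\<bar> - (Y \<omega>)\<^sup>2)\<^sup>2" by simp
        then show ?thesis
          by (simp add: power2_diff abs_mult power_abs power3_eq_cube power2_eq_square
              power4_eq_xxxx algebra_simps)
      qed
    qed (use integrable_powers[of 1 3 0] integrable_powers[of 2 2 0] int_Y in auto)
    also have "\<dots> \<le> (a * b + b\<^sup>2) / 2"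
      using sq b int_Y integrable_powers(1)[of 2 2 0] by simp
    finally have XY: "\<bar>expectation (\<lambda>\<omega>. X \<omega> ^ 1 * Y \<omega> ^ 3)\<bar> \<le> (a * b + b\<^sup>2) / 2" .
    have "\<bar>expectation (\<lambda>\<omega>. U \<omega> ^ 3)\<bar> \<le> expectation (\<lambda>\<omega>. \<bar>U \<omega> ^ 3\<bar>)"
      by (rule integral_abs_bound)
    also have "\<dots> \<le> expectation (\<lambda>\<omega>. 1 + U \<omega> ^ 4)"
      using abs_monomial_le[of 3 0 _ 0] integrable_powers(2)[of 0 0 3] int_U
      by (intro integral_mono) auto
    also have "\<dots> \<le> 2 * m" using int_U m by (simp add: prob_space)
    finally have U3: "\<bar>expectation (\<lambda>\<omega>. U \<omega> ^ 3)\<bar> \<le> 2 * m" .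
    have "\<bar>expectation (\<lambda>\<omega>. X \<omega> ^ 1 * Y \<omega> ^ 3)\<bar> * \<bar>expectation (\<lambda>\<omega>. U \<omega> ^ 3)\<bar>
        \<le> (a * b + b\<^sup>2) / 2 * (2 * m)"
      using a b by (intro mult_mono XY U3) auto
    then show "expectation (\<lambda>\<omega>. X \<omega> ^ 1 * Y \<omega> ^ 3) * expectation (\<lambda>\<omega>. U \<omega> ^ 3)
        \<le> (a * b + b\<^sup>2) / 2 * (2 * m)"
      unfolding abs_mult[symmetric] by simp
    show "expectation (\<lambda>\<omega>. Y \<omega> ^ 4) * expectation (\<lambda>\<omega>. U \<omega> ^ 4) \<le> b\<^sup>2 * m"
      by (intro mult_mono b m integral_nonneg_AE) auto
  qed (use a in auto)
  \<comment> \<open>The mixed terms contribute 6 + 4 = 10 and the terms in \<open>b^2\<close>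
    contribute 4 + 1 = 5. The factor 5 in the conclusion makes \<open>10 * m * a * b\<close> exactly
    the cross term of the square; \<open>1 \<le> m\<close> takes care of \<open>b^2\<close>.\<close>
  also have "\<dots> = a\<^sup>2 + 10 * m * a * b + 5 * m * b\<^sup>2"
    by (simp add: field_simps)
  also have "\<dots> \<le> (a + 5 * m * b)\<^sup>2"
  proof -
    have "5 * m * 1 \<le> 5 * m * (5 * m)" using m by (intro mult_left_mono) auto
    then have "(5 * m * 1) * b\<^sup>2 \<le> 5 * m * (5 * m) * b\<^sup>2" by (intro mult_right_mono) auto
    then show ?thesis by (simp add: power2_eq_square algebra_simps)
  qed
  finally show "expectation (\<lambda>\<omega>. (X \<omega> + U \<omega> * Y \<omega>) ^ 4) \<le> (a + 5 * m * b)\<^sup>2" .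
qed

end

text \<open>Disjoint blocks of an independent family are independent, so any pair of measurable
  functions of the block over \<open>J\<close> is jointly independent of \<open>Z i\<close>.\<close>

lemma (in prob_space) affine_stepI:
  fixes Z :: "'i \<Rightarrow> 'a \<Rightarrow> real"
  assumes indep: "indep_vars (\<lambda>_. borel) Z I" and J: "J \<subseteq> I" "i \<in> I" "i \<notin> J"
    and f: "f \<in> borel_measurable (PiM J (\<lambda>_. borel))" and h: "h \<in> borel_measurable (PiM J (\<lambda>_. borel))"
    and X: "\<And>\<omega>. X \<omega> = f (\<lambda>j\<in>J. Z j \<omega>)" and Y: "\<And>\<omega>. Y \<omega> = h (\<lambda>j\<in>J. Z j \<omega>)"
    and int: "integrable M (\<lambda>\<omega>. X \<omega> ^ 4)" "integrable M (\<lambda>\<omega>. Y \<omega> ^ 4)" "integrable M (\<lambda>\<omega>. Z i \<omega> ^ 4)"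
    and centred: "expectation (Z i) = 0"
  shows "affine_step M X Y (Z i)"
proof (unfold_locales, goal_cases)
  case (1 g)
  have "indep_var (PiM J (\<lambda>_. borel)) (\<lambda>\<omega>. \<lambda>j\<in>J. Z j \<omega>) (PiM {i} (\<lambda>_. borel)) (\<lambda>\<omega>. \<lambda>j\<in>{i}. Z j \<omega>)"
    using J by (intro indep_var_restrict[OF indep]) auto
  then have "indep_var borel ((\<lambda>x. g (f x, h x)) \<circ> (\<lambda>\<omega>. \<lambda>j\<in>J. Z j \<omega>)) borel ((\<lambda>x. x i) \<circ> (\<lambda>\<omega>. \<lambda>j\<in>{i}. Z j \<omega>))"
    by (rule indep_var_compose) (use f h 1 in measurable)
  then show ?case by (simp add: comp_def X Y)
qed (use int centred in auto)

text \<open>Induction on \<open>J\<close>: adding \<open>i\<close> is an affine step with constant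
  \<open>Y = b i\<close>. The bound on the squared L4 norm grows by \<open>5 * m * (b i)^2\<close>,
  hence its constant does not depend on the number of summands.\<close>

lemma (in prob_space) linear_form_moments:
  fixes Z :: "'i \<Rightarrow> 'a \<Rightarrow> real"
  assumes indep: "indep_vars (\<lambda>_. borel) Z I" and J: "finite J" "J \<subseteq> I"
    and Z4: "\<And>i. i \<in> I \<Longrightarrow> integrable M (\<lambda>\<omega>. Z i \<omega> ^ 4)"
      "\<And>i. i \<in> I \<Longrightarrow> expectation (\<lambda>\<omega>. Z i \<omega> ^ 4) \<le> m" and m: "1 \<le> m"
    and centred: "\<And>i. i \<in> I \<Longrightarrow> expectation (Z i) = 0"
  shows "integrable M (\<lambda>\<omega>. (\<Sum>i\<in>J. b i * Z i \<omega>) ^ 4)"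
    and "expectation (\<lambda>\<omega>. \<Sum>i\<in>J. b i * Z i \<omega>) = 0"
    and "expectation (\<lambda>\<omega>. (\<Sum>i\<in>J. b i * Z i \<omega>)\<^sup>2) = (\<Sum>i\<in>J. (b i)\<^sup>2 * expectation (\<lambda>\<omega>. (Z i \<omega>)\<^sup>2))"
    and "expectation (\<lambda>\<omega>. (\<Sum>i\<in>J. b i * Z i \<omega>) ^ 4) \<le> (5 * m * (\<Sum>i\<in>J. (b i)\<^sup>2))\<^sup>2"
  using J
proof (induction J rule: finite_induct)
  case (insert i J)
  let ?L = "\<lambda>J \<omega>. \<Sum>i\<in>J. b i * Z i \<omega>"
  { assume sub: "insert i J \<subseteq> I"
    then have "J \<subseteq> I" by simp
    note IH = insert.IH[OF this]
    interpret s: affine_step M "?L J" "\<lambda>_. b i" "Z i"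
    proof (rule affine_stepI[where f = "\<lambda>x. \<Sum>i\<in>J. b i * x i" and h = "\<lambda>_. b i", OF indep])
      show "?L J \<omega> = (\<Sum>i\<in>J. b i * (\<lambda>j\<in>J. Z j \<omega>) i)" for \<omega> by (intro sum.cong) auto
    qed (use insert.hyps sub IH Z4 centred in auto)
    have eq: "?L (insert i J) \<omega> = ?L J \<omega> + Z i \<omega> * b i" for \<omega>
      using insert by (simp add: algebra_simps)
    have b4: "expectation (\<lambda>_. b i ^ 4) \<le> ((b i)\<^sup>2)\<^sup>2"
      by (simp add: prob_space)
    have s4: "integrable M (\<lambda>\<omega>. (?L J \<omega> + Z i \<omega> * b i) ^ 4)"
      "expectation (\<lambda>\<omega>. (?L J \<omega> + Z i \<omega> * b i) ^ 4) \<le> (5 * m * (\<Sum>i\<in>J. (b i)\<^sup>2) + 5 * m * (b i)\<^sup>2)\<^sup>2"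
      using insert.hyps sub IH m Z4 by (auto intro!: s.fourth_moment[where m = m] b4 sum_nonneg mult_nonneg_nonneg)
    show "integrable M (\<lambda>\<omega>. ?L (insert i J) \<omega> ^ 4)" using s4 by (simp add: eq)
    show "expectation (?L (insert i J)) = 0" using s.mean IH by (simp add: eq)
    show "expectation (\<lambda>\<omega>. (?L (insert i J) \<omega>)\<^sup>2) =
        (\<Sum>i\<in>insert i J. (b i)\<^sup>2 * expectation (\<lambda>\<omega>. (Z i \<omega>)\<^sup>2))"
      using s.second_moment insert.hyps IH by (simp add: eq prob_space algebra_simps)
    show "expectation (\<lambda>\<omega>. ?L (insert i J) \<omega> ^ 4) \<le> (5 * m * (\<Sum>i\<in>insert i J. (b i)\<^sup>2))\<^sup>2"
      using s4 insert.hyps by (simp add: eq algebra_simps) }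
qed auto

text \<open>With \<open>j < k\<close> the inner sum involves earlier variables only, so raising
  \<open>n\<close> by one is an affine step in the variable \<open>Suc n\<close>.\<close>

definition chaos :: "nat \<Rightarrow> (nat \<Rightarrow> nat \<Rightarrow> real) \<Rightarrow> (nat \<Rightarrow> real) \<Rightarrow> real" where
  "chaos n b z = (\<Sum>k=1..n. z k * (\<Sum>j=1..<k. b j k * z j))"

text \<open>The affine step has the shorter chaos as \<open>X\<close>, a linear form in the earlier
  variables as \<open>Y\<close> and the new variable as \<open>U\<close>. The linear form
  contributes one factor \<open>5 * m\<close> and the step another, which gives
  \<open>25 * m^2\<close> for every \<open>n\<close>: a comparison of fourth and second moments as
  in hypercontractivity.\<close>

lemma (in prob_space) chaos_moments:
  fixes Z :: "nat \<Rightarrow> 'a \<Rightarrow> real"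
  assumes indep: "indep_vars (\<lambda>_. borel) Z {1..p}"
    and Z4: "\<And>i. i \<in> {1..p} \<Longrightarrow> integrable M (\<lambda>\<omega>. Z i \<omega> ^ 4)"
      "\<And>i. i \<in> {1..p} \<Longrightarrow> expectation (\<lambda>\<omega>. Z i \<omega> ^ 4) \<le> m" and m: "1 \<le> m"
    and centred: "\<And>i. i \<in> {1..p} \<Longrightarrow> expectation (Z i) = 0"
    and var: "\<And>i. i \<in> {1..p} \<Longrightarrow> expectation (\<lambda>\<omega>. (Z i \<omega>)\<^sup>2) = v"
    and n: "n \<le> p"
  shows "integrable M (\<lambda>\<omega>. chaos n b (\<lambda>k. Z k \<omega>) ^ 4)"
    and "expectation (\<lambda>\<omega>. chaos n b (\<lambda>k. Z k \<omega>)) = 0"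
    and "expectation (\<lambda>\<omega>. (chaos n b (\<lambda>k. Z k \<omega>))\<^sup>2) = v\<^sup>2 * (\<Sum>k=1..n. \<Sum>j=1..<k. (b j k)\<^sup>2)"
    and "expectation (\<lambda>\<omega>. chaos n b (\<lambda>k. Z k \<omega>) ^ 4) \<le>
      (25 * m\<^sup>2 * (\<Sum>k=1..n. \<Sum>j=1..<k. (b j k)\<^sup>2))\<^sup>2"
  using n
proof (induction n)
  case 0
  { case 1 show ?case by (simp add: chaos_def) next
    case 2 show ?case by (simp add: chaos_def) next
    case 3 show ?case by (simp add: chaos_def) next
    case 4 show ?case by (simp add: chaos_def) }
next
  case (Suc n)
  let ?Q = "\<lambda>n \<omega>. chaos n b (\<lambda>k. Z k \<omega>)"
  let ?L = "\<lambda>\<omega>. \<Sum>j=1..<Suc n. b j (Suc n) * Z j \<omega>"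
  let ?\<beta> = "\<Sum>j=1..<Suc n. (b j (Suc n))\<^sup>2"
  let ?B = "\<lambda>n. \<Sum>k=1..n. \<Sum>j=1..<k. (b j k)\<^sup>2"
  have eq: "?Q (Suc n) \<omega> = ?Q n \<omega> + Z (Suc n) \<omega> * ?L \<omega>" for \<omega>
    by (simp add: chaos_def)
  have nonneg: "0 \<le> ?\<beta>" "0 \<le> ?B n" by (intro sum_nonneg zero_le_power2)+
  { assume n: "Suc n \<le> p"
    note IH = Suc.IH[OF Suc_leD[OF n]]
    have sub: "finite {1..<Suc n}" "{1..<Suc n} \<subseteq> {1..p}" using n by auto
    have L: "integrable M (\<lambda>\<omega>. ?L \<omega> ^ 4)"
      "expectation (\<lambda>\<omega>. (?L \<omega>)\<^sup>2) = (\<Sum>i=1..<Suc n. (b i (Suc n))\<^sup>2 * expectation (\<lambda>\<omega>. (Z i \<omega>)\<^sup>2))"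
      "expectation (\<lambda>\<omega>. ?L \<omega> ^ 4) \<le> (5 * m * ?\<beta>)\<^sup>2"
      by (rule linear_form_moments[OF indep sub Z4 m centred], assumption+)+
    have L2: "expectation (\<lambda>\<omega>. (?L \<omega>)\<^sup>2) = v * ?\<beta>"
      unfolding L(2) sum_distrib_left using var n by (intro sum.cong) auto
    interpret s: affine_step M "?Q n" ?L "Z (Suc n)"
    proof (rule affine_stepI[where f = "chaos n b" and h = "\<lambda>x. \<Sum>j=1..<Suc n. b j (Suc n) * x j"
          and J = "{1..n}", OF indep])
      show "?Q n \<omega> = chaos n b (\<lambda>j\<in>{1..n}. Z j \<omega>)" for \<omega>
        unfolding chaos_def by (intro sum.cong arg_cong2[where f = "(*)"]) auto
      show "?L \<omega> = (\<Sum>j=1..<Suc n. b j (Suc n) * (\<lambda>j\<in>{1..n}. Z j \<omega>) j)" for \<omega>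
        by (intro sum.cong) auto
      show "chaos n b \<in> borel_measurable (Pi\<^sub>M {1..n} (\<lambda>_. borel))"
        unfolding chaos_def
        by (intro borel_measurable_sum borel_measurable_times borel_measurable_const
            measurable_component_singleton) auto
      show "(\<lambda>x. \<Sum>j=1..<Suc n. b j (Suc n) * x j) \<in> borel_measurable (Pi\<^sub>M {1..n} (\<lambda>_. borel))"
        by (intro borel_measurable_sum borel_measurable_times borel_measurable_const
            measurable_component_singleton) auto
    qed (use n Z4 centred L IH in auto)
    have mem: "Suc n \<in> {1..p}" using n by simp
    have pos: "0 \<le> 25 * m\<^sup>2 * ?B n" "0 \<le> 5 * m * ?\<beta>"
      using nonneg m by (auto intro!: mult_nonneg_nonneg simp del: sum.op_ivl_Suc)
    have s4: "integrable M (\<lambda>\<omega>. (?Q n \<omega> + Z (Suc n) \<omega> * ?L \<omega>) ^ 4)"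
      "expectation (\<lambda>\<omega>. (?Q n \<omega> + Z (Suc n) \<omega> * ?L \<omega>) ^ 4) \<le>
        (25 * m\<^sup>2 * ?B n + 5 * m * (5 * m * ?\<beta>))\<^sup>2"
      by (rule s.fourth_moment[OF Z4(2)[OF mem] m IH(4) pos(1) L(3) pos(2)])+
    show "integrable M (\<lambda>\<omega>. ?Q (Suc n) \<omega> ^ 4)" using s4 by (simp only: eq)
    show "expectation (?Q (Suc n)) = 0" using s.mean IH by (simp only: eq)
    show "expectation (\<lambda>\<omega>. (?Q (Suc n) \<omega>)\<^sup>2) = v\<^sup>2 * ?B (Suc n)"
      using IH(3) L2 var[of "Suc n"] n
      by (simp only: eq s.second_moment) (simp add: power2_eq_square algebra_simps)
    have "?B (Suc n) = ?B n + ?\<beta>" by simp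
    then show "expectation (\<lambda>\<omega>. ?Q (Suc n) \<omega> ^ 4) \<le> (25 * m\<^sup>2 * ?B (Suc n))\<^sup>2"
      using s4 by (simp only: eq) (simp add: power2_eq_square algebra_simps) }
qed

section \<open>Contrasts of periodograms\<close>

lemma sum_square_deviation:
  assumes "finite A"
  shows "(\<Sum>l\<in>A. (x l - emp_mean A x)\<^sup>2) = (\<Sum>l\<in>A. (x l)\<^sup>2) - (\<Sum>l\<in>A. x l)\<^sup>2 / real (card A)"
proof (cases "A = {}")
  case False
  let ?n = "real (card A)" and ?s = "\<Sum>l\<in>A. x l"
  have n: "?n \<noteq> 0" using assms False by simp
  have "(\<Sum>l\<in>A. (x l - emp_mean A x)\<^sup>2) =
      (\<Sum>l\<in>A. (x l)\<^sup>2 - 2 * emp_mean A x * x l + (emp_mean A x)\<^sup>2)"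
    by (intro sum.cong) (auto simp: power2_diff)
  also have "\<dots> = (\<Sum>l\<in>A. (x l)\<^sup>2) - 2 * emp_mean A x * ?s + ?n * (emp_mean A x)\<^sup>2"
    by (simp add: sum.distrib sum_subtractf sum_distrib_left)
  also have "\<dots> = (\<Sum>l\<in>A. (x l)\<^sup>2) - ?s\<^sup>2 / ?n"
    using n by (simp add: emp_mean_def field_simps power2_eq_square)
  finally show ?thesis .
qed simp

text \<open>The rows of \<open>a\<close> are those of a Helmert matrix; the step adding one index is Welford's
  updating formula for the sum of squared deviations.\<close>

lemma helmert_exists:
  assumes "finite A" "A \<noteq> {}"
  shows "\<exists>a :: nat \<Rightarrow> 'i \<Rightarrow> real.
    (\<forall>i<card A - 1. (\<Sum>l\<in>A. a i l) = 0) \<and>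
    (\<forall>i<card A - 1. \<forall>j<card A - 1. (\<Sum>l\<in>A. a i l * a j l) = (if i = j then 1 else 0)) \<and>
    (\<forall>x. (\<Sum>l\<in>A. (x l - emp_mean A x)\<^sup>2) = (\<Sum>i<card A - 1. (\<Sum>l\<in>A. a i l * x l)\<^sup>2))"
  using assms
proof (induction A rule: finite_ne_induct)
  case (singleton x)
  then show ?case by (simp add: emp_mean_def)
next
  case (insert y A)
  define n where "n = card A"
  have n: "n > 0" using insert by (simp add: n_def card_gt_0_iff)
  have card: "card (insert y A) - 1 = Suc (n - 1)" using insert n by (simp add: n_def)
  obtain a where a0: "\<And>i. i < n - 1 \<Longrightarrow> (\<Sum>l\<in>A. a i l) = 0"
    and a1: "\<And>i j. i < n - 1 \<Longrightarrow> j < n - 1 \<Longrightarrow> (\<Sum>l\<in>A. a i l * a j l) = (if i = j then 1 else 0)"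
    and a2: "\<And>x. (\<Sum>l\<in>A. (x l - emp_mean A x)\<^sup>2) = (\<Sum>i<n - 1. (\<Sum>l\<in>A. a i l * x l)\<^sup>2)"
    using insert.IH unfolding n_def by blast
  \<comment> \<open>The new row is \<open>c\<close> at \<open>y\<close> and \<open>- c / n\<close>
    on \<open>A\<close>. It sums to 0 and is orthogonal to all rows that sum to 0 on
    \<open>A\<close>; its squared length \<open>c^2 * (1 + 1 / n)\<close> is 1 for this
    \<open>c\<close>.\<close>
  define c where "c = sqrt (real n / (real n + 1))"
  define a' where "a' i l = (if i < n - 1 then (if l = y then 0 else a i l)
      else if l = y then c else - c / real n)" for i l
  have c2: "c\<^sup>2 = real n / (real n + 1)" by (simp add: c_def)
  have old: "(\<Sum>l\<in>insert y A. a' i l * x l) = (\<Sum>l\<in>A. a i l * x l)" if "i < n - 1" for i x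
  proof -
    have "(\<Sum>l\<in>A. a' i l * x l) = (\<Sum>l\<in>A. a i l * x l)"
      using that insert by (intro sum.cong) (auto simp: a'_def)
    then show ?thesis using that insert by (simp add: a'_def)
  qed
  have new: "(\<Sum>l\<in>insert y A. a' (n - 1) l * x l) = c * (x y - (\<Sum>l\<in>A. x l) / real n)" for x
  proof -
    have "(\<Sum>l\<in>A. a' (n - 1) l * x l) = (\<Sum>l\<in>A. - c / real n * x l)"
      using insert by (intro sum.cong) (auto simp: a'_def)
    also have "\<dots> = - c / real n * (\<Sum>l\<in>A. x l)" by (rule sum_distrib_left[symmetric])
    finally show ?thesis using insert.hyps by (simp add: a'_def algebra_simps)
  qed
  have z: "(\<Sum>l\<in>insert y A. a' i l) = 0" if "i < Suc (n - 1)" for i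
  proof (cases "i < n - 1")
    case True
    then show ?thesis using old[of i "\<lambda>_. 1"] a0 by simp
  next
    case False
    then have "i = n - 1" using that by simp
    then show ?thesis using new[of "\<lambda>_. 1"] n by (simp add: n_def)
  qed
  have cross: "(\<Sum>l\<in>insert y A. a' (n - 1) l * a' j l) = 0" if "j < n - 1" for j
  proof -
    have "(\<Sum>l\<in>A. a' j l) = (\<Sum>l\<in>A. a j l)"
      using that insert by (intro sum.cong) (auto simp: a'_def)
    then show ?thesis using new[of "a' j"] a0 that by (simp add: a'_def)
  qed
  have diag: "(\<Sum>l\<in>insert y A. a' (n - 1) l * a' (n - 1) l) = 1"
  proof -
    have "(\<Sum>l\<in>A. a' (n - 1) l) = (\<Sum>l\<in>A. - c / real n)"
      using insert by (intro sum.cong) (auto simp: a'_def)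
    also have "\<dots> = - c" using n by (simp add: n_def)
    finally have "(\<Sum>l\<in>insert y A. a' (n - 1) l * a' (n - 1) l) = c * (c - - c / real n)"
      unfolding new by (simp add: a'_def)
    also have "\<dots> = c\<^sup>2 * (1 + 1 / real n)" by (simp add: power2_eq_square algebra_simps)
    also have "\<dots> = 1" using n by (simp add: c2 divide_simps)
    finally show ?thesis .
  qed
  have orth: "(\<Sum>l\<in>insert y A. a' i l * a' j l) = (if i = j then 1 else 0)"
    if ij: "i < Suc (n - 1)" "j < Suc (n - 1)" for i j
  proof -
    consider "i < n - 1" "j < n - 1" | "i = n - 1" "j < n - 1" | "i < n - 1" "j = n - 1"
      | "i = n - 1" "j = n - 1" using ij unfolding less_Suc_eq by blast
    then show ?thesis
    proof cases
      case 1
      have "(\<Sum>l\<in>A. a i l * a' j l) = (\<Sum>l\<in>A. a i l * a j l)"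
        using 1 insert by (intro sum.cong) (auto simp: a'_def)
      then show ?thesis using 1 old a1 by simp
    qed (use cross[of j] cross[of i] diag in \<open>auto simp: mult.commute\<close>)
  qed
  have parseval: "(\<Sum>l\<in>insert y A. (x l - emp_mean (insert y A) x)\<^sup>2) =
      (\<Sum>i<Suc (n - 1). (\<Sum>l\<in>insert y A. a' i l * x l)\<^sup>2)" for x
  proof -
    have "(\<Sum>i<Suc (n - 1). (\<Sum>l\<in>insert y A. a' i l * x l)\<^sup>2) =
        (\<Sum>l\<in>A. (x l - emp_mean A x)\<^sup>2) + c\<^sup>2 * (x y - (\<Sum>l\<in>A. x l) / real n)\<^sup>2"
      unfolding sum.lessThan_Suc a2 new power_mult_distrib
      by (simp only: sum.cong[OF refl, OF arg_cong[where f = power2, OF old, unfolded lessThan_iff[symmetric]]])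
    also have "\<dots> = (\<Sum>l\<in>A. (x l)\<^sup>2) - (\<Sum>l\<in>A. x l)\<^sup>2 / real n
        + real n / (real n + 1) * (x y - (\<Sum>l\<in>A. x l) / real n)\<^sup>2"
      by (simp add: sum_square_deviation[OF insert(1)] c2 n_def)
    also have "\<dots> = (x y)\<^sup>2 + (\<Sum>l\<in>A. (x l)\<^sup>2) - (x y + (\<Sum>l\<in>A. x l))\<^sup>2 / (real n + 1)"
    proof -
      have "q - s\<^sup>2 / r + r / (r + 1) * (t - s / r)\<^sup>2 = t\<^sup>2 + q - (t + s)\<^sup>2 / (r + 1)"
        if "r > 0" for q s r t :: real
      proof -
        have "r \<noteq> 0" "r + 1 \<noteq> 0" using that by auto
        then show ?thesis by (simp add: divide_simps) algebra
      qed
      then show ?thesis using n by simp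
    qed
    also have "\<dots> = (\<Sum>l\<in>insert y A. (x l - emp_mean (insert y A) x)\<^sup>2)"
      unfolding sum_square_deviation[OF finite.insertI[OF insert(1)]]
      using insert.hyps by (simp add: n_def add.commute)
    finally show ?thesis by (rule sym)
  qed
  show ?case unfolding card
    using z orth parseval by blast
qed

lemma sum_symmetric_pairs:
  fixes g :: "nat \<Rightarrow> nat \<Rightarrow> real"
  assumes "\<And>j k. g j k = g k j"
  shows "(\<Sum>k=1..n. \<Sum>j=1..n. g j k) = (\<Sum>k=1..n. g k k) + 2 * (\<Sum>k=1..n. \<Sum>j=1..<k. g j k)"
proof (induction n)
  case (Suc n)
  have "(\<Sum>k=1..n. g (Suc n) k) = (\<Sum>j=1..<Suc n. g j (Suc n))"
    using assms by (intro sum.cong) auto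
  with Suc show ?case
    by (simp add: sum.distrib atLeastLessThanSuc_atLeastAtMost del: sum.op_ivl_Suc)
qed simp

section \<open>Orthogonality of the trigonometric system at the fundamental frequencies\<close>

lemma sum_cis_roots:
  assumes "p > 0"
  shows "(\<Sum>k=1..p. cis (real k * (2 * pi * of_int m / real p))) = (if int p dvd m then of_nat p else 0)"
proof -
  define w where "w = cis (2 * pi * of_int m / real p)"
  have cis: "cis (real k * (2 * pi * of_int m / real p)) = w ^ k" for k
    by (simp only: w_def Complex.DeMoivre)
  have wp: "w ^ p = 1"
  proof -
    have "w ^ p = cis (2 * pi * of_int m)" using assms by (simp add: w_def Complex.DeMoivre)
    then show ?thesis by (simp only: cis_multiple_2pi Ints_of_int)
  qed
  have sum: "(\<Sum>k=1..p. w ^ k) = w * (\<Sum>k<p. w ^ k)"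
    by (simp add: sum_distrib_left sum.atLeast1_atMost_eq)
  have w1: "w = 1 \<longleftrightarrow> int p dvd m"
  proof
    assume "w = 1"
    then have "cos (2 * pi * of_int m / real p) = 1" by (simp add: w_def complex_eq_iff)
    then obtain j :: int where "2 * pi * of_int m / real p = of_int j * 2 * pi"
      using cos_one_2pi_int by blast
    then have "(of_int m :: real) = of_int (j * int p)" using assms by (simp add: field_simps)
    then have "m = j * int p" by (simp only: of_int_eq_iff)
    then show "int p dvd m" by simp
  next
    assume "int p dvd m"
    then obtain j where "m = int p * j" by auto
    then have "2 * pi * of_int m / real p = 2 * pi * of_int j" using assms by simp
    then show "w = 1" by (simp add: w_def cis_multiple_2pi)
  qed
  show ?thesis
  proof (cases "w = 1")
    case True
    then show ?thesis using w1 by (simp only: cis) simp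
  next
    case False
    then show ?thesis using w1 wp by (simp only: cis sum) (simp add: geometric_sum)
  qed
qed

lemma sum_cos_roots:
  assumes "p > 0"
  shows "(\<Sum>k=1..p. cos (real k * (2 * pi * of_int m / real p))) = (if int p dvd m then real p else 0)"
  using arg_cong[OF sum_cis_roots[OF assms, of m], of Re] by auto

lemma sum_sin_roots:
  assumes "p > 0"
  shows "(\<Sum>k=1..p. sin (real k * (2 * pi * of_int m / real p))) = 0"
  using arg_cong[OF sum_cis_roots[OF assms, of m], of Im] by (auto split: if_splits)

lemma fund_freq_diff: "real k * fund_freq p l - real k * fund_freq p m =
    real k * (2 * pi * of_int (int l - int m) / real p)"
  and fund_freq_add: "real k * fund_freq p l + real k * fund_freq p m =
    real k * (2 * pi * of_int (int l + int m) / real p)"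
  by (simp_all add: fund_freq_def diff_divide_distrib add_divide_distrib algebra_simps)

text \<open>The product formulas reduce everything to sums over roots of unity with indices
  \<open>l - m\<close> and \<open>l + m\<close>. In the given range \<open>p\<close> divides
  \<open>l - m\<close> only for \<open>l = m\<close>, and divides \<open>l + m\<close> only when
  both equal \<open>p / 2\<close>. The latter is the Nyquist case, where the sine vanishes at all
  integers and the cosine takes the values 1 and -1.\<close>

lemma fund_freq_orthogonality:
  assumes l: "l \<in> {1..p div 2}" and m: "m \<in> {1..p div 2}"
  shows "(\<Sum>k=1..p. cos (real k * fund_freq p l) * cos (real k * fund_freq p m)) =
      (if l = m then if 2 * l = p then real p else real p / 2 else 0)"
    and "(\<Sum>k=1..p. sin (real k * fund_freq p l) * sin (real k * fund_freq p m)) =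
      (if l = m then if 2 * l = p then 0 else real p / 2 else 0)"
    and "(\<Sum>k=1..p. cos (real k * fund_freq p l) * sin (real k * fund_freq p m)) = 0"
    and "(\<Sum>k=1..p. sin (real k * fund_freq p l) * cos (real k * fund_freq p m)) = 0"
proof -
  have p: "p > 0" using l by auto
  have dvd1: "int p dvd int l - int m \<longleftrightarrow> l = m"
  proof
    assume "int p dvd int l - int m"
    moreover have "\<bar>int l - int m\<bar> < int p" using l m by auto
    ultimately have "int l - int m = 0" using zdvd_not_zless[of "\<bar>int l - int m\<bar>" "int p"] by fastforce
    then show "l = m" by simp
  qed simp
  have dvd2: "int p dvd int l + int m \<longleftrightarrow> l = m \<and> 2 * l = p"
  proof
    assume *: "int p dvd int l + int m"
    then have "p \<le> l + m" using l m by (intro dvd_imp_le) (auto simp flip: of_nat_add)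
    moreover have "2 * l \<le> p" "2 * m \<le> p" using l m by auto
    ultimately show "l = m \<and> 2 * l = p" by linarith
  qed auto
  note sums = sum_cos_roots[OF p] sum_sin_roots[OF p] dvd1 dvd2
  note prods = cos_times_cos sin_times_sin cos_times_sin sin_times_cos fund_freq_diff fund_freq_add
    sum_divide_distrib[symmetric] sum.distrib sum_subtractf
  show "(\<Sum>k=1..p. cos (real k * fund_freq p l) * cos (real k * fund_freq p m)) =
      (if l = m then if 2 * l = p then real p else real p / 2 else 0)"
    unfolding prods sums by auto
  show "(\<Sum>k=1..p. sin (real k * fund_freq p l) * sin (real k * fund_freq p m)) =
      (if l = m then if 2 * l = p then 0 else real p / 2 else 0)"
    unfolding prods sums by auto
  show "(\<Sum>k=1..p. cos (real k * fund_freq p l) * sin (real k * fund_freq p m)) = 0"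
    unfolding prods sums by auto
  show "(\<Sum>k=1..p. sin (real k * fund_freq p l) * cos (real k * fund_freq p m)) = 0"
    unfolding prods sums by auto
qed

text \<open>By the addition theorem each cosine kernel has rank at most two, so the double sum
  factors into four squares of single sums. Cosine and sine contribute \<open>p^2 / 4\<close> each;
  at the Nyquist index the cosine alone contributes \<open>p^2\<close>.\<close>

lemma sum_cos_kernel:
  assumes l: "l \<in> {1..p div 2}" and m: "m \<in> {1..p div 2}"
  shows "(\<Sum>k=1..p. \<Sum>j=1..p. cos ((real k - real j) * fund_freq p l) * cos ((real k - real j) * fund_freq p m)) =
    (if l = m then if 2 * l = p then (real p)\<^sup>2 else (real p)\<^sup>2 / 2 else 0)"
proof -
  let ?c = "\<lambda>l k. cos (real k * fund_freq p l)" and ?s = "\<lambda>l k. sin (real k * fund_freq p l)"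
  have "(\<Sum>k=1..p. \<Sum>j=1..p. cos ((real k - real j) * fund_freq p l) * cos ((real k - real j) * fund_freq p m)) =
     (\<Sum>k=1..p. \<Sum>j=1..p. (?c l k * ?c m k) * (?c l j * ?c m j) + (?c l k * ?s m k) * (?c l j * ?s m j)
       + (?s l k * ?c m k) * (?s l j * ?c m j) + (?s l k * ?s m k) * (?s l j * ?s m j))"
    by (intro sum.cong refl) (simp add: left_diff_distrib cos_diff algebra_simps)
  also have "\<dots> = (\<Sum>k=1..p. ?c l k * ?c m k)\<^sup>2 + (\<Sum>k=1..p. ?c l k * ?s m k)\<^sup>2
      + (\<Sum>k=1..p. ?s l k * ?c m k)\<^sup>2 + (\<Sum>k=1..p. ?s l k * ?s m k)\<^sup>2"
    unfolding sum.distrib by (simp add: power2_eq_square sum_product)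
  also have "\<dots> = (if l = m then if 2 * l = p then (real p)\<^sup>2 else (real p)\<^sup>2 / 2 else 0)"
    unfolding fund_freq_orthogonality[OF l m] by (simp add: power_divide)
  finally show ?thesis .
qed

text \<open>The coefficient of \<open>u j * u k\<close> in the combination of periodograms with
  weights \<open>z\<close>. The factor 2 is present because a chaos runs over each pair
  once.\<close>

definition contrast_kernel :: "nat \<Rightarrow> nat set \<Rightarrow> (nat \<Rightarrow> real) \<Rightarrow> nat \<Rightarrow> nat \<Rightarrow> real" where
  "contrast_kernel p A z j k = 2 / real p * (\<Sum>l\<in>A. z l * cos ((real k - real j) * fund_freq p l))"

text \<open>Since the weights sum to 0, the kernel vanishes on the diagonal, and the sum over
  \<open>j < k\<close> is half the full double sum, which \<open>sum_cos_kernel\<close> evaluates.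
  The doubled value at the Nyquist index is the second sum. Through \<open>chaos_moments\<close>
  this is the exact variance of the contrast, up to the factor \<open>v^2\<close>.\<close>

lemma contrast_kernel_norm:
  assumes A: "A \<subseteq> {1..p div 2}" and z: "(\<Sum>l\<in>A. z l) = 0" and p: "p > 0"
  shows "(\<Sum>k=1..p. \<Sum>j=1..<k. (contrast_kernel p A z j k)\<^sup>2) =
    (\<Sum>l\<in>A. (z l)\<^sup>2) + (\<Sum>l\<in>A. if 2 * l = p then (z l)\<^sup>2 else 0)"
proof -
  have fin: "finite A" using A finite_subset by blast
  let ?g = "\<lambda>j k. (contrast_kernel p A z j k)\<^sup>2"
  let ?C = "\<lambda>l k j. cos ((real k - real j) * fund_freq p l)"
  have sym: "?g j k = ?g k j" for j k
  proof -
    have "?C l k j = ?C l j k" for l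
      using cos_minus[of "(real k - real j) * fund_freq p l"] by (simp add: algebra_simps)
    then show ?thesis by (simp add: contrast_kernel_def)
  qed
  have diag: "?g k k = 0" for k by (simp add: contrast_kernel_def z)
  have "2 * (\<Sum>k=1..p. \<Sum>j=1..<k. ?g j k) = (\<Sum>k=1..p. \<Sum>j=1..p. ?g j k)"
    using sum_symmetric_pairs[of ?g p, OF sym] diag by simp
  also have "\<dots> = (\<Sum>k=1..p. \<Sum>j=1..p. 4 / (real p)\<^sup>2 * (\<Sum>l\<in>A. \<Sum>m\<in>A. z l * z m * (?C l k j * ?C m k j)))"
    by (intro sum.cong refl)
      (simp add: contrast_kernel_def power_mult_distrib power_divide power2_eq_square[of "sum _ _"] sum_product
        algebra_simps)
  also have "\<dots> = 4 / (real p)\<^sup>2 * (\<Sum>l\<in>A. \<Sum>m\<in>A. z l * z m * (\<Sum>k=1..p. \<Sum>j=1..p. ?C l k j * ?C m k j))"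
  proof -
    have "(\<Sum>k=1..p. \<Sum>j=1..p. \<Sum>l\<in>A. \<Sum>m\<in>A. z l * z m * (?C l k j * ?C m k j)) =
      (\<Sum>k=1..p. \<Sum>l\<in>A. \<Sum>m\<in>A. \<Sum>j=1..p. z l * z m * (?C l k j * ?C m k j))"
      by (subst sum.swap, subst (2) sum.swap, rule refl)
    also have "\<dots> = (\<Sum>l\<in>A. \<Sum>m\<in>A. \<Sum>k=1..p. \<Sum>j=1..p. z l * z m * (?C l k j * ?C m k j))"
      by (subst sum.swap, subst (2) sum.swap, rule refl)
    finally have swap: "(\<Sum>k=1..p. \<Sum>j=1..p. \<Sum>l\<in>A. \<Sum>m\<in>A. z l * z m * (?C l k j * ?C m k j)) =
      (\<Sum>l\<in>A. \<Sum>m\<in>A. z l * z m * (\<Sum>k=1..p. \<Sum>j=1..p. ?C l k j * ?C m k j))"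
      by (simp only: sum_distrib_left)
    show ?thesis unfolding swap[symmetric] by (simp only: sum_distrib_left)
  qed
  also have "\<dots> = 4 / (real p)\<^sup>2 * (\<Sum>l\<in>A. \<Sum>m\<in>A. z l * z m *
      (if l = m then if 2 * l = p then (real p)\<^sup>2 else (real p)\<^sup>2 / 2 else 0))"
    using A by (intro arg_cong2[where f = "(*)"] sum.cong refl sum_cos_kernel) auto
  also have "\<dots> = 4 / (real p)\<^sup>2 * (\<Sum>l\<in>A. (z l)\<^sup>2 * (if 2 * l = p then (real p)\<^sup>2 else (real p)\<^sup>2 / 2))"
  proof -
    have "(\<Sum>m\<in>A. z l * z m * (if l = m then if 2 * l = p then (real p)\<^sup>2 else (real p)\<^sup>2 / 2 else 0)) =
      (z l)\<^sup>2 * (if 2 * l = p then (real p)\<^sup>2 else (real p)\<^sup>2 / 2)" if "l \<in> A" for l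
      using that fin by (subst sum.remove[of _ l]) (auto simp: power2_eq_square)
    then show ?thesis by simp
  qed
  also have "\<dots> = 2 * (\<Sum>l\<in>A. (z l)\<^sup>2 + (if 2 * l = p then (z l)\<^sup>2 else 0))"
    unfolding sum_distrib_left using p by (intro sum.cong refl) (auto simp: field_simps)
  finally show ?thesis by (simp add: sum.distrib)
qed

lemma periodogram_eq:
  "periodogram p u \<theta> = 1 / real p * (\<Sum>k=1..p. \<Sum>j=1..p. u j * u k * cos ((real k - real j) * \<theta>))"
proof -
  have "(\<Sum>k=1..p. of_real (u k) * exp (- (\<i> * of_nat k * of_real \<theta>))) =
      Complex (\<Sum>k=1..p. u k * cos (real k * \<theta>)) (- (\<Sum>k=1..p. u k * sin (real k * \<theta>)))"
  proof -
    have "exp (- (\<i> * of_nat k * of_real \<theta>)) = cis (- (real k * \<theta>))" for k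
      by (simp add: cis_conv_exp mult.assoc)
    then show ?thesis by (simp add: complex_eq_iff sum_negf)
  qed
  then have "(cmod (\<Sum>k=1..p. of_real (u k) * exp (- (\<i> * of_nat k * of_real \<theta>))))\<^sup>2 =
      (\<Sum>k=1..p. u k * cos (real k * \<theta>))\<^sup>2 + (\<Sum>k=1..p. u k * sin (real k * \<theta>))\<^sup>2"
    by (simp add: cmod_power2)
  also have "\<dots> = (\<Sum>k=1..p. \<Sum>j=1..p. u j * u k * cos ((real k - real j) * \<theta>))"
    by (simp add: power2_eq_square sum_product left_diff_distrib cos_diff sum.distrib[symmetric] algebra_simps)
  finally show ?thesis by (simp add: periodogram_def)
qed

text \<open>The diagonal terms do not depend on the frequency, so that a contrast removes them.\<close>

lemma contrast_periodogram:
  assumes z: "(\<Sum>l\<in>A. z l) = 0"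
  shows "(\<Sum>l\<in>A. z l * periodogram p u (fund_freq p l)) = chaos p (contrast_kernel p A z) u"
proof -
  let ?g = "\<lambda>l j k. u j * u k * cos ((real k - real j) * fund_freq p l)"
  have sym: "?g l j k = ?g l k j" for l j k
    using cos_minus[of "(real k - real j) * fund_freq p l"] by (simp add: algebra_simps)
  have "periodogram p u (fund_freq p l) = 1 / real p * (\<Sum>k=1..p. (u k)\<^sup>2)
      + 2 / real p * (\<Sum>k=1..p. \<Sum>j=1..<k. ?g l j k)" for l
    unfolding periodogram_eq sum_symmetric_pairs[of "?g l" p, OF sym]
    by (simp add: power2_eq_square distrib_left)
  then have "(\<Sum>l\<in>A. z l * periodogram p u (fund_freq p l)) =
      (\<Sum>l\<in>A. z l) * (1 / real p * (\<Sum>k=1..p. (u k)\<^sup>2))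
      + (\<Sum>l\<in>A. \<Sum>k=1..p. \<Sum>j=1..<k. 2 / real p * (z l * ?g l j k))"
    by (simp only: distrib_left sum.distrib sum_distrib_right) (simp add: sum_distrib_left mult.left_commute)
  also have "\<dots> = (\<Sum>k=1..p. \<Sum>j=1..<k. \<Sum>l\<in>A. 2 / real p * (z l * ?g l j k))"
    unfolding z by (subst sum.swap, subst (2) sum.swap) simp
  also have "\<dots> = chaos p (contrast_kernel p A z) u"
    unfolding chaos_def contrast_kernel_def sum_distrib_left sum_distrib_right
    by (intro sum.cong refl) (simp add: mult_ac)
  finally show ?thesis .
qed

section \<open>Gaussian replacement\<close>

text \<open>The dimension is an argument and not a type because it may change with \<open>T\<close>;
  coordinates from \<open>d\<close> on are ignored.\<close>

definition dot :: "nat \<Rightarrow> (nat \<Rightarrow> real) \<Rightarrow> (nat \<Rightarrow> real) \<Rightarrow> real" where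
  "dot d x y = (\<Sum>i<d. x i * y i)"

lemma dot_self_nonneg [simp]: "0 \<le> dot d x x"
  by (auto simp: dot_def intro!: sum_nonneg)

lemma dot_cauchy_schwarz: "(dot d x y)\<^sup>2 \<le> dot d x x * dot d y y"
  using Cauchy_Schwarz_ineq_sum[of x y "{..<d}"] by (simp add: dot_def power2_eq_square)

lemma dot_translate: "dot d (\<lambda>i. x i + h * v i) (\<lambda>i. x i + h * v i) =
    dot d x x + (2 * h * dot d x v + h\<^sup>2 * dot d v v)"
  by (simp add: dot_def sum_distrib_left sum.distrib[symmetric] power2_eq_square algebra_simps)

lemma dot_self_square_le: "(dot d x x)\<^sup>2 \<le> real d * (\<Sum>i<d. x i ^ 4)"
  using sum_squared_le_sum_of_squares[of "\<lambda>i. x i * x i" "{..<d}"]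
  by (simp add: dot_def power2_eq_square power4_eq_xxxx mult.assoc mult.commute[of _ "real d"])

definition unit_vec :: "nat \<Rightarrow> nat \<Rightarrow> real" where
  "unit_vec i = (\<lambda>j. if j = i then 1 else 0)"

lemma dot_unit_vec: "i < d \<Longrightarrow> dot d (unit_vec i) x = x i"
    "i < d \<Longrightarrow> dot d x (unit_vec i) = x i"
  by (simp_all add: dot_def unit_vec_def if_distrib[where f = "\<lambda>a. a * _"] if_distrib[where f = "\<lambda>a. _ * a"]
      sum.delta cong: if_cong)

lemma unit_vec_self: "unit_vec i i = 1"
  by (simp add: unit_vec_def)

text \<open>The covariance matrix is the identity plus the rank-one matrix \<open>r r\<^sup>T\<close>; a frequency with
  doubled limiting variance produces a nonzero \<open>r\<close>.\<close>

locale whitened_law = prob_space \<nu> for \<nu> :: "(nat \<Rightarrow> real) measure" +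
  fixes d :: nat and r :: "nat \<Rightarrow> real" and C :: real
  assumes sets_eq: "sets \<nu> = sets (PiM {..<d} (\<lambda>_. borel))"
    and int4: "\<And>y. integrable \<nu> (\<lambda>v. dot d y v ^ 4)"
    and mean: "\<And>y. expectation (\<lambda>v. dot d y v) = 0"
    and second: "\<And>y. expectation (\<lambda>v. (dot d y v)\<^sup>2) = dot d y y + (dot d r y)\<^sup>2"
    and fourth: "\<And>y. expectation (\<lambda>v. dot d y v ^ 4) \<le> C * (dot d y y)\<^sup>2"
    and r_le: "dot d r r \<le> 1"
    and C_ge: "1 \<le> C"
begin

lemma component_meas [measurable]: "i < d \<Longrightarrow> (\<lambda>v. v i) \<in> borel_measurable \<nu>"
  using measurable_component_singleton[of i "{..<d}" "\<lambda>_. borel"]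
  by (simp add: measurable_cong_sets[OF sets_eq refl])

lemma dot_meas [measurable]: "dot d y \<in> borel_measurable \<nu>" "(\<lambda>v. dot d v v) \<in> borel_measurable \<nu>"
  unfolding dot_def by (intro borel_measurable_sum borel_measurable_times component_meas; simp)+

lemma int_power: "k \<le> 4 \<Longrightarrow> integrable \<nu> (\<lambda>v. dot d y v ^ k)"
  by (rule integrable_power_le4[OF finite_measure_axioms _ int4]) auto

lemma component:
  assumes "i < d"
  shows "integrable \<nu> (\<lambda>v. v i ^ 4)" "expectation (\<lambda>v. v i ^ 4) \<le> C"
    "integrable \<nu> (\<lambda>v. (v i)\<^sup>2)" "expectation (\<lambda>v. (v i)\<^sup>2) = 1 + (r i)\<^sup>2"
  using int4[of "unit_vec i"] fourth[of "unit_vec i"] int_power[of 2 "unit_vec i"] second[of "unit_vec i"] assms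
  by (simp_all add: dot_unit_vec unit_vec_self)

lemma second_le: "expectation (\<lambda>v. (dot d y v)\<^sup>2) \<le> 2 * dot d y y"
proof -
  have "(dot d r y)\<^sup>2 \<le> dot d r r * dot d y y" by (rule dot_cauchy_schwarz)
  also have "\<dots> \<le> 1 * dot d y y" by (intro mult_right_mono r_le) auto
  finally show ?thesis by (simp add: second)
qed

lemma norm_moments:
  shows "integrable \<nu> (\<lambda>v. dot d v v)" "expectation (\<lambda>v. dot d v v) = real d + dot d r r"
    "integrable \<nu> (\<lambda>v. (dot d v v)\<^sup>2)" "expectation (\<lambda>v. (dot d v v)\<^sup>2) \<le> C * (real d)\<^sup>2"
proof -
  have eq: "dot d v v = (\<Sum>i<d. (v i)\<^sup>2)" for v by (simp add: dot_def power2_eq_square)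
  show "integrable \<nu> (\<lambda>v. dot d v v)" "expectation (\<lambda>v. dot d v v) = real d + dot d r r"
    using component by (auto simp: eq sum.distrib)
  have int: "integrable \<nu> (\<lambda>v. real d * (\<Sum>i<d. v i ^ 4))"
    using component by auto
  show sq: "integrable \<nu> (\<lambda>v. (dot d v v)\<^sup>2)"
    using order_trans[OF dot_self_square_le abs_ge_self]
    by (intro Bochner_Integration.integrable_bound[OF int]) auto
  have "expectation (\<lambda>v. (dot d v v)\<^sup>2) \<le> expectation (\<lambda>v. real d * (\<Sum>i<d. v i ^ 4))"
    using sq int by (intro integral_mono dot_self_square_le)
  also have "\<dots> = real d * (\<Sum>i<d. expectation (\<lambda>v. v i ^ 4))"
    using component by simp
  also have "\<dots> \<le> real d * (\<Sum>i<d. C)"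
    using component by (intro mult_left_mono sum_mono) auto
  finally show "expectation (\<lambda>v. (dot d v v)\<^sup>2) \<le> C * (real d)\<^sup>2"
    by (simp add: power2_eq_square mult_ac)
qed

end

text \<open>Using the third-order bound only where \<open>\<bar>b\<bar> \<le> \<bar>a\<bar>\<close> keeps the remainder quadratic in \<open>b\<close>; as \<open>b\<close>
  is a squared length below, no moments of order six are needed.\<close>

lemma iexp_two_scale_taylor:
  fixes a b s \<alpha> :: real
  assumes \<alpha>: "\<alpha> > 0"
  shows "cmod (iexp (s * (a + b)) - (1 + \<i> * of_real (s * (a + b)) - of_real (s\<^sup>2 * a\<^sup>2 / 2)))
    \<le> 2 / 3 * \<bar>s\<bar> ^ 3 * (\<alpha> * a\<^sup>2 + a ^ 4 / \<alpha>) + s\<^sup>2 / 2 * (\<alpha> * a\<^sup>2 + b\<^sup>2 / \<alpha>) + 9 / 2 * s\<^sup>2 * b\<^sup>2"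
proof -
  define u where "u = s * (a + b)"
  \<comment> \<open>The weight \<open>\<alpha>\<close> turns the odd products
    \<open>|a| * a^2\<close> and \<open>|a| * |b|\<close> into moments that are controlled. It stays
    free until \<open>char_sum_squares_approx\<close> balances the two sides.\<close>
  have amgm: "2 * (\<bar>x\<bar> * \<bar>y\<bar>) \<le> \<alpha> * x\<^sup>2 + y\<^sup>2 / \<alpha>" for x y :: real
  proof -
    have "0 \<le> (\<alpha> * \<bar>x\<bar> - \<bar>y\<bar>)\<^sup>2 / \<alpha>" using \<alpha> by simp
    also have "\<dots> = \<alpha> * x\<^sup>2 + y\<^sup>2 / \<alpha> - 2 * (\<bar>x\<bar> * \<bar>y\<bar>)"
      using \<alpha> by (simp add: power2_diff power_mult_distrib field_simps power2_eq_square)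
    finally show ?thesis by simp
  qed
  have T2: "(\<Sum>k\<le>2. (\<i> * complex_of_real u) ^ k / fact k) = 1 + \<i> * u - of_real (u\<^sup>2 / 2)"
    by (simp add: numeral_2_eq_2 power_mult_distrib)
  have rest: "cmod (iexp u - (1 + \<i> * u - of_real (u\<^sup>2 / 2))) \<le> 4 / 3 * \<bar>s\<bar> ^ 3 * \<bar>a\<bar> ^ 3 + 4 * s\<^sup>2 * b\<^sup>2"
  proof (cases "\<bar>b\<bar> \<le> \<bar>a\<bar>")
    case True
    then have "\<bar>u\<bar> \<le> \<bar>s\<bar> * (2 * \<bar>a\<bar>)" by (auto simp: u_def abs_mult intro!: mult_left_mono)
    then have "\<bar>u\<bar> ^ 3 \<le> (\<bar>s\<bar> * (2 * \<bar>a\<bar>)) ^ 3" by (intro power_mono) auto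
    then have "\<bar>u\<bar> ^ 3 / 6 \<le> 4 / 3 * \<bar>s\<bar> ^ 3 * \<bar>a\<bar> ^ 3" by (simp add: power_mult_distrib)
    moreover have "cmod (iexp u - (1 + \<i> * u - of_real (u\<^sup>2 / 2))) \<le> \<bar>u\<bar> ^ 3 / 6"
      using iexp_approx1[of u 2] unfolding T2 by (simp add: fact_numeral)
    ultimately show ?thesis by (smt (verit) mult_nonneg_nonneg zero_le_power2)
  next
    case False
    then have "\<bar>u\<bar> \<le> \<bar>s\<bar> * (2 * \<bar>b\<bar>)" by (auto simp: u_def abs_mult intro!: mult_left_mono)
    then have "\<bar>u\<bar> ^ 2 \<le> (\<bar>s\<bar> * (2 * \<bar>b\<bar>)) ^ 2" by (intro power_mono) auto
    then have "\<bar>u\<bar> ^ 2 \<le> 4 * s\<^sup>2 * b\<^sup>2" by (simp add: power_mult_distrib)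
    moreover have "cmod (iexp u - (1 + \<i> * u - of_real (u\<^sup>2 / 2))) \<le> \<bar>u\<bar> ^ 2"
      using iexp_approx2[of u 2] unfolding T2 by simp
    moreover have "0 \<le> 4 / 3 * \<bar>s\<bar> ^ 3 * \<bar>a\<bar> ^ 3" by simp
    ultimately show ?thesis by linarith
  qed
  \<comment> \<open>Only \<open>a^2\<close> is kept from \<open>(a + b)^2\<close>: with
    \<open>a\<close> linear and \<open>b\<close> quadratic in a random vector, \<open>a * b\<close>
    would bring in third moments, which the two laws to be compared need not share.\<close>
  have "cmod (iexp u - (1 + \<i> * of_real u - of_real (s\<^sup>2 * a\<^sup>2 / 2)))
      \<le> cmod (iexp u - (1 + \<i> * u - of_real (u\<^sup>2 / 2))) + cmod (of_real (s\<^sup>2 * a\<^sup>2 / 2 - u\<^sup>2 / 2))"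
    by (rule order_trans[OF _ norm_triangle_ineq]) (simp add: algebra_simps)
  also have "\<dots> \<le> 4 / 3 * \<bar>s\<bar> ^ 3 * \<bar>a\<bar> ^ 3 + 4 * s\<^sup>2 * b\<^sup>2 + (s\<^sup>2 * (\<bar>a\<bar> * \<bar>b\<bar>) + s\<^sup>2 * b\<^sup>2 / 2)"
  proof (intro add_mono rest)
    have "s\<^sup>2 * a\<^sup>2 / 2 - u\<^sup>2 / 2 = - (s\<^sup>2 * (a * b)) - s\<^sup>2 * b\<^sup>2 / 2"
      by (simp add: u_def power_mult_distrib power2_eq_square algebra_simps)
    then have "\<bar>s\<^sup>2 * a\<^sup>2 / 2 - u\<^sup>2 / 2\<bar> \<le> \<bar>s\<^sup>2 * (a * b)\<bar> + \<bar>s\<^sup>2 * b\<^sup>2 / 2\<bar>" by linarith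
    then show "cmod (of_real (s\<^sup>2 * a\<^sup>2 / 2 - u\<^sup>2 / 2)) \<le> s\<^sup>2 * (\<bar>a\<bar> * \<bar>b\<bar>) + s\<^sup>2 * b\<^sup>2 / 2"
      by (simp only: norm_of_real) (simp add: abs_mult)
  qed
  also have "\<dots> = 2 / 3 * \<bar>s\<bar> ^ 3 * (2 * (\<bar>a\<bar> * \<bar>a\<^sup>2\<bar>)) + s\<^sup>2 / 2 * (2 * (\<bar>a\<bar> * \<bar>b\<bar>)) + 9 / 2 * s\<^sup>2 * b\<^sup>2"
    by (simp add: power2_eq_square power3_eq_cube algebra_simps abs_mult)
  also have "\<dots> \<le> 2 / 3 * \<bar>s\<bar> ^ 3 * (\<alpha> * a\<^sup>2 + (a\<^sup>2)\<^sup>2 / \<alpha>) + s\<^sup>2 / 2 * (\<alpha> * a\<^sup>2 + b\<^sup>2 / \<alpha>) + 9 / 2 * s\<^sup>2 * b\<^sup>2"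
    by (intro add_mono mult_left_mono amgm) auto
  finally show ?thesis by (simp add: u_def)
qed

lemma norm_integral_le:
  fixes f :: "'a \<Rightarrow> 'b::{banach, second_countable_topology}"
  assumes "integrable M f" "integrable M g" "\<And>x. x \<in> space M \<Longrightarrow> norm (f x) \<le> g x"
  shows "norm (LINT x|M. f x) \<le> (LINT x|M. g x)"
  by (rule order_trans[OF integral_norm_bound integral_mono]) (use assms in auto)

text \<open>The exponential splits off the factor \<open>iexp (s * dot d x x)\<close> of modulus 1,
  and the expansion of the rest involves only the mean and the covariance of the law, hence only
  \<open>d\<close> and \<open>r\<close>. Laws with the same covariance thus have the same main
  term.\<close>

lemma (in whitened_law) one_step:
  assumes \<alpha>: "\<alpha> > 0"
  shows "cmod ((LINT v|\<nu>. iexp (s * dot d (\<lambda>i. x i + h * v i) (\<lambda>i. x i + h * v i))) -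
      iexp (s * dot d x x) * (1 + \<i> * of_real (s * h\<^sup>2 * (real d + dot d r r))
        - of_real (2 * s\<^sup>2 * h\<^sup>2 * (dot d x x + (dot d r x)\<^sup>2))))
    \<le> 8 * \<alpha> * h\<^sup>2 * (2 / 3 * \<bar>s\<bar> ^ 3 + s\<^sup>2 / 2) * dot d x x
      + 32 / 3 * \<bar>s\<bar> ^ 3 * C * h ^ 4 / \<alpha> * (dot d x x)\<^sup>2
      + s\<^sup>2 * C * h ^ 4 * (real d)\<^sup>2 * (1 / (2 * \<alpha>) + 9 / 2)"
proof -
  define a where "a v = 2 * h * dot d x v" for v
  define b where "b v = h\<^sup>2 * dot d v v" for v
  define R where "R v = 2 / 3 * \<bar>s\<bar> ^ 3 * (\<alpha> * (a v)\<^sup>2 + a v ^ 4 / \<alpha>) + s\<^sup>2 / 2 * (\<alpha> * (a v)\<^sup>2 + (b v)\<^sup>2 / \<alpha>)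
    + 9 / 2 * s\<^sup>2 * (b v)\<^sup>2" for v
  define P where "P v = 1 + \<i> * complex_of_real (s * (a v + b v)) - of_real (s\<^sup>2 * (a v)\<^sup>2 / 2)" for v
  have [measurable]: "a \<in> borel_measurable \<nu>" "b \<in> borel_measurable \<nu>"
    unfolding a_def b_def by measurable
  have int1: "integrable \<nu> a" "integrable \<nu> b" "integrable \<nu> (\<lambda>v. (a v)\<^sup>2)" "integrable \<nu> (\<lambda>v. a v ^ 4)"
      "integrable \<nu> (\<lambda>v. (b v)\<^sup>2)"
    using int_power[of 1 x] int_power[of 2 x] int4[of x] norm_moments
    by (auto simp: a_def[abs_def] b_def[abs_def] power_mult_distrib)
  have E: "expectation a = 0" "expectation b = h\<^sup>2 * (real d + dot d r r)"
      "expectation (\<lambda>v. (a v)\<^sup>2) = 4 * h\<^sup>2 * (dot d x x + (dot d r x)\<^sup>2)"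
    using mean[of x] second[of x] norm_moments by (auto simp: a_def[abs_def] b_def[abs_def] power_mult_distrib)
  have Ea2: "expectation (\<lambda>v. (a v)\<^sup>2) \<le> 8 * h\<^sup>2 * dot d x x"
    using mult_left_mono[OF second_le[of x], of "4 * h\<^sup>2"] second[of x]
    by (simp add: a_def power_mult_distrib)
  have Ea4: "expectation (\<lambda>v. a v ^ 4) \<le> 16 * h ^ 4 * (C * (dot d x x)\<^sup>2)"
    using mult_left_mono[OF fourth[of x], of "16 * h ^ 4"] by (simp add: a_def power_mult_distrib)
  have Eb2: "expectation (\<lambda>v. (b v)\<^sup>2) \<le> h ^ 4 * (C * (real d)\<^sup>2)"
    using mult_left_mono[OF norm_moments(4), of "h ^ 4"] by (simp add: b_def power_mult_distrib)
  have iP: "integrable \<nu> P" unfolding P_def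
    by (intro Bochner_Integration.integrable_diff Bochner_Integration.integrable_add integrable_const
        integrable_mult_right integrable_of_real) (use int1 in auto)
  have EP: "(LINT v|\<nu>. P v) = 1 + \<i> * of_real (s * h\<^sup>2 * (real d + dot d r r))
        - of_real (2 * s\<^sup>2 * h\<^sup>2 * (dot d x x + (dot d r x)\<^sup>2))"
  proof -
    have "(LINT v|\<nu>. P v) = 1 + \<i> * of_real (LINT v|\<nu>. s * (a v + b v)) - of_real (LINT v|\<nu>. s\<^sup>2 * (a v)\<^sup>2 / 2)"
      unfolding P_def using int1 by (simp add: prob_space del: of_real_add of_real_mult of_real_divide)
    moreover have "(LINT v|\<nu>. s * (a v + b v)) = s * h\<^sup>2 * (real d + dot d r r)"
      using int1 E by simp
    moreover have "(LINT v|\<nu>. s\<^sup>2 * (a v)\<^sup>2 / 2) = 2 * s\<^sup>2 * h\<^sup>2 * (dot d x x + (dot d r x)\<^sup>2)"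
      using int1 E by simp
    ultimately show ?thesis by (simp only:)
  qed
  have iR: "integrable \<nu> R" unfolding R_def using int1 by auto
  have ii: "integrable \<nu> (\<lambda>v. iexp (s * (a v + b v)))"
    by (rule integrable_iexp) auto
  have split: "iexp (s * dot d (\<lambda>i. x i + h * v i) (\<lambda>i. x i + h * v i)) = iexp (s * dot d x x) * iexp (s * (a v + b v))" for v
    unfolding dot_translate a_def b_def by (simp add: distrib_left exp_add[symmetric])
  have "(LINT v|\<nu>. iexp (s * dot d (\<lambda>i. x i + h * v i) (\<lambda>i. x i + h * v i))) - iexp (s * dot d x x) * (LINT v|\<nu>. P v)
      = iexp (s * dot d x x) * (LINT v|\<nu>. iexp (s * (a v + b v)) - P v)"
    unfolding split using ii iP by (simp add: right_diff_distrib)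
  also have "cmod \<dots> = cmod (LINT v|\<nu>. iexp (s * (a v + b v)) - P v)"
    by (simp add: norm_mult)
  also have "\<dots> \<le> (LINT v|\<nu>. R v)"
  proof (rule norm_integral_le)
    show "cmod (iexp (s * (a v + b v)) - P v) \<le> R v" for v
      unfolding P_def R_def by (rule iexp_two_scale_taylor[OF \<alpha>])
  qed (use ii iP iR in auto)
  also have "\<dots> = 2 / 3 * \<bar>s\<bar> ^ 3 * (\<alpha> * expectation (\<lambda>v. (a v)\<^sup>2) + expectation (\<lambda>v. a v ^ 4) / \<alpha>)
      + s\<^sup>2 / 2 * (\<alpha> * expectation (\<lambda>v. (a v)\<^sup>2) + expectation (\<lambda>v. (b v)\<^sup>2) / \<alpha>)
      + 9 / 2 * s\<^sup>2 * expectation (\<lambda>v. (b v)\<^sup>2)"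
    unfolding R_def using int1 by simp
  also have "\<dots> \<le> 2 / 3 * \<bar>s\<bar> ^ 3 * (\<alpha> * (8 * h\<^sup>2 * dot d x x) + (16 * h ^ 4 * (C * (dot d x x)\<^sup>2)) / \<alpha>)
      + s\<^sup>2 / 2 * (\<alpha> * (8 * h\<^sup>2 * dot d x x) + (h ^ 4 * (C * (real d)\<^sup>2)) / \<alpha>)
      + 9 / 2 * s\<^sup>2 * (h ^ 4 * (C * (real d)\<^sup>2))"
    using \<alpha> by (intro add_mono mult_left_mono divide_right_mono Ea2 Ea4 Eb2) auto
  also have "\<dots> = 8 * \<alpha> * h\<^sup>2 * (2 / 3 * \<bar>s\<bar> ^ 3 + s\<^sup>2 / 2) * dot d x x
      + 32 / 3 * \<bar>s\<bar> ^ 3 * C * h ^ 4 / \<alpha> * (dot d x x)\<^sup>2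
      + s\<^sup>2 * C * h ^ 4 * (real d)\<^sup>2 * (1 / (2 * \<alpha>) + 9 / 2)"
    by (simp add: algebra_simps add_divide_distrib)
  finally show ?thesis unfolding EP .
qed

section \<open>Independent vectors and their replacement one at a time\<close>

lemma indep_vars_PiM_components:
  assumes N: "\<And>i. i \<in> I \<Longrightarrow> prob_space (N i)"
  shows "prob_space.indep_vars (PiM I N) N (\<lambda>i \<omega>. \<omega> i) I"
proof -
  interpret P: prob_space "PiM I N" by (rule prob_space_PiM[OF N])
  show ?thesis
  proof (cases "I = {}")
    case True
    then show ?thesis unfolding P.indep_vars_def P.indep_sets_def by auto
  next
    case False
    have "distr (PiM I N) (PiM I N) (\<lambda>x. \<lambda>i\<in>I. x i) = distr (PiM I N) (PiM I N) (\<lambda>x. x)"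
      by (rule distr_cong) (auto simp: space_PiM)
    moreover have "(\<Pi>\<^sub>M i\<in>I. distr (PiM I N) (N i) (\<lambda>\<omega>. \<omega> i)) = PiM I N"
      by (intro PiM_cong refl distr_PiM_component N)
    ultimately show ?thesis
      using False by (subst P.indep_vars_iff_distr_eq_PiM') auto
  qed
qed

text \<open>The laws may differ between indices because the partially replaced sums mix original and
  Gaussian vectors. Applying \<open>linear_form_moments\<close> to each coordinate of the sum gives
  fourth moments at most \<open>25 * C^2\<close>, however many summands there are.\<close>

lemma product_law_moments:
  fixes N :: "nat \<Rightarrow> (nat \<Rightarrow> real) measure"
  assumes N: "\<And>t. whitened_law (N t) d (R t) C" and I: "finite I" and h: "real (card I) * h\<^sup>2 \<le> 1"
  defines "S \<equiv> \<lambda>\<omega> i. h * (\<Sum>t\<in>I. \<omega> t i)"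
  shows "integrable (PiM I N) (\<lambda>\<omega>. dot d (S \<omega>) (S \<omega>))"
    and "(LINT \<omega>|PiM I N. dot d (S \<omega>) (S \<omega>)) \<le> 2 * real d"
    and "integrable (PiM I N) (\<lambda>\<omega>. (dot d (S \<omega>) (S \<omega>))\<^sup>2)"
    and "(LINT \<omega>|PiM I N. (dot d (S \<omega>) (S \<omega>))\<^sup>2) \<le> 25 * C\<^sup>2 * (real d)\<^sup>2"
    and "integrable (PiM I N) (\<lambda>\<omega>. (dot d y (S \<omega>))\<^sup>2)"
    and "(LINT \<omega>|PiM I N. (dot d y (S \<omega>))\<^sup>2) \<le> 2 * dot d y y"
proof -
  interpret N: whitened_law "N t" d "R t" C for t by (rule N)
  interpret P: prob_space "PiM I N" by (rule prob_space_PiM) unfold_locales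
  have C: "1 \<le> C" by (rule N.C_ge)
  have comp: "distr (PiM I N) (N t) (\<lambda>\<omega>. \<omega> t) = N t" if "t \<in> I" for t
    using that by (intro distr_PiM_component) unfold_locales
  have transfer: "integrable (PiM I N) (\<lambda>\<omega>. f (\<omega> t)) = integrable (N t) f"
      "P.expectation (\<lambda>\<omega>. f (\<omega> t)) = integral\<^sup>L (N t) f"
    if "t \<in> I" "f \<in> borel_measurable (N t)" for t and f :: "_ \<Rightarrow> real"
    using that comp[OF that(1)] integrable_distr_eq[of "\<lambda>\<omega>. \<omega> t" "PiM I N" "N t" f]
      integral_distr[of "\<lambda>\<omega>. \<omega> t" "PiM I N" "N t" f] by auto
  have indep: "P.indep_vars (\<lambda>_. borel) (\<lambda>t \<omega>. dot d y (\<omega> t)) I" for y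
    by (rule P.indep_vars_compose2[OF indep_vars_PiM_components]) (unfold_locales, rule N.dot_meas)
  have dotS: "dot d y (S \<omega>) = (\<Sum>t\<in>I. h * dot d y (\<omega> t))" for y \<omega>
    unfolding S_def dot_def sum_distrib_left
    by (subst sum.swap) (simp add: mult_ac)
  note lin = P.linear_form_moments[OF indep I subset_refl, where b = "\<lambda>_. h"]
  have int_pow: "integrable (PiM I N) (\<lambda>\<omega>. dot d y (\<omega> t) ^ 4)"
      "P.expectation (\<lambda>\<omega>. dot d y (\<omega> t) ^ 4) \<le> C * (dot d y y)\<^sup>2"
      "P.expectation (\<lambda>\<omega>. dot d y (\<omega> t)) = 0"
      "P.expectation (\<lambda>\<omega>. (dot d y (\<omega> t))\<^sup>2) \<le> 2 * dot d y y"
    if "t \<in> I" for t y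
    using N.int4 N.fourth N.mean N.second_le that
    by (simp_all add: transfer[OF that, of "\<lambda>v. dot d y v ^ 4"] transfer[OF that, of "\<lambda>v. dot d y v"]
        transfer[OF that, of "\<lambda>v. (dot d y v)\<^sup>2"])
  have S4: "integrable (PiM I N) (\<lambda>\<omega>. dot d y (S \<omega>) ^ 4)"
      "P.expectation (\<lambda>\<omega>. (dot d y (S \<omega>))\<^sup>2) \<le> 2 * dot d y y"
      "P.expectation (\<lambda>\<omega>. dot d y (S \<omega>) ^ 4) \<le> (5 * max 1 (C * (dot d y y)\<^sup>2))\<^sup>2" for y
  proof -
    \<comment> \<open>The maximum supplies \<open>1 \<le> m\<close> for
      \<open>linear_form_moments\<close>; for unit vectors it equals \<open>C\<close>.\<close>
    let ?m = "max 1 (C * (dot d y y)\<^sup>2)"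
    have le: "P.expectation (\<lambda>\<omega>. dot d y (\<omega> t) ^ 4) \<le> ?m" if "t \<in> I" for t
      using int_pow(2)[OF that, of y] by simp
    note l = lin[of y ?m, OF int_pow(1) le _ int_pow(3)]
    show "integrable (PiM I N) (\<lambda>\<omega>. dot d y (S \<omega>) ^ 4)" unfolding dotS by (rule l(1)) auto
    have "P.expectation (\<lambda>\<omega>. (dot d y (S \<omega>))\<^sup>2) = (\<Sum>t\<in>I. h\<^sup>2 * P.expectation (\<lambda>\<omega>. (dot d y (\<omega> t))\<^sup>2))"
      unfolding dotS by (rule l(3)) auto
    also have "\<dots> \<le> (\<Sum>t\<in>I. h\<^sup>2 * (2 * dot d y y))"
      by (intro sum_mono mult_left_mono int_pow) auto
    also have "\<dots> = (real (card I) * h\<^sup>2) * (2 * dot d y y)" by simp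
    also have "\<dots> \<le> 1 * (2 * dot d y y)" by (intro mult_right_mono h) auto
    finally show "P.expectation (\<lambda>\<omega>. (dot d y (S \<omega>))\<^sup>2) \<le> 2 * dot d y y" by simp
    have "P.expectation (\<lambda>\<omega>. dot d y (S \<omega>) ^ 4) \<le> (5 * ?m * (\<Sum>t\<in>I. h\<^sup>2))\<^sup>2"
      unfolding dotS by (rule l(4)) auto
    also have "\<dots> \<le> (5 * ?m * 1)\<^sup>2"
      using h by (intro power_mono mult_left_mono) (auto intro!: mult_nonneg_nonneg)
    finally show "P.expectation (\<lambda>\<omega>. dot d y (S \<omega>) ^ 4) \<le> (5 * ?m)\<^sup>2" by simp
  qed
  have S_meas: "(\<lambda>\<omega>. dot d y (S \<omega>)) \<in> borel_measurable (PiM I N)" for y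
    unfolding dotS using indep[of y] by (auto simp: P.indep_vars_def2)
  have S2: "integrable (PiM I N) (\<lambda>\<omega>. (dot d y (S \<omega>))\<^sup>2)" for y
    by (rule integrable_power_le4[OF P.finite_measure_axioms S_meas S4(1)]) simp
  show "integrable (PiM I N) (\<lambda>\<omega>. (dot d y (S \<omega>))\<^sup>2)"
    and "(LINT \<omega>|PiM I N. (dot d y (S \<omega>))\<^sup>2) \<le> 2 * dot d y y"
    using S2 S4 by auto
  have compS: "integrable (PiM I N) (\<lambda>\<omega>. (S \<omega> i)\<^sup>2)" "P.expectation (\<lambda>\<omega>. (S \<omega> i)\<^sup>2) \<le> 2"
      "integrable (PiM I N) (\<lambda>\<omega>. S \<omega> i ^ 4)" "P.expectation (\<lambda>\<omega>. S \<omega> i ^ 4) \<le> 25 * C\<^sup>2"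
      "(\<lambda>\<omega>. S \<omega> i) \<in> borel_measurable (PiM I N)" if "i < d" for i
    using that C S2[of "unit_vec i"] S4[of "unit_vec i"] S_meas[of "unit_vec i"]
    by (simp_all add: dot_unit_vec unit_vec_self power_mult_distrib max_absorb2)
  have eq: "dot d (S \<omega>) (S \<omega>) = (\<Sum>i<d. (S \<omega> i)\<^sup>2)" for \<omega> by (simp add: dot_def power2_eq_square)
  show int2: "integrable (PiM I N) (\<lambda>\<omega>. dot d (S \<omega>) (S \<omega>))"
    unfolding eq using compS by auto
  have "(LINT \<omega>|PiM I N. dot d (S \<omega>) (S \<omega>)) = (\<Sum>i<d. P.expectation (\<lambda>\<omega>. (S \<omega> i)\<^sup>2))"
    unfolding eq using compS by simp
  also have "\<dots> \<le> (\<Sum>i<d. 2)" by (intro sum_mono) (use compS in auto)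
  finally show "(LINT \<omega>|PiM I N. dot d (S \<omega>) (S \<omega>)) \<le> 2 * real d" by simp
  have int: "integrable (PiM I N) (\<lambda>\<omega>. real d * (\<Sum>i<d. S \<omega> i ^ 4))"
    using compS by auto
  show sq: "integrable (PiM I N) (\<lambda>\<omega>. (dot d (S \<omega>) (S \<omega>))\<^sup>2)"
    using order_trans[OF dot_self_square_le abs_ge_self] borel_measurable_integrable[OF int2]
    by (intro Bochner_Integration.integrable_bound[OF int]) auto
  have "(LINT \<omega>|PiM I N. (dot d (S \<omega>) (S \<omega>))\<^sup>2) \<le> P.expectation (\<lambda>\<omega>. real d * (\<Sum>i<d. S \<omega> i ^ 4))"
    using sq int by (intro integral_mono dot_self_square_le)
  also have "\<dots> = real d * (\<Sum>i<d. P.expectation (\<lambda>\<omega>. S \<omega> i ^ 4))"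
    using compS by simp
  also have "\<dots> \<le> real d * (\<Sum>i<d. 25 * C\<^sup>2)"
    using compS by (intro mult_left_mono sum_mono) auto
  finally show "(LINT \<omega>|PiM I N. (dot d (S \<omega>) (S \<omega>))\<^sup>2) \<le> 25 * C\<^sup>2 * (real d)\<^sup>2"
    by (simp add: power2_eq_square mult_ac)
qed

lemma dot_zero_left [simp]: "dot d (\<lambda>_. 0) y = 0"
  by (simp add: dot_def)

text \<open>Both expansions leave the same remainder bound, hence the factor 2. The terms in
  \<open>r\<close> are the difference of the main terms: the comparison law is standard Gaussian and
  not Gaussian with covariance identity plus \<open>r r^T\<close>.\<close>

lemma one_step_compare:
  assumes \<nu>: "whitened_law \<nu> d r C" and \<gamma>: "whitened_law \<gamma> d (\<lambda>_. 0) C" and \<alpha>: "\<alpha> > 0"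
  shows "cmod ((LINT v|\<nu>. iexp (s * dot d (\<lambda>i. x i + h * v i) (\<lambda>i. x i + h * v i)))
      - (LINT v|\<gamma>. iexp (s * dot d (\<lambda>i. x i + h * v i) (\<lambda>i. x i + h * v i))))
    \<le> 2 * (8 * \<alpha> * h\<^sup>2 * (2 / 3 * \<bar>s\<bar> ^ 3 + s\<^sup>2 / 2) * dot d x x
      + 32 / 3 * \<bar>s\<bar> ^ 3 * C * h ^ 4 / \<alpha> * (dot d x x)\<^sup>2
      + s\<^sup>2 * C * h ^ 4 * (real d)\<^sup>2 * (1 / (2 * \<alpha>) + 9 / 2))
      + \<bar>s\<bar> * h\<^sup>2 * dot d r r + 2 * s\<^sup>2 * h\<^sup>2 * (dot d r x)\<^sup>2"
    (is "cmod (?N - ?G) \<le> 2 * ?\<rho> + _ + _")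
proof -
  interpret N: whitened_law \<nu> d r C by fact
  interpret G: whitened_law \<gamma> d "\<lambda>_. 0" C by fact
  let ?e = "iexp (s * dot d x x)"
  let ?n = "?e * (1 + \<i> * of_real (s * h\<^sup>2 * (real d + dot d r r))
        - of_real (2 * s\<^sup>2 * h\<^sup>2 * (dot d x x + (dot d r x)\<^sup>2)))"
  let ?g = "?e * (1 + \<i> * of_real (s * h\<^sup>2 * (real d + dot d (\<lambda>_. 0) (\<lambda>_. 0)))
        - of_real (2 * s\<^sup>2 * h\<^sup>2 * (dot d x x + (dot d (\<lambda>_. 0) x)\<^sup>2)))"
  have "?n - ?g = ?e * (\<i> * of_real (s * h\<^sup>2 * dot d r r) - of_real (2 * s\<^sup>2 * h\<^sup>2 * (dot d r x)\<^sup>2))"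
    by (simp add: algebra_simps)
  then have "cmod (?n - ?g) = cmod (\<i> * of_real (s * h\<^sup>2 * dot d r r) - of_real (2 * s\<^sup>2 * h\<^sup>2 * (dot d r x)\<^sup>2))"
    by (simp only: norm_mult) simp
  also have "\<dots> \<le> cmod (\<i> * of_real (s * h\<^sup>2 * dot d r r)) + cmod (of_real (2 * s\<^sup>2 * h\<^sup>2 * (dot d r x)\<^sup>2))"
    by (rule norm_triangle_ineq4)
  also have "\<dots> = \<bar>s\<bar> * h\<^sup>2 * dot d r r + 2 * s\<^sup>2 * h\<^sup>2 * (dot d r x)\<^sup>2"
    by (simp only: norm_mult norm_of_real norm_ii) (simp add: abs_mult)
  finally have main: "cmod (?n - ?g) \<le> \<bar>s\<bar> * h\<^sup>2 * dot d r r + 2 * s\<^sup>2 * h\<^sup>2 * (dot d r x)\<^sup>2" .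
  have tri: "cmod (a - b) \<le> cmod (a - a') + cmod (b - b') + cmod (a' - b')" for a b a' b' :: complex
    using norm_triangle_ineq[of "(a - a') - (b - b')" "a' - b'"] norm_triangle_ineq4[of "a - a'" "b - b'"]
    by simp
  have "cmod (?N - ?G) \<le> cmod (?N - ?n) + cmod (?G - ?g) + cmod (?n - ?g)"
    by (rule tri)
  also have "\<dots> \<le> ?\<rho> + ?\<rho> + (\<bar>s\<bar> * h\<^sup>2 * dot d r r + 2 * s\<^sup>2 * h\<^sup>2 * (dot d r x)\<^sup>2)"
    by (rule add_mono[OF add_mono[OF N.one_step[OF \<alpha>, of s x h] G.one_step[OF \<alpha>, of s x h]] main])
  finally show ?thesis by (simp only: mult_2 add.assoc)
qed

text \<open>Two neighbouring hybrid laws differ in one coordinate. Integrating this coordinate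
  first, for a fixed sum of the others, reduces the difference to \<open>one_step_compare\<close>;
  the moments of that sum obey the bounds of \<open>product_law_moments\<close> for every hybrid.
  The differences then telescope.\<close>

lemma lindeberg_swap:
  fixes \<nu> :: "nat \<Rightarrow> (nat \<Rightarrow> real) measure" and s h \<alpha> :: real
  assumes \<nu>: "\<And>t. whitened_law (\<nu> t) d r C" and \<gamma>: "whitened_law \<gamma> d (\<lambda>_. 0) C"
    and I: "finite I" and h: "real (card I) * h\<^sup>2 \<le> 1" and \<alpha>: "\<alpha> > 0"
  defines "\<Phi> \<equiv> \<lambda>\<omega>. iexp (s * dot d (\<lambda>i. h * (\<Sum>t\<in>I. \<omega> t i)) (\<lambda>i. h * (\<Sum>t\<in>I. \<omega> t i)))"
  shows "cmod ((LINT \<omega>|PiM I \<nu>. \<Phi> \<omega>) - (LINT \<omega>|PiM I (\<lambda>_. \<gamma>). \<Phi> \<omega>)) \<le>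
    real (card I) * (2 * (8 * \<alpha> * h\<^sup>2 * (2 / 3 * \<bar>s\<bar> ^ 3 + s\<^sup>2 / 2) * (2 * real d)
      + 32 / 3 * \<bar>s\<bar> ^ 3 * C * h ^ 4 / \<alpha> * (25 * C\<^sup>2 * (real d)\<^sup>2)
      + s\<^sup>2 * C * h ^ 4 * (real d)\<^sup>2 * (1 / (2 * \<alpha>) + 9 / 2))
      + \<bar>s\<bar> * h\<^sup>2 * dot d r r + 2 * s\<^sup>2 * h\<^sup>2 * (2 * dot d r r))"
    (is "_ \<le> _ * ?bound")
proof -
  \<comment> \<open>The hybrid law: original on \<open>J\<close>, Gaussian elsewhere.
    \<open>J = I\<close> and \<open>J = {}\<close> are the two ends of the telescope.\<close>
  define N where "N J t = (if t \<in> J then \<nu> t else \<gamma>)" for J t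
  define R where "R J t = (if t \<in> J then r else (\<lambda>_. 0))" for J :: "nat set" and t
  have law: "whitened_law (N J t) d (R J t) C" for J t
    using \<nu> \<gamma> by (simp add: N_def R_def)
  interpret N: whitened_law "N J t" d "R J t" C for J t by (rule law)
  interpret P: product_sigma_finite "N J" for J by unfold_locales
  have meas_comp: "(\<lambda>\<omega>. \<omega> t i) \<in> borel_measurable (PiM K (N J))" if "t \<in> K" "i < d" for K J t i
    by (rule measurable_compose[where f = "\<lambda>\<omega>. \<omega> t" and g = "\<lambda>v. v i" and N = "N J t"])
      (use that N.component_meas in auto)
  have \<Phi>_meas: "\<Phi> \<in> borel_measurable (PiM I (N J))" for J
  proof -
    have "(\<lambda>\<omega>. dot d (\<lambda>i. h * (\<Sum>t\<in>I. \<omega> t i)) (\<lambda>i. h * (\<Sum>t\<in>I. \<omega> t i))) \<in> borel_measurable (PiM I (N J))"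
      unfolding dot_def
      by (intro borel_measurable_sum borel_measurable_times borel_measurable_const meas_comp) auto
    then show ?thesis unfolding \<Phi>_def by measurable
  qed
  have step: "cmod ((LINT \<omega>|PiM I (N (insert t J)). \<Phi> \<omega>) - (LINT \<omega>|PiM I (N J). \<Phi> \<omega>)) \<le> ?bound"
    if t: "t \<in> I" "t \<notin> J" for t J
  proof -
    define K where "K = I - {t}"
    have I_eq: "I = insert t K" and K: "finite K" "t \<notin> K" using t I by (auto simp: K_def)
    have "card K \<le> card I" using I by (auto simp: K_def intro: card_mono)
    then have "real (card K) * h\<^sup>2 \<le> real (card I) * h\<^sup>2" by (intro mult_right_mono) auto
    with h have hK: "real (card K) * h\<^sup>2 \<le> 1" by linarith
    define S where "S x i = h * (\<Sum>u\<in>K. x u i)" for x :: "nat \<Rightarrow> nat \<Rightarrow> real" and i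
    have same: "PiM K (N (insert t J)) = PiM K (N J)"
      using K by (intro PiM_cong) (auto simp: N_def)
    let ?P = "PiM K (N J)"
    interpret PK: prob_space ?P by (rule prob_space_PiM) unfold_locales
    \<comment> \<open>The conditional expectation given all coordinates other than \<open>t\<close>;
      only the law at \<open>t\<close> distinguishes the two hybrids.\<close>
    define f where "f J' x = (LINT v|N J' t. iexp (s * dot d (\<lambda>i. S x i + h * v i) (\<lambda>i. S x i + h * v i)))" for J' x
    have fubini: "(LINT \<omega>|PiM I (N J'). \<Phi> \<omega>) = (LINT x|PiM K (N J'). f J' x)"
      and f_int: "integrable (PiM K (N J')) (f J')" for J'
    proof -
      interpret PI: prob_space "PiM I (N J')" by (rule prob_space_PiM) unfold_locales
      interpret PK': prob_space "PiM K (N J')" by (rule prob_space_PiM) unfold_locales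
      have int: "integrable (PiM (insert t K) (N J')) \<Phi>"
        unfolding I_eq[symmetric]
        by (intro PI.integrable_const_bound[where B = 1] \<Phi>_meas) (auto simp: \<Phi>_def)
      have eq: "(LINT v|N J' t. \<Phi> (x(t := v))) = f J' x" for x
      proof -
        have "(\<Sum>u\<in>I. (x(t := v)) u i) = (\<Sum>u\<in>K. x u i) + v i" for v i
        proof -
          have "(\<Sum>u\<in>K. (x(t := v)) u i) = (\<Sum>u\<in>K. x u i)"
            using K by (intro sum.cong) auto
          then show ?thesis unfolding I_eq using K by simp
        qed
        then show ?thesis by (simp add: \<Phi>_def f_def S_def distrib_left)
      qed
      show "(LINT \<omega>|PiM I (N J'). \<Phi> \<omega>) = (LINT x|PiM K (N J'). f J' x)"
        unfolding I_eq P.product_integral_insert[OF K int] eq ..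
      have "(\<lambda>(x, v). \<Phi> (x(t := v))) \<in> borel_measurable (PiM K (N J') \<Otimes>\<^sub>M N J' t)"
        using measurable_compose[OF measurable_add_dim \<Phi>_meas[unfolded I_eq], of J']
        by (simp add: case_prod_unfold)
      then have "(\<lambda>x. LINT v|N J' t. \<Phi> (x(t := v))) \<in> borel_measurable (PiM K (N J'))"
        by (rule N.borel_measurable_lebesgue_integral)
      then have "f J' \<in> borel_measurable (PiM K (N J'))" unfolding eq .
      moreover have "cmod (f J' x) \<le> 1" for x
        unfolding f_def
        by (rule order_trans[OF norm_integral_le[where g = "\<lambda>_. 1"]])
          (auto intro!: N.integrable_iexp simp: dot_translate N.prob_space)
      ultimately show "integrable (PiM K (N J')) (f J')"
        by (intro PK'.integrable_const_bound[where B = 1]) auto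
    qed
    have linear: "(LINT x|?P. 2 * (a * A x + b * B x + c) + e + k * D x) =
        2 * (a * (LINT x|?P. A x) + b * (LINT x|?P. B x) + c) + e + k * (LINT x|?P. D x)"
      if "integrable ?P A" "integrable ?P B" "integrable ?P D" for A B D and a b c e k :: real
      using that by (simp add: PK.prob_space)
    have NJ: "N (insert t J) t = \<nu> t" "N J t = \<gamma>" using t by (auto simp: N_def)
    note mom = product_law_moments[where N = "N J", OF law K(1) hK, folded S_def]
    have eq: "(LINT \<omega>|PiM I (N (insert t J)). \<Phi> \<omega>) - (LINT \<omega>|PiM I (N J). \<Phi> \<omega>) = (LINT x|?P. f (insert t J) x - f J x)"
      using f_int[of "insert t J"] f_int[of J] by (simp add: fubini same)
    have "cmod (LINT x|?P. f (insert t J) x - f J x) \<le> (LINT x|?P. 2 * (8 * \<alpha> * h\<^sup>2 * (2 / 3 * \<bar>s\<bar> ^ 3 + s\<^sup>2 / 2) * dot d (S x) (S x)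
      + 32 / 3 * \<bar>s\<bar> ^ 3 * C * h ^ 4 / \<alpha> * (dot d (S x) (S x))\<^sup>2
      + s\<^sup>2 * C * h ^ 4 * (real d)\<^sup>2 * (1 / (2 * \<alpha>) + 9 / 2))
      + \<bar>s\<bar> * h\<^sup>2 * dot d r r + 2 * s\<^sup>2 * h\<^sup>2 * (dot d r (S x))\<^sup>2)" (is "_ \<le> integral\<^sup>L _ ?B")
    proof (rule norm_integral_le)
      show "integrable ?P (\<lambda>x. f (insert t J) x - f J x)"
        using f_int[of "insert t J"] f_int[of J] by (simp add: same)
      show "integrable ?P ?B" using mom(1,3) mom(5)[of r] by simp
      show "cmod (f (insert t J) x - f J x) \<le> ?B x" for x
        unfolding f_def NJ by (rule one_step_compare[OF \<nu> \<gamma> \<alpha>])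
    qed
    also have "\<dots> = 2 * (8 * \<alpha> * h\<^sup>2 * (2 / 3 * \<bar>s\<bar> ^ 3 + s\<^sup>2 / 2) * (LINT x|?P. dot d (S x) (S x))
      + 32 / 3 * \<bar>s\<bar> ^ 3 * C * h ^ 4 / \<alpha> * (LINT x|?P. (dot d (S x) (S x))\<^sup>2)
      + s\<^sup>2 * C * h ^ 4 * (real d)\<^sup>2 * (1 / (2 * \<alpha>) + 9 / 2))
      + \<bar>s\<bar> * h\<^sup>2 * dot d r r + 2 * s\<^sup>2 * h\<^sup>2 * (LINT x|?P. (dot d r (S x))\<^sup>2)"
      by (rule linear) (rule mom)+
    also have "\<dots> \<le> ?bound"
    proof -
      have C: "0 \<le> C" using N.C_ge by simp
      have "0 \<le> 8 * \<alpha> * h\<^sup>2 * (2 / 3 * \<bar>s\<bar> ^ 3 + s\<^sup>2 / 2)" "0 \<le> 32 / 3 * \<bar>s\<bar> ^ 3 * C * h ^ 4 / \<alpha>"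
        "0 \<le> 2 * s\<^sup>2 * h\<^sup>2"
        using \<alpha> C by (intro mult_nonneg_nonneg divide_nonneg_pos add_nonneg_nonneg; simp)+
      note mult = this[THEN mult_left_mono[rotated]]
      show ?thesis
        by (rule add_mono[OF add_mono[OF mult_left_mono[OF add_mono[OF add_mono[OF
            mult(1)[OF mom(2)] mult(2)[OF mom(4)]] order_refl]] order_refl] mult(3)[OF mom(6)[of r]]]) simp
    qed
    finally show ?thesis unfolding eq .
  qed
  obtain B where B: "?bound = B" by blast
  have hybrid: "cmod ((LINT \<omega>|PiM I (N J). \<Phi> \<omega>) - (LINT \<omega>|PiM I (N {}). \<Phi> \<omega>)) \<le> real (card J) * B"
    if "finite J" "J \<subseteq> I" for J
    using that
  proof (induction J rule: finite_induct)
    case (insert t J)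
    have "cmod ((LINT \<omega>|PiM I (N (insert t J)). \<Phi> \<omega>) - (LINT \<omega>|PiM I (N {}). \<Phi> \<omega>)) \<le>
      cmod ((LINT \<omega>|PiM I (N (insert t J)). \<Phi> \<omega>) - (LINT \<omega>|PiM I (N J). \<Phi> \<omega>)) +
      cmod ((LINT \<omega>|PiM I (N J). \<Phi> \<omega>) - (LINT \<omega>|PiM I (N {}). \<Phi> \<omega>))"
      by (rule order_trans[OF _ norm_triangle_ineq]) simp
    also have "\<dots> \<le> B + real (card J) * B"
      by (rule add_mono[OF step[unfolded B] insert.IH]) (use insert.hyps insert.prems in auto)
    also have "\<dots> = real (card (insert t J)) * B"
      using insert.hyps by (simp add: distrib_right)
    finally show ?case .
  qed simp
  have "PiM I (N I) = PiM I \<nu>" "PiM I (N {}) = PiM I (\<lambda>_. \<gamma>)"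
    by (auto intro!: PiM_cong simp: N_def)
  then show ?thesis using hybrid[OF I subset_refl] unfolding B by simp
qed

section \<open>Gaussian vectors and the chi-square distribution\<close>

abbreviation gauss :: "nat \<Rightarrow> (nat \<Rightarrow> real) measure" where
  "gauss d \<equiv> PiM {..<d} (\<lambda>_. std_normal_distribution)"

lemma prob_space_std_normal: "prob_space std_normal_distribution"
  by (rule prob_space_normal_density) simp

lemma sets_PiM_std_normal: "sets (PiM I (\<lambda>_. std_normal_distribution)) = sets (PiM I (\<lambda>_. borel))"
  by (intro sets_PiM_cong) auto

lemma std_normal_second_moment: "(LINT x|std_normal_distribution. x\<^sup>2) = 1"
  using std_normal_distribution_even_moments(1)[of 1] by (simp add: fact_numeral)

lemma std_normal_fourth_moment: "(LINT x|std_normal_distribution. x ^ 4) = 3"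
  using std_normal_distribution_even_moments(1)[of 2] by (simp add: fact_numeral)

lemma std_normal_mean: "(LINT x|std_normal_distribution. x) = 0"
  using integral_std_normal_distribution_moment_odd[of 1] by simp

lemma std_normal_coordinates:
  fixes I :: "'i set"
  defines "P \<equiv> PiM I (\<lambda>_. std_normal_distribution)"
  shows "prob_space P"
    and "i \<in> I \<Longrightarrow> (\<lambda>\<omega>. \<omega> i) \<in> borel_measurable P"
    and "i \<in> I \<Longrightarrow> distr P borel (\<lambda>\<omega>. \<omega> i) = std_normal_distribution"
    and "prob_space.indep_vars P (\<lambda>_. borel) (\<lambda>i \<omega>. \<omega> i) I"
    and "i \<in> I \<Longrightarrow> f \<in> borel_measurable borel \<Longrightarrow>
      integrable P (\<lambda>\<omega>. f (\<omega> i) :: real) \<longleftrightarrow> integrable std_normal_distribution f"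
    and "i \<in> I \<Longrightarrow> f \<in> borel_measurable borel \<Longrightarrow>
      (LINT \<omega>|P. f (\<omega> i)) = (LINT x|std_normal_distribution. f x)"
proof -
  show P: "prob_space P" unfolding P_def by (intro prob_space_PiM prob_space_std_normal)
  interpret P: prob_space P by (rule P)
  show meas: "(\<lambda>\<omega>. \<omega> i) \<in> borel_measurable P" if "i \<in> I" for i
    using measurable_component_singleton[OF that, of "\<lambda>_. std_normal_distribution"]
    by (simp add: P_def cong: measurable_cong_sets)
  show law: "distr P borel (\<lambda>\<omega>. \<omega> i) = std_normal_distribution" if "i \<in> I" for i
  proof -
    have "distr P borel (\<lambda>\<omega>. \<omega> i) = distr P std_normal_distribution (\<lambda>\<omega>. \<omega> i)"
      by (rule distr_cong) auto
    also have "\<dots> = std_normal_distribution"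
      unfolding P_def by (intro distr_PiM_component prob_space_std_normal that)
    finally show ?thesis .
  qed
  show "P.indep_vars (\<lambda>_. borel) (\<lambda>i \<omega>. \<omega> i) I"
    unfolding P_def
    by (rule prob_space.indep_vars_compose2[OF P[unfolded P_def]
          indep_vars_PiM_components[OF prob_space_std_normal], where Y = "\<lambda>_ x. x"]) simp
  show "integrable P (\<lambda>\<omega>. f (\<omega> i) :: real) \<longleftrightarrow> integrable std_normal_distribution f"
    if "i \<in> I" "f \<in> borel_measurable borel" for i f
    using integrable_distr_eq[OF meas[OF that(1)] that(2)] by (simp add: law that)
  show "(LINT \<omega>|P. f (\<omega> i)) = (LINT x|std_normal_distribution. f x)"
    if "i \<in> I" "f \<in> borel_measurable borel" for i and f :: "real \<Rightarrow> real"
    using integral_distr[OF meas[OF that(1)] that(2)] by (simp add: law that)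
qed

text \<open>The number 225 is \<open>(5 * 3)^2\<close>: the bound of
  \<open>linear_form_moments\<close> with the fourth moment \<open>m = 3\<close> of a standard
  normal variable.\<close>

lemma gauss_whitened: 
  assumes C: "225 \<le> C"
  shows "whitened_law (gauss d) d (\<lambda>_. 0) C"
proof -
  note coord = std_normal_coordinates[where I = "{..<d}"]
  interpret P: prob_space "gauss d" by (rule coord)
  have m: "integrable (gauss d) (\<lambda>\<omega>. \<omega> i ^ 4)" "P.expectation (\<lambda>\<omega>. \<omega> i ^ 4) \<le> 3"
    "P.expectation (\<lambda>\<omega>. \<omega> i) = 0" if "i \<in> {..<d}" for i
    using that integrable_std_normal_distribution_moment[of 4]
    by (simp_all add: coord(5)[of i "\<lambda>x. x ^ 4"] coord(6)[of i "\<lambda>x. x ^ 4"] coord(6)[of i "\<lambda>x. x"]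
        std_normal_fourth_moment std_normal_mean)
  have var: "P.expectation (\<lambda>\<omega>. (\<omega> i)\<^sup>2) = 1" if "i \<in> {..<d}" for i
    using that by (simp add: coord(6)[of i "\<lambda>x. x\<^sup>2"] std_normal_second_moment)
  have le: "(1::real) \<le> 3" by simp
  note lin = P.linear_form_moments[OF coord(4) finite_lessThan subset_refl m(1,2) le m(3), folded dot_def]
  show ?thesis
  proof
    show "sets (gauss d) = sets (PiM {..<d} (\<lambda>_. borel))" by (rule sets_PiM_std_normal)
    show "integrable (gauss d) (\<lambda>v. dot d y v ^ 4)" for y by (rule lin)
    show "P.expectation (\<lambda>v. dot d y v) = 0" for y by (rule lin)
    show "P.expectation (\<lambda>v. (dot d y v)\<^sup>2) = dot d y y + (dot d (\<lambda>_. 0) y)\<^sup>2" for y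
      using lin(3)[of y] var by (simp add: dot_def power2_eq_square)
    show "P.expectation (\<lambda>v. dot d y v ^ 4) \<le> C * (dot d y y)\<^sup>2" for y
    proof -
      have "P.expectation (\<lambda>v. dot d y v ^ 4) \<le> (5 * 3 * (\<Sum>i<d. (y i)\<^sup>2))\<^sup>2" by (rule lin)
      also have "\<dots> = 225 * (dot d y y)\<^sup>2" by (simp add: dot_def power2_eq_square)
      also have "\<dots> \<le> C * (dot d y y)\<^sup>2" using C by (intro mult_right_mono) auto
      finally show ?thesis .
    qed
  qed (use C in auto)
qed

lemma (in prob_space) indep_vars_joint_distr:
  assumes "indep_vars N X I" "I \<noteq> {}"
  shows "distr M (PiM I N) (\<lambda>\<omega>. \<lambda>i\<in>I. X i \<omega>) = PiM I (\<lambda>i. distr M (N i) (X i))"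
  using assms by (subst indep_vars_iff_distr_eq_PiM'[symmetric]) (auto simp: indep_vars_def)

lemma normalized_sum_std_normal:
  fixes Z :: "'i \<Rightarrow> 'a \<Rightarrow> real"
  assumes M: "prob_space M" and indep: "prob_space.indep_vars M (\<lambda>_. borel) Z I"
    and I: "finite I" "I \<noteq> {}"
    and Z: "\<And>i. i \<in> I \<Longrightarrow> distr M borel (Z i) = std_normal_distribution"
  shows "distr M borel (\<lambda>\<omega>. 1 / sqrt (real (card I)) * (\<Sum>i\<in>I. Z i \<omega>)) = std_normal_distribution"
proof -
  interpret prob_space M by fact
  define h where "h = 1 / sqrt (real (card I))"
  have h: "h > 0" using I by (simp add: h_def card_gt_0_iff)
  have meas: "Z i \<in> borel_measurable M" if "i \<in> I" for i
    using indep that by (simp add: indep_vars_def2)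
  have "distributed M lborel (Z i) std_normal_density" if "i \<in> I" for i
    unfolding distributed_def using Z[OF that] meas[OF that] by (simp cong: distr_cong)
  then have "distributed M lborel (\<lambda>\<omega>. 0 + h * Z i \<omega>) (normal_density (0 + h * 0) (\<bar>h\<bar> * 1))"
    if "i \<in> I" for i
    using that h by (intro normal_density_affine) auto
  then have d: "distributed M lborel (\<lambda>\<omega>. h * Z i \<omega>) (normal_density 0 h)" if "i \<in> I" for i
    using that h by simp
  have ind: "indep_vars (\<lambda>_. borel) (\<lambda>i \<omega>. h * Z i \<omega>) I"
    by (rule indep_vars_compose2[OF indep]) simp
  have "distributed M lborel (\<lambda>\<omega>. \<Sum>i\<in>I. h * Z i \<omega>) (normal_density (\<Sum>i\<in>I. 0) (sqrt (\<Sum>i\<in>I. h\<^sup>2)))"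
    by (rule sum_indep_normal[OF I ind]) (use h d in auto)
  moreover have "sqrt (\<Sum>i\<in>I. h\<^sup>2) = 1"
    using I by (simp add: h_def power_divide card_gt_0_iff)
  ultimately have "distributed M lborel (\<lambda>\<omega>. h * (\<Sum>i\<in>I. Z i \<omega>)) std_normal_density"
    by (simp add: sum_distrib_left)
  then have "distr M lborel (\<lambda>\<omega>. h * (\<Sum>i\<in>I. Z i \<omega>)) = std_normal_distribution"
    by (rule distributed_distr_eq_density)
  then show ?thesis unfolding h_def by (simp cong: distr_cong)
qed

lemma char_chi_square:
  "char (chi_square_distribution d) s = (LINT z|gauss d. iexp (s * dot d z z))"
proof -
  have "(\<lambda>z. \<Sum>i<d. (z i)\<^sup>2) \<in> borel_measurable (gauss d)"
    using std_normal_coordinates(2)[of _ "{..<d}"] by (intro borel_measurable_sum borel_measurable_power) auto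
  then show ?thesis
    unfolding char_def chi_square_distribution_def
    by (subst integral_distr) (auto simp: dot_def power2_eq_square)
qed

text \<open>One array of independent standard normals over \<open>I \<times> {..<d}\<close> is read
  in two ways. Its rows realise the independent Gaussian vectors; its normalised column sums
  \<open>W i\<close> are again independent standard normals, and their sum of squares is the squared
  length in question.\<close>

lemma gauss_power_chi_square:
  fixes I :: "nat set"
  assumes I: "finite I" "I \<noteq> {}" and d: "d > 0"
  defines "h \<equiv> 1 / sqrt (real (card I))"
  shows "(LINT \<omega>|PiM I (\<lambda>_. gauss d). iexp (s * dot d (\<lambda>i. h * (\<Sum>t\<in>I. \<omega> t i)) (\<lambda>i. h * (\<Sum>t\<in>I. \<omega> t i)))) =
    char (chi_square_distribution d) s" (is "(LINT \<omega>|_. ?\<Phi> \<omega>) = _")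
proof -
  define P where "P = PiM (I \<times> {..<d}) (\<lambda>_. std_normal_distribution)"
  note coord = std_normal_coordinates[where I = "I \<times> {..<d}", folded P_def]
  interpret P: prob_space P by (rule coord)
  let ?row = "\<lambda>(t :: nat) (\<omega> :: nat \<times> nat \<Rightarrow> real). \<lambda>i\<in>{..<d}. \<omega> (t, i)"
  have indep_std: "P.indep_vars (\<lambda>_. std_normal_distribution) (\<lambda>p \<omega>. \<omega> p) (I \<times> {..<d})"
    unfolding P_def by (rule indep_vars_PiM_components[OF prob_space_std_normal])
  have "P.indep_vars (\<lambda>t. PiM ({t} \<times> {..<d}) (\<lambda>_. std_normal_distribution))
      (\<lambda>t \<omega>. restrict (\<lambda>p. \<omega> p) ({t} \<times> {..<d})) I"
    by (rule P.indep_vars_restrict[OF indep_std]) (auto simp: disjoint_family_on_def)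
  then have "P.indep_vars (\<lambda>_. gauss d)
      (\<lambda>t \<omega>. \<lambda>i\<in>{..<d}. restrict (\<lambda>p. \<omega> p) ({t} \<times> {..<d}) (t, i)) I"
    by (rule P.indep_vars_compose2[where Y = "\<lambda>t x. \<lambda>i\<in>{..<d}. x (t, i)"])
      (intro measurable_restrict measurable_component_singleton, simp)
  moreover have "(\<lambda>t \<omega>. \<lambda>i\<in>{..<d}. restrict (\<lambda>p. \<omega> p) ({t} \<times> {..<d}) (t, i)) = ?row"
    by (auto simp: fun_eq_iff)
  ultimately have rows: "P.indep_vars (\<lambda>_. gauss d) ?row I" by (simp only:)
  have row_meas: "?row t \<in> P \<rightarrow>\<^sub>M gauss d" if "t \<in> I" for t
    using rows that by (simp add: P.indep_vars_def)
  have row_law: "distr P (gauss d) (?row t) = gauss d" if "t \<in> I" for t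
    unfolding P_def
    using distr_PiM_reindex[where K = "I \<times> {..<d}" and M = "\<lambda>_. std_normal_distribution" and f = "Pair t" and I = "{..<d}"]
      that prob_space_std_normal by (auto simp: inj_on_def)
  have joint: "distr P (PiM I (\<lambda>_. gauss d)) (\<lambda>\<omega>. \<lambda>t\<in>I. ?row t \<omega>) = PiM I (\<lambda>_. gauss d)"
  proof -
    have "distr P (PiM I (\<lambda>_. gauss d)) (\<lambda>\<omega>. \<lambda>t\<in>I. ?row t \<omega>) = PiM I (\<lambda>t. distr P (gauss d) (?row t))"
      by (rule P.indep_vars_joint_distr[OF rows I(2)])
    also have "\<dots> = PiM I (\<lambda>_. gauss d)" by (intro PiM_cong row_law refl)
    finally show ?thesis .
  qed
  have joint_meas: "(\<lambda>\<omega>. \<lambda>t\<in>I. ?row t \<omega>) \<in> P \<rightarrow>\<^sub>M PiM I (\<lambda>_. gauss d)"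
    by (intro measurable_restrict row_meas)
  interpret G: whitened_law "gauss d" d "\<lambda>_. 0" 225 by (rule gauss_whitened) simp
  have comp: "(\<lambda>\<omega>. \<omega> t i) \<in> borel_measurable (PiM I (\<lambda>_. gauss d))" if "t \<in> I" "i < d" for t i
    by (rule measurable_compose[where f = "\<lambda>\<omega>. \<omega> t" and g = "\<lambda>v. v i" and N = "gauss d"])
      (use that G.component_meas in auto)
  have "(\<lambda>\<omega>. dot d (\<lambda>i. h * (\<Sum>t\<in>I. \<omega> t i)) (\<lambda>i. h * (\<Sum>t\<in>I. \<omega> t i))) \<in> borel_measurable (PiM I (\<lambda>_. gauss d))"
    unfolding dot_def
    by (intro borel_measurable_sum borel_measurable_times borel_measurable_const comp) auto
  then have \<Phi>_meas: "?\<Phi> \<in> borel_measurable (PiM I (\<lambda>_. gauss d))" by measurable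
  define W where "W i \<omega> = h * (\<Sum>t\<in>I. \<omega> (t, i))" for i and \<omega> :: "nat \<times> nat \<Rightarrow> real"
  have "P.indep_vars (\<lambda>i. PiM (I \<times> {i}) (\<lambda>_. borel))
      (\<lambda>i \<omega>. restrict (\<lambda>p. \<omega> p) (I \<times> {i})) {..<d}"
    by (rule P.indep_vars_restrict[OF coord(4)]) (auto simp: disjoint_family_on_def)
  then have "P.indep_vars (\<lambda>_. borel) (\<lambda>i \<omega>. h * (\<Sum>t\<in>I. restrict (\<lambda>p. \<omega> p) (I \<times> {i}) (t, i))) {..<d}"
    by (rule P.indep_vars_compose2)
      (intro borel_measurable_sum borel_measurable_times borel_measurable_const measurable_component_singleton, auto)
  moreover have "(\<lambda>i \<omega>. h * (\<Sum>t\<in>I. restrict (\<lambda>p. \<omega> p) (I \<times> {i}) (t, i))) = W"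
    unfolding W_def fun_eq_iff by (auto intro!: sum.cong arg_cong2[where f = "(*)"])
  ultimately have cols: "P.indep_vars (\<lambda>_. borel) W {..<d}" by (simp only:)
  have W_law: "distr P borel (W i) = std_normal_distribution" if "i \<in> {..<d}" for i
  proof -
    have "P.indep_vars (\<lambda>_. borel) (\<lambda>t \<omega>. \<omega> (t, i)) I"
    proof -
      have "P.indep_vars (\<lambda>t. PiM ({(t, i)}) (\<lambda>_. borel)) (\<lambda>t \<omega>. restrict (\<lambda>p. \<omega> p) {(t, i)}) I"
        by (rule P.indep_vars_restrict[OF coord(4)]) (use that in \<open>auto simp: disjoint_family_on_def\<close>)
      then have "P.indep_vars (\<lambda>_. borel) (\<lambda>t \<omega>. restrict (\<lambda>p. \<omega> p) {(t, i)} (t, i)) I"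
        by (rule P.indep_vars_compose2) (intro measurable_component_singleton, simp)
      then show ?thesis by simp
    qed
    from normalized_sum_std_normal[OF P.prob_space_axioms this I coord(3)] that
    show ?thesis by (simp add: W_def[abs_def] h_def)
  qed
  have W_meas: "W i \<in> borel_measurable P" if "i \<in> {..<d}" for i
    using cols that by (simp add: P.indep_vars_def2)
  have "distr P (PiM {..<d} (\<lambda>_. borel)) (\<lambda>\<omega>. \<lambda>i\<in>{..<d}. W i \<omega>) = PiM {..<d} (\<lambda>i. distr P borel (W i))"
    by (rule P.indep_vars_joint_distr[OF cols]) (use d in auto)
  also have "\<dots> = gauss d" by (intro PiM_cong W_law refl)
  finally have W_joint: "distr P (PiM {..<d} (\<lambda>_. borel)) (\<lambda>\<omega>. \<lambda>i\<in>{..<d}. W i \<omega>) = gauss d" .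
  have W_joint_meas: "(\<lambda>\<omega>. \<lambda>i\<in>{..<d}. W i \<omega>) \<in> P \<rightarrow>\<^sub>M PiM {..<d} (\<lambda>_. borel)"
    by (intro measurable_restrict W_meas)
  have dot_cong: "dot d x x = dot d y y" if "\<And>i. i < d \<Longrightarrow> x i = y i" for x y
    using that by (simp add: dot_def)
  have "(LINT \<omega>|PiM I (\<lambda>_. gauss d). ?\<Phi> \<omega>) = (LINT \<omega>|P. ?\<Phi> (\<lambda>t\<in>I. ?row t \<omega>))"
    by (subst joint[symmetric], rule integral_distr[OF joint_meas \<Phi>_meas])
  also have "\<dots> = (LINT \<omega>|P. iexp (s * dot d (\<lambda>i\<in>{..<d}. W i \<omega>) (\<lambda>i\<in>{..<d}. W i \<omega>)))"
    by (intro Bochner_Integration.integral_cong refl arg_cong[where f = exp] arg_cong[where f = "\<lambda>x. \<i> * complex_of_real (s * x)"] dot_cong)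
      (auto simp: W_def intro!: sum.cong)
  also have "\<dots> = (LINT z|gauss d. iexp (s * dot d z z))"
  proof -
    have "(\<lambda>z. iexp (s * dot d z z)) \<in> borel_measurable (PiM {..<d} (\<lambda>_. borel))"
    proof -
      have "(\<lambda>z. dot d z z) \<in> borel_measurable (PiM {..<d} (\<lambda>_. borel))"
        using G.dot_meas(2) by (simp cong: measurable_cong_sets add: G.sets_eq)
      then show ?thesis by measurable
    qed
    from integral_distr[OF W_joint_meas this] show ?thesis unfolding W_joint by simp
  qed
  finally show ?thesis unfolding char_chi_square .
qed

lemma char_sum_squares_approx:
  fixes \<nu> :: "nat \<Rightarrow> (nat \<Rightarrow> real) measure"
  assumes \<nu>: "\<And>t. whitened_law (\<nu> t) d r C" and C: "225 \<le> C"
    and I: "finite I" "I \<noteq> {}" and d: "d > 0"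
  defines "n \<equiv> real (card I)"
  defines "h \<equiv> 1 / sqrt n"
  shows "cmod ((LINT \<omega>|PiM I \<nu>. iexp (s * dot d (\<lambda>i. h * (\<Sum>t\<in>I. \<omega> t i)) (\<lambda>i. h * (\<Sum>t\<in>I. \<omega> t i))))
      - char (chi_square_distribution d) s)
    \<le> real d * sqrt (real d / n) * ((64 / 3 + 1600 / 3 * C ^ 3) * \<bar>s\<bar> ^ 3 + (16 + C) * s\<^sup>2)
      + 9 * C * s\<^sup>2 * (real d)\<^sup>2 / n + dot d r r * (\<bar>s\<bar> + 4 * s\<^sup>2)"
proof -
  have n: "n > 0" using I by (simp add: n_def card_gt_0_iff)
  have h2: "h\<^sup>2 = 1 / n" and h4: "h ^ 4 = 1 / n\<^sup>2"
    using n by (simp_all add: h_def power_divide power4_eq_xxxx power2_eq_square)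
  \<comment> \<open>The choice that equates the error terms \<open>d * \<alpha>\<close> and
    \<open>d * (d / (n * \<alpha>))\<close>.\<close>
  define \<alpha> where "\<alpha> = sqrt (real d / n)"
  have \<alpha>: "\<alpha> > 0" using n d by (simp add: \<alpha>_def)
  have \<alpha>2: "\<alpha> * \<alpha> = real d / n" using n by (simp add: \<alpha>_def)
  have inv: "real d / (n * \<alpha>) = \<alpha>" using \<alpha> \<alpha>2 n by (simp add: field_simps)
  have hn: "real (card I) * h\<^sup>2 \<le> 1" unfolding h2 using n by (simp add: n_def)
  have "cmod ((LINT \<omega>|PiM I \<nu>. iexp (s * dot d (\<lambda>i. h * (\<Sum>t\<in>I. \<omega> t i)) (\<lambda>i. h * (\<Sum>t\<in>I. \<omega> t i))))
      - char (chi_square_distribution d) s)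
    \<le> n * (2 * (8 * \<alpha> * h\<^sup>2 * (2 / 3 * \<bar>s\<bar> ^ 3 + s\<^sup>2 / 2) * (2 * real d)
      + 32 / 3 * \<bar>s\<bar> ^ 3 * C * h ^ 4 / \<alpha> * (25 * C\<^sup>2 * (real d)\<^sup>2)
      + s\<^sup>2 * C * h ^ 4 * (real d)\<^sup>2 * (1 / (2 * \<alpha>) + 9 / 2))
      + \<bar>s\<bar> * h\<^sup>2 * dot d r r + 2 * s\<^sup>2 * h\<^sup>2 * (2 * dot d r r))"
    using lindeberg_swap[where s = s, OF \<nu> gauss_whitened[OF C] I(1) hn \<alpha>]
      gauss_power_chi_square[where s = s, OF I d, folded n_def h_def]
    by (simp only: n_def)
  also have "\<dots> = 32 * \<alpha> * real d * (2 / 3 * \<bar>s\<bar> ^ 3 + s\<^sup>2 / 2)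
      + 1600 / 3 * C ^ 3 * \<bar>s\<bar> ^ 3 * real d * (real d / (n * \<alpha>))
      + s\<^sup>2 * C * real d * (real d / (n * \<alpha>)) + 9 * C * s\<^sup>2 * (real d)\<^sup>2 / n
      + dot d r r * (\<bar>s\<bar> + 4 * s\<^sup>2)"
    unfolding h2 h4 using n \<alpha> by (simp add: field_simps power2_eq_square power3_eq_cube)
  also have "\<dots> = real d * \<alpha> * ((64 / 3 + 1600 / 3 * C ^ 3) * \<bar>s\<bar> ^ 3 + (16 + C) * s\<^sup>2)
      + 9 * C * s\<^sup>2 * (real d)\<^sup>2 / n + dot d r r * (\<bar>s\<bar> + 4 * s\<^sup>2)"
    unfolding inv by (simp add: algebra_simps)
  finally show ?thesis by (simp only: \<alpha>_def)
qed

text \<open>All chi-square laws are realised on one infinite product space as laws of partial sums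
  of squared standard normals, so the theorem for i.i.d. sequences applies. The variance 2 is 3 - 1,
  fourth moment minus squared second moment.\<close>

lemma chi_square_clt:
  "weak_conv_m (\<lambda>d. distr (chi_square_distribution d) borel (\<lambda>x. (x - real d) / sqrt (2 * real d)))
    std_normal_distribution"
proof -
  define P where "P = PiM (UNIV :: nat set) (\<lambda>_. std_normal_distribution)"
  note coord = std_normal_coordinates[where I = "UNIV :: nat set", folded P_def, simplified]
  interpret P: prob_space P by (rule coord)
  have meas [measurable]: "(\<lambda>\<omega>. \<omega> i) \<in> borel_measurable P" for i by (rule coord)
  have int: "integrable P (\<lambda>\<omega>. (\<omega> i)\<^sup>2)" "integrable P (\<lambda>\<omega>. \<omega> i ^ 4)" for i
    using coord(5)[of "\<lambda>x. x\<^sup>2" i] coord(5)[of "\<lambda>x. x ^ 4" i]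
      integrable_std_normal_distribution_moment[of 2] integrable_std_normal_distribution_moment[of 4] by simp_all
  have E: "P.expectation (\<lambda>\<omega>. (\<omega> i)\<^sup>2) = 1" "P.expectation (\<lambda>\<omega>. \<omega> i ^ 4) = 3" for i
    using coord(6)[of "\<lambda>x. x\<^sup>2" i] coord(6)[of "\<lambda>x. x ^ 4" i]
    by (simp_all add: std_normal_second_moment std_normal_fourth_moment)
  have "weak_conv_m (\<lambda>n. distr P borel (\<lambda>x. (\<Sum>i<n. (x i)\<^sup>2 - 1) / sqrt (real n * (sqrt 2)\<^sup>2))) std_normal_distribution"
  proof (rule P.central_limit_theorem[where \<mu> = "distr std_normal_distribution borel (\<lambda>x. x\<^sup>2)"])
    show "P.indep_vars (\<lambda>_. borel) (\<lambda>i x. (x i)\<^sup>2) UNIV"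
      by (rule P.indep_vars_compose2[OF coord(4)]) simp
    show "P.variance (\<lambda>x. (x n)\<^sup>2) = (sqrt 2)\<^sup>2" for n
    proof -
      have "P.variance (\<lambda>x. (x n)\<^sup>2) = P.expectation (\<lambda>x. x n ^ 4 - 2 * (x n)\<^sup>2 + 1)"
        by (intro Bochner_Integration.integral_cong) (auto simp: E power2_diff)
      then show ?thesis using int[of n] E[of n] by (simp add: P.prob_space)
    qed
    show "distr P borel (\<lambda>x. (x n)\<^sup>2) = distr std_normal_distribution borel (\<lambda>x. x\<^sup>2)" for n
      unfolding coord(3)[of n, symmetric] by (subst distr_distr) (auto simp: comp_def)
  qed (use int E in auto)
  moreover have "distr P borel (\<lambda>x. (\<Sum>i<n. (x i)\<^sup>2 - 1) / sqrt (real n * (sqrt 2)\<^sup>2)) =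
      distr (chi_square_distribution n) borel (\<lambda>x. (x - real n) / sqrt (2 * real n))" for n
  proof -
    have restr: "distr P (gauss n) (\<lambda>\<omega>. \<lambda>i\<in>{..<n}. \<omega> i) = gauss n"
      using distr_PiM_reindex[where K = UNIV and M = "\<lambda>_. std_normal_distribution" and f = "\<lambda>i. i" and I = "{..<n}"]
        prob_space_std_normal by (simp add: P_def)
    have restr_meas: "(\<lambda>\<omega>. \<lambda>i\<in>{..<n}. \<omega> i) \<in> P \<rightarrow>\<^sub>M gauss n"
      unfolding P_def by (intro measurable_restrict measurable_component_singleton) simp
    have sum_meas: "(\<lambda>z. \<Sum>i<n. (z i)\<^sup>2) \<in> borel_measurable (gauss n)"
      using std_normal_coordinates(2)[of _ "{..<n}"] by (intro borel_measurable_sum borel_measurable_power) auto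
    have "chi_square_distribution n = distr P borel (\<lambda>\<omega>. \<Sum>i<n. (\<omega> i)\<^sup>2)"
      unfolding chi_square_distribution_def
      by (subst restr[symmetric], subst distr_distr[OF sum_meas restr_meas]) (auto simp: comp_def)
    then show ?thesis
      by (simp add: distr_distr comp_def sum_subtractf mult.commute)
  qed
  ultimately show ?thesis by simp
qed

section \<open>The whitened sample\<close>

text \<open>The situation at a fixed \<open>T\<close>. The bound \<open>m\<close> is separated from
  the distribution so that the constants obtained here can be shared by all
  \<open>T\<close>.\<close>

locale periodogram_sample = prob_space M for M :: "'a measure" +
  fixes T p :: nat and U :: "nat \<Rightarrow> nat \<Rightarrow> 'a \<Rightarrow> real" and F :: "nat set" and \<sigma> m :: real
  assumes T: "T \<ge> 1"
    and indep_vectors: "indep_vars (\<lambda>_. PiM {1..p} (\<lambda>_. borel)) (\<lambda>t \<omega>. \<lambda>k\<in>{1..p}. U t k \<omega>) {1..T}"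
    and indep_components: "\<And>t. t \<in> {1..T} \<Longrightarrow> indep_vars (\<lambda>_. borel) (U t) {1..p}"
    and mean_zero: "\<And>t k. t \<in> {1..T} \<Longrightarrow> k \<in> {1..p} \<Longrightarrow> expectation (U t k) = 0"
    and second_moment: "\<And>t k. t \<in> {1..T} \<Longrightarrow> k \<in> {1..p} \<Longrightarrow> expectation (\<lambda>\<omega>. (U t k \<omega>)\<^sup>2) = \<sigma>\<^sup>2"
    and int_fourth: "\<And>t k. t \<in> {1..T} \<Longrightarrow> k \<in> {1..p} \<Longrightarrow> integrable M (\<lambda>\<omega>. U t k \<omega> ^ 4)"
    and fourth_moment: "\<And>t k. t \<in> {1..T} \<Longrightarrow> k \<in> {1..p} \<Longrightarrow> expectation (\<lambda>\<omega>. U t k \<omega> ^ 4) \<le> m"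
    and m: "1 \<le> m" and \<sigma>: "\<sigma>\<^sup>2 > 0"
    and F: "F \<subseteq> {1..p div 2}" and card_F: "card F \<ge> 2"
begin

definition "d = card F - 1"

text \<open>This is \<open>Lambda_fin\<close> with the estimator replaced by the true
  variance.\<close>

definition "Q \<omega> = real d * (real T * S_xi2 T p F (\<lambda>t k. U t k \<omega>)) / (\<sigma>\<^sup>2)\<^sup>2"

text \<open>The number 225 serves the Gaussian comparison law. The other entry is
  \<open>(25 * m^2 * 2)^2 / (\<sigma>^2)^4\<close>: the bound of \<open>chaos_moments\<close>, a
  factor 2 for the rank-one term, and the fourth power of the normalisation by
  \<open>\<sigma>^2\<close>.\<close>

definition "C = max 225 (2500 * m ^ 4 / (\<sigma>\<^sup>2) ^ 4)"

lemma fin_F: "finite F" and F_nonempty: "F \<noteq> {}" and p_pos: "p > 0" and d_pos: "d > 0"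
proof -
  show "finite F" using F finite_subset by blast
  show "F \<noteq> {}" "d > 0" using card_F by (auto simp: d_def)
  then show "p > 0" using F by (cases "p = 0") auto
qed

definition "helm = (SOME a :: nat \<Rightarrow> nat \<Rightarrow> real.
    (\<forall>i<d. (\<Sum>l\<in>F. a i l) = 0) \<and>
    (\<forall>i<d. \<forall>j<d. (\<Sum>l\<in>F. a i l * a j l) = (if i = j then 1 else 0)) \<and>
    (\<forall>x. (\<Sum>l\<in>F. (x l - emp_mean F x)\<^sup>2) = (\<Sum>i<d. (\<Sum>l\<in>F. a i l * x l)\<^sup>2)))"

lemma helm:
  "i < d \<Longrightarrow> (\<Sum>l\<in>F. helm i l) = 0"
  "i < d \<Longrightarrow> j < d \<Longrightarrow> (\<Sum>l\<in>F. helm i l * helm j l) = (if i = j then 1 else 0)"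
  "(\<Sum>l\<in>F. (x l - emp_mean F x)\<^sup>2) = (\<Sum>i<d. (\<Sum>l\<in>F. helm i l * x l)\<^sup>2)"
  using someI_ex[OF helmert_exists[OF fin_F F_nonempty, folded d_def]] unfolding helm_def[symmetric] by blast+

definition "nyq l = (if 2 * l = p then 1 else 0 :: real)" for l

text \<open>The Helmert coordinates of the indicator of the Nyquist index. In terms of
  \<open>r\<close> the extra sum of \<open>contrast_kernel_norm\<close> becomes a squared inner
  product.\<close>

definition "r i = (\<Sum>l\<in>F. helm i l * nyq l)"

lemma sum_nyq_le: "(\<Sum>l\<in>F. (nyq l)\<^sup>2) \<le> 1"
proof -
  have "(\<Sum>l\<in>F. (nyq l)\<^sup>2) = real (card {l\<in>F. 2 * l = p})"
    using fin_F by (simp add: nyq_def if_distrib[where f = "\<lambda>x. x\<^sup>2"] sum.If_cases Int_def cong: if_cong)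
  also have "card {l\<in>F. 2 * l = p} \<le> card {p div 2}"
    by (rule card_mono) auto
  finally show ?thesis by simp
qed

text \<open>By Parseval for the Helmert rows, the squared length of \<open>r\<close> is the sum of
  squared deviations of \<open>nyq\<close>, and at most one index is Nyquist.\<close>

lemma r_le: "dot d r r \<le> 1"
proof -
  have "dot d r r = (\<Sum>i<d. (\<Sum>l\<in>F. helm i l * nyq l)\<^sup>2)"
    by (simp add: dot_def r_def power2_eq_square)
  also have "\<dots> = (\<Sum>l\<in>F. (nyq l)\<^sup>2) - (\<Sum>l\<in>F. nyq l)\<^sup>2 / real (card F)"
    by (simp only: helm(3)[symmetric] sum_square_deviation[OF fin_F])
  also have "\<dots> \<le> (\<Sum>l\<in>F. (nyq l)\<^sup>2)" by simp
  finally show ?thesis using sum_nyq_le by linarith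
qed

lemma r_zero: "\<forall>l\<in>F. 2 * l \<noteq> p \<Longrightarrow> dot d r r = 0"
  by (simp add: dot_def r_def nyq_def)

text \<open>The Helmert coordinates of the periodogram vector of one sample vector, divided by
  \<open>\<sigma>^2\<close> and written as chaoses since contrasts lose the diagonal. The
  restriction to \<open>{..<d}\<close> makes the value a point of the product space.\<close>

definition "G u = (\<lambda>i\<in>{..<d}. chaos p (contrast_kernel p F (helm i)) u / \<sigma>\<^sup>2)"

definition "combine y l = (\<Sum>i<d. y i * helm i l)"

text \<open>A linear functional of \<open>G\<close> is once more a contrast, with weights
  \<open>combine y\<close>. All moments that \<open>whitened_law\<close> asks for are therefore
  moments of a single chaos, and orthonormality of the Helmert rows turns the norm of the weights
  into that of \<open>y\<close>.\<close>

lemma combine: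
  shows "(\<Sum>l\<in>F. combine y l) = 0"
    and "(\<Sum>l\<in>F. (combine y l)\<^sup>2) = dot d y y"
    and "(\<Sum>l\<in>F. if 2 * l = p then (combine y l)\<^sup>2 else 0) = (dot d r y)\<^sup>2"
    and "dot d y (G u) = chaos p (contrast_kernel p F (combine y)) u / \<sigma>\<^sup>2"
proof -
  show sum0: "(\<Sum>l\<in>F. combine y l) = 0"
    unfolding combine_def by (subst sum.swap) (simp add: sum_distrib_left[symmetric] helm)
  have "(\<Sum>l\<in>F. (combine y l)\<^sup>2) = (\<Sum>l\<in>F. \<Sum>i<d. \<Sum>j<d. y i * y j * (helm i l * helm j l))"
    by (simp add: combine_def power2_eq_square sum_product mult_ac)
  also have "\<dots> = (\<Sum>i<d. \<Sum>j<d. y i * y j * (\<Sum>l\<in>F. helm i l * helm j l))"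
    unfolding sum_distrib_left by (subst sum.swap, subst (2) sum.swap, rule refl)
  also have "\<dots> = (\<Sum>i<d. \<Sum>j<d. y i * y j * (if i = j then 1 else 0))"
    by (intro sum.cong refl) (simp add: helm)
  also have "\<dots> = dot d y y"
    by (simp add: dot_def if_distrib[where f = "\<lambda>a. _ * a"] cong: if_cong)
  finally show "(\<Sum>l\<in>F. (combine y l)\<^sup>2) = dot d y y" .
  have "dot d r y = (\<Sum>i<d. \<Sum>l\<in>F. y i * helm i l * nyq l)"
    by (simp add: dot_def r_def sum_distrib_left mult_ac)
  also have "\<dots> = (\<Sum>l\<in>F. combine y l * nyq l)"
    unfolding combine_def sum_distrib_right by (rule sum.swap)
  finally have dot_r: "dot d r y = (\<Sum>l\<in>F. combine y l * nyq l)" .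
  show "(\<Sum>l\<in>F. if 2 * l = p then (combine y l)\<^sup>2 else 0) = (dot d r y)\<^sup>2"
  \<comment> \<open>At most one index \<open>N\<close> satisfies \<open>2 * N = p\<close>, so sum of
    squares and square of the sum agree.\<close>
  proof (cases "\<exists>N\<in>F. 2 * N = p")
    case True
    then obtain N where N: "N \<in> F" "2 * N = p" by blast
    have eq: "2 * l = p \<longleftrightarrow> l = N" for l using N by auto
    show ?thesis unfolding dot_r nyq_def eq
      using N fin_F by (simp add: if_distrib[where f = "\<lambda>a. _ * a"] cong: if_cong)
  next
    case False
    then show ?thesis unfolding dot_r nyq_def by (simp cong: sum.cong)
  qed
  have "dot d y (G u) = (\<Sum>i<d. y i * (\<Sum>l\<in>F. helm i l * periodogram p u (fund_freq p l))) / \<sigma>\<^sup>2"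
    by (simp add: dot_def G_def contrast_periodogram helm(1) sum_divide_distrib)
  also have "(\<Sum>i<d. y i * (\<Sum>l\<in>F. helm i l * periodogram p u (fund_freq p l))) =
      (\<Sum>l\<in>F. combine y l * periodogram p u (fund_freq p l))"
    unfolding combine_def sum_distrib_left sum_distrib_right by (subst sum.swap) (simp add: mult_ac)
  also have "\<dots> = chaos p (contrast_kernel p F (combine y)) u"
    by (rule contrast_periodogram[OF sum0])
  finally show "dot d y (G u) = chaos p (contrast_kernel p F (combine y)) u / \<sigma>\<^sup>2" .
qed

definition "V t \<omega> = G (\<lambda>k. U t k \<omega>)"

text \<open>Only the indices \<open>1..p\<close> enter, so \<open>V t\<close> is a function of the
  restricted vector, for which independence over \<open>t\<close> is assumed.\<close>

lemma V_restrict: "V t \<omega> = G (\<lambda>k\<in>{1..p}. U t k \<omega>)"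
  unfolding V_def G_def chaos_def by (intro restrict_ext arg_cong2[where f = "(/)"] sum.cong arg_cong2[where f = "(*)"]) auto

lemma G_meas: "G \<in> PiM {1..p} (\<lambda>_. borel) \<rightarrow>\<^sub>M PiM {..<d} (\<lambda>_. borel)"
  unfolding G_def chaos_def
  by (intro measurable_restrict borel_measurable_divide borel_measurable_sum borel_measurable_times
      borel_measurable_const measurable_component_singleton) auto

lemma V_indep: "indep_vars (\<lambda>_. PiM {..<d} (\<lambda>_. borel)) V {1..T}"
  using indep_vars_compose2[OF indep_vectors, of "\<lambda>_. G" "\<lambda>_. PiM {..<d} (\<lambda>_. borel)"] G_meas
  by (simp add: V_restrict[abs_def])

lemma V_meas: "t \<in> {1..T} \<Longrightarrow> V t \<in> M \<rightarrow>\<^sub>M PiM {..<d} (\<lambda>_. borel)"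
  using V_indep by (auto simp: indep_vars_def)

text \<open>By \<open>combine\<close>, \<open>dot d y (V t)\<close> is a chaos over
  \<open>\<sigma>^2\<close>. Its variance \<open>(\<sigma>^2)^2\<close> times the squared kernel
  norm is divided by \<open>(\<sigma>^2)^2\<close>, which leaves exactly the identity plus the
  rank-one term.\<close>

lemma V_whitened:
  assumes t: "t \<in> {1..T}"
  shows "whitened_law (distr M (PiM {..<d} (\<lambda>_. borel)) (V t)) d r C"
proof -
  let ?\<nu> = "distr M (PiM {..<d} (\<lambda>_. borel)) (V t)"
  interpret N: prob_space ?\<nu> by (rule prob_space_distr[OF V_meas[OF t]])
  let ?q = "\<lambda>y \<omega>. chaos p (contrast_kernel p F (combine y)) (\<lambda>k. U t k \<omega>)"
  have dotV: "dot d y (V t \<omega>) = ?q y \<omega> / \<sigma>\<^sup>2" for y \<omega>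
    unfolding V_def by (rule combine)
  note ch = chaos_moments[OF indep_components[OF t] int_fourth[OF t] fourth_moment[OF t] m mean_zero[OF t]
      second_moment[OF t] order_refl]
  have norm: "(\<Sum>k=1..p. \<Sum>j=1..<k. (contrast_kernel p F (combine y) j k)\<^sup>2) = dot d y y + (dot d r y)\<^sup>2" for y
    unfolding contrast_kernel_norm[OF F combine(1) p_pos] combine ..
  have meas: "(\<lambda>v. dot d y v) \<in> borel_measurable (PiM {..<d} (\<lambda>_. borel))" for y
    unfolding dot_def by (intro borel_measurable_sum borel_measurable_times borel_measurable_const
        measurable_component_singleton)
  have pow_meas: "(\<lambda>v. dot d y v ^ n) \<in> borel_measurable (PiM {..<d} (\<lambda>_. borel))" for y n
    using meas by measurable
  show ?thesis
  proof
    show "integrable ?\<nu> (\<lambda>v. dot d y v ^ 4)" for y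
      using ch(1) by (subst integrable_distr_eq[OF V_meas[OF t] pow_meas]) (simp add: dotV power_divide)
    show "N.expectation (\<lambda>v. dot d y v) = 0" for y
      using ch(2) by (subst integral_distr[OF V_meas[OF t] meas]) (simp add: dotV)
    show "N.expectation (\<lambda>v. (dot d y v)\<^sup>2) = dot d y y + (dot d r y)\<^sup>2" for y
      using ch(3)[of "contrast_kernel p F (combine y)", unfolded norm] \<sigma>
      by (subst integral_distr[OF V_meas[OF t] pow_meas]) (simp add: dotV power_divide)
    show "N.expectation (\<lambda>v. dot d y v ^ 4) \<le> C * (dot d y y)\<^sup>2" for y
    proof -
      have "N.expectation (\<lambda>v. dot d y v ^ 4) = expectation (\<lambda>\<omega>. ?q y \<omega> ^ 4) / (\<sigma>\<^sup>2) ^ 4"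
        by (subst integral_distr[OF V_meas[OF t] pow_meas]) (simp add: dotV power_divide)
      also have "\<dots> \<le> (25 * m\<^sup>2 * (dot d y y + (dot d r y)\<^sup>2))\<^sup>2 / (\<sigma>\<^sup>2) ^ 4"
        using ch(4)[of "contrast_kernel p F (combine y)", unfolded norm] by (intro divide_right_mono) simp_all
      also have "\<dots> \<le> (25 * m\<^sup>2 * (2 * dot d y y))\<^sup>2 / (\<sigma>\<^sup>2) ^ 4"
      proof -
        have "(dot d r y)\<^sup>2 \<le> dot d r r * dot d y y" by (rule dot_cauchy_schwarz)
        also have "\<dots> \<le> 1 * dot d y y" by (intro mult_right_mono r_le) auto
        finally show ?thesis
          by (intro divide_right_mono power_mono mult_left_mono) auto
      qed
      also have "\<dots> = 2500 * m ^ 4 / (\<sigma>\<^sup>2) ^ 4 * (dot d y y)\<^sup>2"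
        by (simp add: power_mult_distrib)
      also have "\<dots> \<le> C * (dot d y y)\<^sup>2"
        unfolding C_def by (intro mult_right_mono) auto
      finally show ?thesis .
    qed
    show "dot d r r \<le> 1" by (rule r_le)
    show "1 \<le> C" by (simp add: C_def)
  qed simp
qed

definition "h = 1 / sqrt (real T)"

text \<open>Contrasts are linear, so those of \<open>xi\<close> are averages of those of the single
  periodograms, and Parseval for the Helmert rows gives the sum of squared deviations. The powers of
  \<open>T\<close> combine to \<open>T / T^2 = h^2\<close>.\<close>

lemma Q_eq: "Q \<omega> = dot d (\<lambda>i. h * (\<Sum>t\<in>{1..T}. V t \<omega> i)) (\<lambda>i. h * (\<Sum>t\<in>{1..T}. V t \<omega> i))"
proof -
  let ?x = "xi T p (\<lambda>t k. U t k \<omega>)"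
  have contrast: "(\<Sum>l\<in>F. helm i l * ?x l) = \<sigma>\<^sup>2 / real T * (\<Sum>t\<in>{1..T}. V t \<omega> i)" if "i < d" for i
  proof -
    have "(\<Sum>l\<in>F. helm i l * ?x l) =
        1 / real T * (\<Sum>t=1..T. \<Sum>l\<in>F. helm i l * periodogram p (\<lambda>k. U t k \<omega>) (fund_freq p l))"
      unfolding xi_def sum_distrib_left by (subst sum.swap) (simp add: mult_ac)
    also have "\<dots> = 1 / real T * (\<Sum>t=1..T. \<sigma>\<^sup>2 * V t \<omega> i)"
      using that \<sigma> by (simp add: contrast_periodogram helm(1) V_def G_def)
    finally show ?thesis by (simp add: sum_distrib_left[symmetric])
  qed
  have "real d * S_xi2 T p F (\<lambda>t k. U t k \<omega>) = (\<Sum>l\<in>F. (?x l - emp_mean F ?x)\<^sup>2)"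
    using card_F by (simp add: S_xi2_def emp_variance_def of_nat_diff d_def)
  also have "\<dots> = (\<Sum>i<d. (\<sigma>\<^sup>2 / real T * (\<Sum>t\<in>{1..T}. V t \<omega> i))\<^sup>2)"
    unfolding helm(3) by (intro sum.cong refl) (simp add: contrast)
  also have "\<dots> = (\<sigma>\<^sup>2)\<^sup>2 / (real T)\<^sup>2 * (\<Sum>i<d. (\<Sum>t\<in>{1..T}. V t \<omega> i)\<^sup>2)"
    by (simp only: power_mult_distrib power_divide sum_distrib_left[symmetric])
  finally have S: "real d * S_xi2 T p F (\<lambda>t k. U t k \<omega>) =
    (\<sigma>\<^sup>2)\<^sup>2 / (real T)\<^sup>2 * (\<Sum>i<d. (\<Sum>t\<in>{1..T}. V t \<omega> i)\<^sup>2)" .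
  have h2: "h * h = 1 / real T" by (simp add: h_def)
  have "Q \<omega> = real T * (real d * S_xi2 T p F (\<lambda>t k. U t k \<omega>)) / (\<sigma>\<^sup>2)\<^sup>2"
    by (simp add: Q_def)
  also have "\<dots> = 1 / real T * (\<Sum>i<d. (\<Sum>t\<in>{1..T}. V t \<omega> i)\<^sup>2)"
  proof -
    have "\<sigma> \<noteq> 0" "real T > 0" using \<sigma> T by auto
    then show ?thesis unfolding S by (simp add: power2_eq_square)
  qed
  also have "\<dots> = dot d (\<lambda>i. h * (\<Sum>t\<in>{1..T}. V t \<omega> i)) (\<lambda>i. h * (\<Sum>t\<in>{1..T}. V t \<omega> i))"
    unfolding dot_def h2[symmetric] by (simp only: power2_eq_square mult_ac sum_distrib_left[symmetric])
  finally show ?thesis .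
qed

text \<open>Outside \<open>{1..T}\<close> the law of \<open>V 1\<close> is used as default, because
  the replacement lemmas expect a \<open>whitened_law\<close> at every index.\<close>

definition "\<nu> t = distr M (PiM {..<d} (\<lambda>_. borel)) (V (if t \<in> {1..T} then t else 1))"

lemma \<nu>_whitened: "whitened_law (\<nu> t) d r C"
  unfolding \<nu>_def using T by (intro V_whitened) auto

lemma joint_law: "distr M (PiM {1..T} (\<lambda>_. PiM {..<d} (\<lambda>_. borel))) (\<lambda>\<omega>. \<lambda>t\<in>{1..T}. V t \<omega>) = PiM {1..T} \<nu>"
  using T by (subst indep_vars_joint_distr[OF V_indep]) (auto intro!: PiM_cong simp: \<nu>_def)

text \<open>\<open>Q\<close> is a function of the family \<open>V\<close>, whose joint law is a
  product; this moves the problem to the product space of the replacement argument. Banach-valued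
  \<open>f\<close> covers both the complex exponential and the mean.\<close>

lemma Q_transfer:
  fixes f :: "real \<Rightarrow> 'b::{banach, second_countable_topology}"
  assumes f: "f \<in> borel_measurable borel"
  defines "S \<equiv> \<lambda>\<omega> i. h * (\<Sum>t\<in>{1..T}. \<omega> t i)"
  shows "Q \<in> borel_measurable M"
    and "integrable M (\<lambda>\<omega>. f (Q \<omega>)) \<longleftrightarrow> integrable (PiM {1..T} \<nu>) (\<lambda>\<omega>. f (dot d (S \<omega>) (S \<omega>)))"
    and "(LINT \<omega>|M. f (Q \<omega>)) = (LINT \<omega>|PiM {1..T} \<nu>. f (dot d (S \<omega>) (S \<omega>)))"
proof -
  let ?N = "PiM {1..T} (\<lambda>_. PiM {..<d} (\<lambda>_. borel :: real measure))"
  have V: "(\<lambda>\<omega>. \<lambda>t\<in>{1..T}. V t \<omega>) \<in> M \<rightarrow>\<^sub>M ?N"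
    by (intro measurable_restrict V_meas)
  have comp: "(\<lambda>\<omega>. \<omega> t i) \<in> borel_measurable ?N" if "t \<in> {1..T}" "i < d" for t i
    by (rule measurable_compose[where f = "\<lambda>\<omega>. \<omega> t" and g = "\<lambda>v. v i" and N = "PiM {..<d} (\<lambda>_. borel)"])
      (use that in auto)
  have dot_meas: "(\<lambda>\<omega>. dot d (S \<omega>) (S \<omega>)) \<in> borel_measurable ?N"
    unfolding dot_def S_def
    by (intro borel_measurable_sum borel_measurable_times borel_measurable_const comp) auto
  have Q: "Q \<omega> = dot d (S (\<lambda>t\<in>{1..T}. V t \<omega>)) (S (\<lambda>t\<in>{1..T}. V t \<omega>))" for \<omega>
  proof -
    have "(\<Sum>t\<in>{1..T}. V t \<omega> i) = (\<Sum>t\<in>{1..T}. (\<lambda>t\<in>{1..T}. V t \<omega>) t i)" for i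
      by (intro sum.cong) auto
    then show ?thesis unfolding Q_eq S_def by (simp only:)
  qed
  show "Q \<in> borel_measurable M"
    unfolding Q[abs_def] by (rule measurable_compose[OF V dot_meas])
  have fm: "(\<lambda>\<omega>. f (dot d (S \<omega>) (S \<omega>))) \<in> borel_measurable ?N"
    using dot_meas f by (rule measurable_compose)
  show "integrable M (\<lambda>\<omega>. f (Q \<omega>)) \<longleftrightarrow> integrable (PiM {1..T} \<nu>) (\<lambda>\<omega>. f (dot d (S \<omega>) (S \<omega>)))"
    unfolding Q joint_law[symmetric] by (rule integrable_distr_eq[OF V fm, symmetric])
  show "(LINT \<omega>|M. f (Q \<omega>)) = (LINT \<omega>|PiM {1..T} \<nu>. f (dot d (S \<omega>) (S \<omega>)))"
    unfolding Q joint_law[symmetric] by (rule integral_distr[OF V fm, symmetric])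
qed

lemma Q_meas: "Q \<in> borel_measurable M"
  by (rule Q_transfer(1)[of "\<lambda>x. x :: real"]) simp

lemma Q_nonneg: "0 \<le> Q \<omega>"
  unfolding Q_eq by simp

lemma Q_integral: "integrable M Q" "expectation Q \<le> 2 * real d"
proof -
  have "real (card {1..T}) * h\<^sup>2 \<le> 1" by (simp add: h_def power_divide)
  note mom = product_law_moments(1,2)[where N = \<nu>, OF \<nu>_whitened finite_atLeastAtMost this]
  show "integrable M Q" "expectation Q \<le> 2 * real d"
    using mom Q_transfer(2,3)[of "\<lambda>x. x :: real"] by simp_all
qed

lemma Q_char:
  "cmod (expectation (\<lambda>\<omega>. iexp (s * Q \<omega>)) - char (chi_square_distribution d) s)
    \<le> real d * sqrt (real d / real T) * ((64 / 3 + 1600 / 3 * C ^ 3) * \<bar>s\<bar> ^ 3 + (16 + C) * s\<^sup>2)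
      + 9 * C * s\<^sup>2 * (real d)\<^sup>2 / real T + dot d r r * (\<bar>s\<bar> + 4 * s\<^sup>2)"
proof -
  have "225 \<le> C" by (simp add: C_def)
  from char_sum_squares_approx[where s = s and I = "{1..T}", OF \<nu>_whitened this _ _ d_pos] T
  show ?thesis
    by (subst Q_transfer(3)) (auto simp: h_def)
qed

end

section \<open>Limit theorems\<close>

text \<open>Nothing is known about the space at index 0, so the continuity theorem is applied to the
  sequence shifted by one.\<close>

lemma conv_in_distr_char:
  fixes X :: "nat \<Rightarrow> 'a \<Rightarrow> real"
  assumes prob: "\<And>n. n \<ge> 1 \<Longrightarrow> prob_space (M n)"
    and meas: "\<And>n. n \<ge> 1 \<Longrightarrow> X n \<in> borel_measurable (M n)"
    and \<nu>: "real_distribution \<nu>"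
    and char: "\<And>s. (\<lambda>n. LINT \<omega>|M n. iexp (s * X n \<omega>)) \<longlonglongrightarrow> char \<nu> s"
  shows "conv_in_distr M X \<nu>"
proof -
  let ?D = "\<lambda>n. distr (M n) borel (X n)"
  have "weak_conv_m (\<lambda>n. ?D (Suc n)) \<nu>"
  proof (rule levy_continuity[OF _ \<nu>])
    show "real_distribution (?D (Suc n))" for n
      using prob[of "Suc n"] meas[of "Suc n"] by (intro prob_space.real_distribution_distr) auto
    show "(\<lambda>n. char (?D (Suc n)) s) \<longlonglongrightarrow> char \<nu> s" for s
    proof -
      have "char (?D (Suc n)) s = (LINT \<omega>|M (Suc n). iexp (s * X (Suc n) \<omega>))" for n
        unfolding char_def using meas[of "Suc n"] by (subst integral_distr) auto
      then show ?thesis using LIMSEQ_Suc[OF char[of s]] by simp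
    qed
  qed
  then show ?thesis
    unfolding conv_in_distr_def weak_conv_m_def weak_conv_def
    by (auto intro: LIMSEQ_imp_Suc)
qed

text \<open>The two exponentials differ by at most \<open>|s| * R * |Z|\<close> and by at most 2.
  The first bound is used where \<open>|Z|\<close> is small, the second on the complement, whose
  probability tends to 0. The uniform bound on the mean of \<open>R\<close> takes the place of
  tightness.\<close>

lemma slutsky_char:
  fixes X Y R Z :: "nat \<Rightarrow> 'a \<Rightarrow> real"
  assumes prob: "\<And>n. n \<ge> 1 \<Longrightarrow> prob_space (M n)"
    and meas: "\<And>n. n \<ge> 1 \<Longrightarrow> X n \<in> borel_measurable (M n)" "\<And>n. n \<ge> 1 \<Longrightarrow> Y n \<in> borel_measurable (M n)"
      "\<And>n. n \<ge> 1 \<Longrightarrow> Z n \<in> borel_measurable (M n)"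
    and R: "\<And>n. n \<ge> 1 \<Longrightarrow> integrable (M n) (R n)" "\<And>n \<omega>. n \<ge> 1 \<Longrightarrow> 0 \<le> R n \<omega>"
      "\<And>n. n \<ge> 1 \<Longrightarrow> (LINT \<omega>|M n. R n \<omega>) \<le> B"
    and Y: "\<And>n \<omega>. n \<ge> 1 \<Longrightarrow> Y n \<omega> = X n \<omega> + R n \<omega> * Z n \<omega>"
    and Z: "conv_in_prob M Z 0"
  shows "(\<lambda>n. (LINT \<omega>|M n. iexp (s * Y n \<omega>)) - (LINT \<omega>|M n. iexp (s * X n \<omega>))) \<longlonglongrightarrow> 0"
proof (rule metric_LIMSEQ_I)
  fix e :: real assume e: "e > 0"
  have "0 \<le> (LINT \<omega>|M 1. R 1 \<omega>)" using R(2)[of 1] by (intro integral_nonneg_AE) auto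
  then have "B \<ge> 0" using R(3)[of 1] by linarith
  \<comment> \<open>This makes the contribution of small \<open>Z\<close> less than
    \<open>e / 2\<close>; the exceptional event, of probability below \<open>e / 4\<close> and
    weighted by 2, takes the other half. The summand 1 avoids division by 0.\<close>
  define \<delta> where "\<delta> = e / (2 * (\<bar>s\<bar> * B + 1))"
  have den: "\<bar>s\<bar> * B + 1 > 0" using \<open>B \<ge> 0\<close> by (simp add: add_nonneg_pos)
  have \<delta>: "\<delta> > 0" using e den by (simp add: \<delta>_def)
  have "\<bar>s\<bar> * \<delta> * B < e / 2"
    using e den by (simp add: \<delta>_def field_simps)
  let ?A = "\<lambda>n. {\<omega> \<in> space (M n). \<bar>Z n \<omega> - 0\<bar> > \<delta>}"
  have "(\<lambda>n. measure (M n) (?A n)) \<longlonglongrightarrow> 0"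
    using Z \<delta> unfolding conv_in_prob_def by blast
  from LIMSEQ_D[OF this, of "e / 4"] e obtain N where N: "\<And>n. n \<ge> N \<Longrightarrow> measure (M n) (?A n) < e / 4"
    by auto
  show "\<exists>N. \<forall>n\<ge>N. dist ((LINT \<omega>|M n. iexp (s * Y n \<omega>)) - (LINT \<omega>|M n. iexp (s * X n \<omega>))) 0 < e"
  proof (intro exI[of _ "max N 1"] allI impI)
    fix n assume n: "n \<ge> max N 1"
    then have n1: "n \<ge> 1" by simp
    interpret prob_space "M n" by (rule prob[OF n1])
    have A: "?A n \<in> sets (M n)" using meas(3)[OF n1] by measurable
    have ind: "integrable (M n) (indicator (?A n) :: _ \<Rightarrow> real)"
        "expectation (indicator (?A n)) = measure (M n) (?A n)"
      using integrable_real_indicator[OF A] sets.Int_space_eq2[OF A]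
      by (simp_all only: Bochner_Integration.integral_indicator) (simp add: emeasure_eq_measure)
    have int: "integrable (M n) (\<lambda>\<omega>. iexp (s * Y n \<omega>))" "integrable (M n) (\<lambda>\<omega>. iexp (s * X n \<omega>))"
      using meas[OF n1] by (auto intro!: integrable_iexp)
    have "cmod (expectation (\<lambda>\<omega>. iexp (s * Y n \<omega>) - iexp (s * X n \<omega>)))
        \<le> expectation (\<lambda>\<omega>. \<bar>s\<bar> * \<delta> * R n \<omega> + 2 * indicator (?A n) \<omega>)"
    proof (rule norm_integral_le)
      show "integrable (M n) (\<lambda>\<omega>. \<bar>s\<bar> * \<delta> * R n \<omega> + 2 * indicator (?A n) \<omega>)"
        by (intro Bochner_Integration.integrable_add integrable_mult_right R(1)[OF n1] ind(1))
      fix \<omega> assume \<omega>: "\<omega> \<in> space (M n)"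
      show "cmod (iexp (s * Y n \<omega>) - iexp (s * X n \<omega>)) \<le> \<bar>s\<bar> * \<delta> * R n \<omega> + 2 * indicator (?A n) \<omega>"
      proof (cases "\<omega> \<in> ?A n")
        case True
        have "cmod (iexp (s * Y n \<omega>) - iexp (s * X n \<omega>)) \<le> 2"
          by (rule order_trans[OF norm_triangle_ineq4]) simp
        moreover have "0 \<le> \<bar>s\<bar> * \<delta> * R n \<omega>" using R(2)[OF n1, of \<omega>] \<delta> by simp
        moreover have "indicator (?A n) \<omega> = (1 :: real)" using True by simp
        ultimately show ?thesis by linarith
      next
        case False
        have "iexp (s * Y n \<omega>) - iexp (s * X n \<omega>) = iexp (s * X n \<omega>) * (iexp (s * (R n \<omega> * Z n \<omega>)) - 1)"
          by (simp add: Y[OF n1] algebra_simps exp_add)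
        then have "cmod (iexp (s * Y n \<omega>) - iexp (s * X n \<omega>)) = cmod (iexp (s * (R n \<omega> * Z n \<omega>)) - 1)"
          by (simp add: norm_mult)
        also have "\<dots> \<le> \<bar>s * (R n \<omega> * Z n \<omega>)\<bar>"
          using iexp_approx1[of "s * (R n \<omega> * Z n \<omega>)" 0] by simp
        also have "\<dots> = \<bar>s\<bar> * (R n \<omega> * \<bar>Z n \<omega>\<bar>)" using R(2)[OF n1, of \<omega>] by (simp add: abs_mult)
        also have "\<dots> \<le> \<bar>s\<bar> * (R n \<omega> * \<delta>)"
          using False \<omega> R(2)[OF n1, of \<omega>] by (intro mult_left_mono) auto
        finally show ?thesis using False by (simp add: mult_ac)
      qed
    qed (use int in auto)
    also have "\<dots> = \<bar>s\<bar> * \<delta> * expectation (R n) + 2 * measure (M n) (?A n)"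
      using R(1)[OF n1] ind by (simp del: Bochner_Integration.integral_indicator)
    also have "\<dots> \<le> \<bar>s\<bar> * \<delta> * B + 2 * measure (M n) (?A n)"
      using R(3)[OF n1] \<delta> by (intro add_right_mono mult_left_mono) auto
    also have "\<dots> < e" using \<open>\<bar>s\<bar> * \<delta> * B < e / 2\<close> N[of n] n by simp
    finally show "dist ((LINT \<omega>|M n. iexp (s * Y n \<omega>)) - (LINT \<omega>|M n. iexp (s * X n \<omega>))) 0 < e"
      using int by (simp add: dist_norm)
  qed
qed

text \<open>Near \<open>v\<close> the map taking \<open>y\<close> to \<open>v^2 / y^2\<close> is
  Lipschitz, so the ratio inherits the rate \<open>c n\<close> of the estimator, and the weights
  \<open>w n\<close> may grow at that rate. As \<open>c n \<ge> 1\<close>, the scaled deviation also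
  keeps \<open>y\<close> away from 0.\<close>

lemma conv_in_prob_square_ratio:
  fixes Y :: "nat \<Rightarrow> 'a \<Rightarrow> real" and v K :: real
  assumes prob: "\<And>n. n \<ge> 1 \<Longrightarrow> prob_space (M n)"
    and meas: "\<And>n. n \<ge> 1 \<Longrightarrow> Y n \<in> borel_measurable (M n)"
    and v: "v > 0" and K: "K > 0" and c: "\<And>n. n \<ge> 1 \<Longrightarrow> c n \<ge> 1"
    and w: "\<And>n. n \<ge> 1 \<Longrightarrow> \<bar>w n\<bar> \<le> K * c n"
    and Y: "conv_in_prob M (\<lambda>n \<omega>. c n * (Y n \<omega> - v)) 0"
  shows "conv_in_prob M (\<lambda>n \<omega>. w n * (v\<^sup>2 / (Y n \<omega>)\<^sup>2 - 1)) 0"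
  unfolding conv_in_prob_def
proof (intro allI impI)
  fix e :: real assume e: "e > 0"
  \<comment> \<open>The first entry ensures \<open>y \<ge> v / 2\<close>; the second makes the
    Lipschitz estimate at most \<open>e\<close>. Its 10 is 5/2, from the bound on
    \<open>|v + y|\<close>, divided by 1/4, from the bound on \<open>y^2\<close>.\<close>
  define \<delta> where "\<delta> = min (v / 2) (v * e / (10 * K))"
  have \<delta>: "\<delta> > 0" using v e K by (simp add: \<delta>_def)
  have le: "\<bar>w n * (v\<^sup>2 / y\<^sup>2 - 1)\<bar> \<le> e" if n: "n \<ge> 1" and y: "\<bar>c n * (y - v)\<bar> \<le> \<delta>" for n y
  proof -
    have cn: "c n \<ge> 1" by (rule c[OF n])
    have cy: "c n * \<bar>y - v\<bar> \<le> \<delta>" using y cn by (simp add: abs_mult)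
    have "1 * \<bar>y - v\<bar> \<le> c n * \<bar>y - v\<bar>" by (intro mult_right_mono cn) auto
    then have yv: "\<bar>y - v\<bar> \<le> v / 2" using cy by (simp add: \<delta>_def)
    then have y_ge: "v / 2 \<le> y" and y_le: "\<bar>v + y\<bar> \<le> 5 / 2 * v" using v by (auto simp: abs_if split: if_splits)
    then have y_pos: "y > 0" using v by simp
    have y2: "v\<^sup>2 / 4 \<le> y\<^sup>2"
      using power_mono[OF y_ge, of 2] v by (simp add: power_divide)
    have "\<bar>v\<^sup>2 / y\<^sup>2 - 1\<bar> = \<bar>y - v\<bar> * \<bar>v + y\<bar> / y\<^sup>2"
    proof -
      have "v\<^sup>2 / y\<^sup>2 - 1 = - ((y - v) * (v + y)) / y\<^sup>2"
        using y_pos by (simp add: field_simps power2_eq_square)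
      then show ?thesis by (simp add: abs_mult)
    qed
    also have "\<dots> \<le> \<bar>y - v\<bar> * (5 / 2 * v) / (v\<^sup>2 / 4)"
      using v y2 y_le by (intro frac_le mult_left_mono) auto
    also have "\<dots> = 10 * \<bar>y - v\<bar> / v"
      using v by (simp add: power2_eq_square)
    finally have ratio: "\<bar>v\<^sup>2 / y\<^sup>2 - 1\<bar> \<le> 10 * \<bar>y - v\<bar> / v" .
    have "\<bar>w n * (v\<^sup>2 / y\<^sup>2 - 1)\<bar> \<le> (K * c n) * (10 * \<bar>y - v\<bar> / v)"
      unfolding abs_mult using K cn by (intro mult_mono w[OF n] ratio) auto
    also have "\<dots> = 10 * K / v * (c n * \<bar>y - v\<bar>)" by simp
    also have "\<dots> \<le> 10 * K / v * (v * e / (10 * K))"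
      using cy K v by (intro mult_left_mono) (auto simp: \<delta>_def)
    also have "\<dots> = e" using K v by simp
    finally show ?thesis .
  qed
  have lim: "(\<lambda>n. measure (M n) {\<omega> \<in> space (M n). \<bar>c n * (Y n \<omega> - v) - 0\<bar> > \<delta>}) \<longlonglongrightarrow> 0"
    using Y \<delta> unfolding conv_in_prob_def by blast
  show "(\<lambda>n. measure (M n) {\<omega> \<in> space (M n). \<bar>w n * (v\<^sup>2 / (Y n \<omega>)\<^sup>2 - 1) - 0\<bar> > e}) \<longlonglongrightarrow> 0"
  proof (rule tendsto_sandwich[OF _ _ tendsto_const lim])
    show "\<forall>\<^sub>F n in sequentially. measure (M n) {\<omega> \<in> space (M n). \<bar>w n * (v\<^sup>2 / (Y n \<omega>)\<^sup>2 - 1) - 0\<bar> > e}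
        \<le> measure (M n) {\<omega> \<in> space (M n). \<bar>c n * (Y n \<omega> - v) - 0\<bar> > \<delta>}"
      using eventually_ge_at_top[of 1]
    proof eventually_elim
      case (elim n)
      interpret prob_space "M n" by (rule prob[OF elim])
      have [measurable]: "Y n \<in> borel_measurable (M n)" by (rule meas[OF elim])
      show ?case
        using le[OF elim] by (intro finite_measure_mono) (auto simp: not_le[symmetric])
    qed
  qed auto
qed

section \<open>Standardised chi-square laws and the two limits\<close>

lemma chi_square_real_distribution: "real_distribution (chi_square_distribution d)"
proof -
  have "(\<lambda>z. \<Sum>i<d. (z i)\<^sup>2) \<in> borel_measurable (gauss d)"
    using std_normal_coordinates(2)[of _ "{..<d}"] by (intro borel_measurable_sum borel_measurable_power) auto
  then show ?thesis
    unfolding chi_square_distribution_def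
    by (intro prob_space.real_distribution_distr std_normal_coordinates(1))
qed

lemma char_standardized_chi_square:
  "char (distr (chi_square_distribution d) borel (\<lambda>x. (x - real d) / sqrt (2 * real d))) s =
    iexp (- (s / sqrt (2 * real d) * real d)) * char (chi_square_distribution d) (s / sqrt (2 * real d))"
proof -
  interpret real_distribution "chi_square_distribution d" by (rule chi_square_real_distribution)
  have "iexp (s * ((x - real d) / sqrt (2 * real d))) =
      iexp (- (s / sqrt (2 * real d) * real d)) * iexp (s / sqrt (2 * real d) * x)" for x
    by (simp add: exp_add[symmetric] algebra_simps diff_divide_distrib)
  then show ?thesis unfolding char_def by (subst integral_distr) auto
qed

theorem proposition3p1:
  fixes M :: "nat \<Rightarrow> 'a measure"
    and p :: "nat \<Rightarrow> nat"
    and U :: "nat \<Rightarrow> nat \<Rightarrow> nat \<Rightarrow> 'a \<Rightarrow> real"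
    and \<mu> :: "real measure"
    and \<sigma> :: real
    and s2hat :: "nat \<Rightarrow> 'a \<Rightarrow> real"
    and F :: "nat \<Rightarrow> nat set"
  assumes prob: "\<And>T. T \<ge> 1 \<Longrightarrow> prob_space (M T)"
    and iid_vectors: "\<And>T. T \<ge> 1 \<Longrightarrow>
      iid_vars (M T) (PiM {1..p T} (\<lambda>_. borel)) (\<lambda>t \<omega>. \<lambda>k\<in>{1..p T}. U T t k \<omega>) {1..T}"
    and H0: "\<And>T t. T \<ge> 1 \<Longrightarrow> t \<in> {1..T} \<Longrightarrow> iid_vars (M T) borel (U T t) {1..p T}"
    and law: "\<And>T. T \<ge> 1 \<Longrightarrow> distr (M T) borel (U T 1 1) = \<mu>"
    and mean_zero: "\<And>T. T \<ge> 1 \<Longrightarrow> prob_space.expectation (M T) (U T 1 1) = 0"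
    and second_moment: "\<And>T. T \<ge> 1 \<Longrightarrow>
      prob_space.expectation (M T) (\<lambda>\<omega>. (U T 1 1 \<omega>)\<^sup>2) = \<sigma>\<^sup>2"
    and variance_pos: "\<sigma>\<^sup>2 > 0"
    and fourth_moment: "\<And>T. T \<ge> 1 \<Longrightarrow> integrable (M T) (\<lambda>\<omega>. (U T 1 1 \<omega>) ^ 4)"
    and estimator: "\<And>T. T \<ge> 1 \<Longrightarrow> s2hat T \<in> borel_measurable (M T)"
    and consistent: "conv_in_prob M s2hat (\<sigma>\<^sup>2)"
    and frequencies: "\<And>T. T \<ge> 1 \<Longrightarrow> F T \<subseteq> {1..p T div 2}"
    and card_frequencies: "\<And>T. T \<ge> 1 \<Longrightarrow> card (F T) \<ge> 2"
  shows
    "(\<forall>f. (\<forall>T\<ge>1. card (F T) = f) \<and>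
         (\<forall>\<^sub>F T in sequentially. \<forall>l\<in>F T. 2 * l \<noteq> p T) \<longrightarrow>
       conv_in_distr M (\<lambda>T \<omega>. Lambda_fin T (p T) (F T) (\<lambda>t k. U T t k \<omega>) (s2hat T \<omega>))
         (chi_square_distribution (f - 1)))
     \<and>
     ((\<forall>T\<ge>1. integrable (M T) (\<lambda>\<omega>. (U T 1 1 \<omega>) ^ 8)) \<and>
      filterlim (\<lambda>T. card (F T)) at_top sequentially \<and>
      (\<lambda>T. real (card (F T)) / real T) \<longlonglongrightarrow> 0 \<and>
      conv_in_prob M (\<lambda>T \<omega>. sqrt (real (card (F T))) * (s2hat T \<omega> - \<sigma>\<^sup>2)) 0 \<longrightarrow>
       conv_in_distr M (\<lambda>T \<omega>. Lambda_inf T (p T) (F T) (\<lambda>t k. U T t k \<omega>) (s2hat T \<omega>))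
         std_normal_distribution)"
proof -
  \<comment> \<open>It depends on \<open>\<mu>\<close> only, so the constants of
    \<open>periodogram_sample\<close> are the same for all \<open>T\<close>; the maximum yields
    \<open>1 \<le> m\<close>.\<close>
  define m where "m = max 1 (LINT x|\<mu>. x ^ 4)"
  define v where "v = \<sigma>\<^sup>2"
  have v: "v > 0" using variance_pos by (simp add: v_def)
  define d where "d T = card (F T) - 1" for T
  have d: "d T \<ge> 1" "real (d T) = real (card (F T)) - 1" if "T \<ge> 1" for T
    using card_frequencies[OF that] by (auto simp: d_def of_nat_diff)
  define S where "S T \<omega> = real T * S_xi2 T (p T) (F T) (\<lambda>t k. U T t k \<omega>)" for T \<omega>
  define Q where "Q T \<omega> = real (d T) * S T \<omega> / v\<^sup>2" for T \<omega>
  have sample: "periodogram_sample (M T) T (p T) (U T) (F T) \<sigma> m" if T: "T \<ge> 1" for T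
  proof -
    interpret prob_space "M T" by (rule prob[OF T])
    have p: "1 \<in> {1..p T}"
    proof -
      have "F T \<noteq> {}" using card_frequencies[OF T] by auto
      then show ?thesis using frequencies[OF T] by (cases "p T = 0") auto
    qed
    have one: "1 \<in> {1..T}" using T by simp
    have comp_meas: "U T t k \<in> borel_measurable (M T)" if "t \<in> {1..T}" "k \<in> {1..p T}" for t k
      using H0[OF T that(1)] that by (auto simp: iid_vars_def indep_vars_def2)
    have vec_meas: "(\<lambda>\<omega>. \<lambda>k\<in>{1..p T}. U T t k \<omega>) \<in> M T \<rightarrow>\<^sub>M PiM {1..p T} (\<lambda>_. borel)" if "t \<in> {1..T}" for t
      using that by (intro measurable_restrict comp_meas)
    \<comment> \<open>Within a vector the components share one law by \<open>H0\<close>; across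
      vectors the first components do, as projections of equal vector laws; at
      \<open>t = k = 1\<close> this law is \<open>\<mu>\<close>.\<close>
    have law_eq: "distr (M T) borel (U T t k) = \<mu>" if t: "t \<in> {1..T}" and k: "k \<in> {1..p T}" for t k
    proof -
      have proj: "distr (distr (M T) (PiM {1..p T} (\<lambda>_. borel)) (\<lambda>\<omega>. \<lambda>k\<in>{1..p T}. U T t k \<omega>)) borel (\<lambda>x. x 1) =
          distr (M T) borel (U T t 1)" if "t \<in> {1..T}" for t
        using p by (subst distr_distr[OF _ vec_meas[OF that]]) (auto simp: comp_def)
      have "distr (M T) borel (U T t k) = distr (M T) borel (U T t 1)"
        using H0[OF T t] k p unfolding iid_vars_def by blast
      moreover have "distr (M T) (PiM {1..p T} (\<lambda>_. borel)) (\<lambda>\<omega>. \<lambda>k\<in>{1..p T}. U T t k \<omega>) =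
          distr (M T) (PiM {1..p T} (\<lambda>_. borel)) (\<lambda>\<omega>. \<lambda>k\<in>{1..p T}. U T 1 k \<omega>)"
        using iid_vectors[OF T] t one unfolding iid_vars_def by blast
      ultimately show ?thesis using proj[OF t] proj[OF one] law[OF T] by (simp only:)
    qed
    have transfer: "integrable (M T) (\<lambda>\<omega>. f (U T t k \<omega>)) \<longleftrightarrow> integrable \<mu> f"
      "expectation (\<lambda>\<omega>. f (U T t k \<omega>)) = (LINT x|\<mu>. f x)"
      if "t \<in> {1..T}" "k \<in> {1..p T}" "f \<in> borel_measurable borel" for t k and f :: "real \<Rightarrow> real"
      using integrable_distr_eq[OF comp_meas[OF that(1,2)] that(3)]
        integral_distr[OF comp_meas[OF that(1,2)] that(3)] law_eq[OF that(1,2)] by simp_all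
    show ?thesis
    proof
      show "indep_vars (\<lambda>_. PiM {1..p T} (\<lambda>_. borel)) (\<lambda>t \<omega>. \<lambda>k\<in>{1..p T}. U T t k \<omega>) {1..T}"
        using iid_vectors[OF T] by (simp add: iid_vars_def)
      fix t assume t: "t \<in> {1..T}"
      show "indep_vars (\<lambda>_. borel) (U T t) {1..p T}"
        using H0[OF T t] by (simp add: iid_vars_def)
      fix k assume k: "k \<in> {1..p T}"
      show "expectation (U T t k) = 0"
        using mean_zero[OF T] transfer(2)[OF t k, of "\<lambda>x. x"] transfer(2)[OF one p, of "\<lambda>x. x"] by simp
      show "expectation (\<lambda>\<omega>. (U T t k \<omega>)\<^sup>2) = \<sigma>\<^sup>2"
        using second_moment[OF T] transfer(2)[OF t k, of "\<lambda>x. x\<^sup>2"] transfer(2)[OF one p, of "\<lambda>x. x\<^sup>2"] by simp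
      show "integrable (M T) (\<lambda>\<omega>. U T t k \<omega> ^ 4)"
        using fourth_moment[OF T] transfer(1)[OF t k, of "\<lambda>x. x ^ 4"] transfer(1)[OF one p, of "\<lambda>x. x ^ 4"] by simp
      show "expectation (\<lambda>\<omega>. U T t k \<omega> ^ 4) \<le> m"
        using transfer(2)[OF t k, of "\<lambda>x. x ^ 4"] by (simp add: m_def)
    qed (use T variance_pos frequencies[OF T] card_frequencies[OF T] in \<open>auto simp: m_def\<close>)
  qed
  define C where "C = max 225 (2500 * m ^ 4 / v ^ 4)"
  let ?bound = "\<lambda>T s \<rho>. real (d T) * sqrt (real (d T) / real T) * ((64 / 3 + 1600 / 3 * C ^ 3) * \<bar>s\<bar> ^ 3 + (16 + C) * s\<^sup>2)
      + 9 * C * s\<^sup>2 * (real (d T))\<^sup>2 / real T + \<rho> * (\<bar>s\<bar> + 4 * s\<^sup>2)"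
  have Q: "Q T \<in> borel_measurable (M T)" "0 \<le> Q T \<omega>" "integrable (M T) (Q T)" "(LINT \<omega>|M T. Q T \<omega>) \<le> 2 * real (d T)"
    and "\<exists>\<rho>. 0 \<le> \<rho> \<and> \<rho> \<le> 1 \<and> ((\<forall>l\<in>F T. 2 * l \<noteq> p T) \<longrightarrow> \<rho> = 0) \<and>
      (\<forall>s. cmod ((LINT \<omega>|M T. iexp (s * Q T \<omega>)) - char (chi_square_distribution (d T)) s) \<le> ?bound T s \<rho>)"
    if T: "T \<ge> 1" for T \<omega>
  proof -
    interpret P: periodogram_sample "M T" T "p T" "U T" "F T" \<sigma> m by (rule sample[OF T])
    have Q: "P.Q = Q T" by (simp add: fun_eq_iff P.Q_def P.d_def Q_def S_def d_def v_def)
    have C: "P.C = C" by (simp add: P.C_def C_def v_def)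
    have dT: "P.d = d T" by (simp add: P.d_def d_def)
    show "Q T \<in> borel_measurable (M T)" "0 \<le> Q T \<omega>" "integrable (M T) (Q T)" "(LINT \<omega>|M T. Q T \<omega>) \<le> 2 * real (d T)"
      using P.Q_meas P.Q_nonneg[of \<omega>] P.Q_integral unfolding Q dT by auto
    show "\<exists>\<rho>. 0 \<le> \<rho> \<and> \<rho> \<le> 1 \<and> ((\<forall>l\<in>F T. 2 * l \<noteq> p T) \<longrightarrow> \<rho> = 0) \<and>
      (\<forall>s. cmod ((LINT \<omega>|M T. iexp (s * Q T \<omega>)) - char (chi_square_distribution (d T)) s) \<le> ?bound T s \<rho>)"
      using P.Q_char P.r_le P.r_zero unfolding Q C dT by (intro exI[of _ "dot (d T) P.r P.r"]) auto
  qed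
  \<comment> \<open>The number \<open>\<rho> T\<close> is the squared length of the vector
    \<open>r\<close> of the sample at \<open>T\<close>; its value matters only through these
    bounds.\<close>
  then obtain \<rho> where \<rho>: "\<And>T. T \<ge> 1 \<Longrightarrow> 0 \<le> \<rho> T" "\<And>T. T \<ge> 1 \<Longrightarrow> \<rho> T \<le> 1"
    "\<And>T. T \<ge> 1 \<Longrightarrow> \<forall>l\<in>F T. 2 * l \<noteq> p T \<Longrightarrow> \<rho> T = 0"
    "\<And>T s. T \<ge> 1 \<Longrightarrow> cmod ((LINT \<omega>|M T. iexp (s * Q T \<omega>)) - char (chi_square_distribution (d T)) s) \<le> ?bound T s (\<rho> T)"
    by metis
  \<comment> \<open>\<open>R\<close> is \<open>T * S_xi2\<close> over the squared true variance. Its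
    mean is at most 2 for every \<open>T\<close>, which is what \<open>slutsky_char\<close> requires
    of the factor in front of the estimation error.\<close>
  define R where "R T \<omega> = Q T \<omega> / real (d T)" for T \<omega>
  have R: "integrable (M T) (R T)" "0 \<le> R T \<omega>" "(LINT \<omega>|M T. R T \<omega>) \<le> 2" if "T \<ge> 1" for T \<omega>
    using Q[OF that] d[OF that] by (auto simp: R_def[abs_def] divide_simps)
  have S_eq: "S T \<omega> = R T \<omega> * v\<^sup>2" if "T \<ge> 1" for T \<omega>
    using d[OF that] v by (simp add: R_def Q_def)
  show ?thesis
  proof (intro conjI allI impI; elim conjE)
    fix f
    assume f: "\<forall>T\<ge>1. card (F T) = f" and nyq: "\<forall>\<^sub>F T in sequentially. \<forall>l\<in>F T. 2 * l \<noteq> p T"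
    have df: "d T = f - 1" if "T \<ge> 1" for T using f that by (simp add: d_def)
    define w where "w T = real (d T)" for T
    \<comment> \<open>Replacing the estimator by the true value changes \<open>Lambda_fin\<close>
      from \<open>Q * v^2 / s2hat^2\<close> to \<open>Q\<close>; since \<open>Q = R * d\<close>, the
      difference is \<open>R * Z\<close> with weight \<open>w = d\<close>, which is bounded
      here.\<close>
    define Z where "Z T \<omega> = w T * (v\<^sup>2 / (s2hat T \<omega>)\<^sup>2 - 1)" for T \<omega>
    define L where "L T \<omega> = Lambda_fin T (p T) (F T) (\<lambda>t k. U T t k \<omega>) (s2hat T \<omega>)" for T \<omega>
    have f2: "f \<ge> 2" using card_frequencies[of 1] f by simp
    have Z: "conv_in_prob M Z 0"
      unfolding Z_def
    proof (rule conv_in_prob_square_ratio[where c = "\<lambda>_. 1" and K = "real f"])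
      show "\<bar>w T\<bar> \<le> real f * 1" if "T \<ge> 1" for T using df[OF that] by (simp add: w_def)
      show "conv_in_prob M (\<lambda>n \<omega>. 1 * (s2hat n \<omega> - v)) 0"
        using consistent by (simp add: conv_in_prob_def v_def)
    qed (use prob estimator v f2 in auto)
    have L: "L T \<omega> = Q T \<omega> + R T \<omega> * Z T \<omega>" if "T \<ge> 1" for T \<omega>
    proof -
      have "L T \<omega> = real (d T) * S T \<omega> / (s2hat T \<omega>)\<^sup>2"
        using d[OF that] by (simp add: L_def Lambda_fin_def S_def)
      then show ?thesis
        unfolding S_eq[OF that] Z_def w_def using d(1)[OF that] by (simp add: R_def right_diff_distrib)
    qed
    have Z_meas: "Z T \<in> borel_measurable (M T)" if "T \<ge> 1" for T
      using estimator[OF that] unfolding Z_def by measurable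
    have R_meas: "R T \<in> borel_measurable (M T)" if "T \<ge> 1" for T
      by (rule borel_measurable_integrable[OF R(1)[OF that]])
    have L_meas: "L T \<in> borel_measurable (M T)" if "T \<ge> 1" for T
      unfolding L[OF that, abs_def]
      by (intro borel_measurable_add borel_measurable_times Q(1) R_meas Z_meas that)
    have "conv_in_distr M L (chi_square_distribution (f - 1))"
    proof (rule conv_in_distr_char[OF prob L_meas chi_square_real_distribution])
      fix s
      have bound: "(\<lambda>T. real (f - 1) * sqrt (real (f - 1) / real T) * ((64 / 3 + 1600 / 3 * C ^ 3) * \<bar>s\<bar> ^ 3 + (16 + C) * s\<^sup>2)
          + 9 * C * s\<^sup>2 * (real (f - 1))\<^sup>2 / real T) \<longlonglongrightarrow>
          real (f - 1) * sqrt 0 * ((64 / 3 + 1600 / 3 * C ^ 3) * \<bar>s\<bar> ^ 3 + (16 + C) * s\<^sup>2) + 0"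
        by (intro tendsto_intros lim_const_over_n)
      have "(\<lambda>T. (LINT \<omega>|M T. iexp (s * Q T \<omega>)) - char (chi_square_distribution (f - 1)) s) \<longlonglongrightarrow> 0"
      proof (rule Lim_null_comparison)
        show "(\<lambda>T. real (f - 1) * sqrt (real (f - 1) / real T) * ((64 / 3 + 1600 / 3 * C ^ 3) * \<bar>s\<bar> ^ 3 + (16 + C) * s\<^sup>2)
          + 9 * C * s\<^sup>2 * (real (f - 1))\<^sup>2 / real T) \<longlonglongrightarrow> 0"
          using bound by simp
        show "\<forall>\<^sub>F T in sequentially. cmod ((LINT \<omega>|M T. iexp (s * Q T \<omega>)) - char (chi_square_distribution (f - 1)) s) \<le>
            real (f - 1) * sqrt (real (f - 1) / real T) * ((64 / 3 + 1600 / 3 * C ^ 3) * \<bar>s\<bar> ^ 3 + (16 + C) * s\<^sup>2)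
            + 9 * C * s\<^sup>2 * (real (f - 1))\<^sup>2 / real T"
          using nyq eventually_ge_at_top[of 1]
        proof eventually_elim
          \<comment> \<open>No selected index is Nyquist for this \<open>T\<close>, hence
            \<open>\<rho> T = 0\<close> and the last term of the bound disappears.\<close>
          case (elim T)
          then show ?case using \<rho>(4)[OF elim(2), of s] \<rho>(3)[OF elim(2,1)] df[OF elim(2)] by simp
        qed
      qed
      moreover have "(\<lambda>T. (LINT \<omega>|M T. iexp (s * L T \<omega>)) - (LINT \<omega>|M T. iexp (s * Q T \<omega>))) \<longlonglongrightarrow> 0"
        by (rule slutsky_char[OF prob Q(1) L_meas Z_meas R L Z])
      ultimately have "(\<lambda>T. ((LINT \<omega>|M T. iexp (s * L T \<omega>)) - (LINT \<omega>|M T. iexp (s * Q T \<omega>))) +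
          ((LINT \<omega>|M T. iexp (s * Q T \<omega>)) - char (chi_square_distribution (f - 1)) s)) \<longlonglongrightarrow> 0 + 0"
        by (intro tendsto_add)
      then show "(\<lambda>T. LINT \<omega>|M T. iexp (s * L T \<omega>)) \<longlonglongrightarrow> char (chi_square_distribution (f - 1)) s"
        by (simp add: LIM_zero_iff)
    qed
    then show "conv_in_distr M (\<lambda>T \<omega>. Lambda_fin T (p T) (F T) (\<lambda>t k. U T t k \<omega>) (s2hat T \<omega>))
         (chi_square_distribution (f - 1))"
      by (simp add: L_def[abs_def])
  next
    assume f_inf: "filterlim (\<lambda>T. card (F T)) at_top sequentially"
      and f_T: "(\<lambda>T. real (card (F T)) / real T) \<longlonglongrightarrow> 0"
      and rate: "conv_in_prob M (\<lambda>T \<omega>. sqrt (real (card (F T))) * (s2hat T \<omega> - \<sigma>\<^sup>2)) 0"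
    \<comment> \<open>The scaling factor of \<open>Lambda_inf\<close>. It grows like the square root
      of the number of frequencies, and the assumed rate of the estimator is what makes
      \<open>Z\<close> vanish.\<close>
    define w where "w T = sqrt (real (d T) / 2)" for T
    define Z where "Z T \<omega> = w T * (v\<^sup>2 / (s2hat T \<omega>)\<^sup>2 - 1)" for T \<omega>
    define L where "L T \<omega> = Lambda_inf T (p T) (F T) (\<lambda>t k. U T t k \<omega>) (s2hat T \<omega>)" for T \<omega>
    \<comment> \<open>The standardised \<open>Q\<close>. It equals \<open>(R - 1) * w\<close>, that
      is \<open>Lambda_inf\<close> at the true variance.\<close>
    define X where "X T \<omega> = (Q T \<omega> - real (d T)) / sqrt (2 * real (d T))" for T \<omega>
    have Z: "conv_in_prob M Z 0"
      unfolding Z_def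
    proof (rule conv_in_prob_square_ratio[where c = "\<lambda>T. sqrt (real (card (F T)))" and K = 1])
      show "\<bar>w T\<bar> \<le> 1 * sqrt (real (card (F T)))" if "T \<ge> 1" for T
        using d[OF that] by (simp add: w_def)
      show "1 \<le> sqrt (real (card (F T)))" if "T \<ge> 1" for T
        using card_frequencies[OF that] by simp
      show "conv_in_prob M (\<lambda>T \<omega>. sqrt (real (card (F T))) * (s2hat T \<omega> - v)) 0"
        using rate by (simp add: v_def)
    qed (use prob estimator v in auto)
    have L: "L T \<omega> = X T \<omega> + R T \<omega> * Z T \<omega>" if "T \<ge> 1" for T \<omega>
    proof -
      have "L T \<omega> = (S T \<omega> / (s2hat T \<omega>)\<^sup>2 - 1) * w T"
        using d[OF that] by (simp add: L_def Lambda_inf_def S_def w_def)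
      moreover have "X T \<omega> = (R T \<omega> - 1) * w T"
      proof -
        have "sqrt (2 * real (d T)) * w T = real (d T)"
          unfolding w_def real_sqrt_mult[symmetric] by simp
        then have "w T = real (d T) / sqrt (2 * real (d T))"
          using d(1)[OF that] by (subst eq_divide_eq) (simp add: mult.commute)
        then show ?thesis
          using d(1)[OF that] by (simp add: X_def R_def left_diff_distrib diff_divide_distrib)
      qed
      ultimately show ?thesis
        unfolding S_eq[OF that] Z_def by (simp add: algebra_simps)
    qed
    have X_meas: "X T \<in> borel_measurable (M T)" if "T \<ge> 1" for T
      using Q(1)[OF that] unfolding X_def by measurable
    have Z_meas: "Z T \<in> borel_measurable (M T)" if "T \<ge> 1" for T
      using estimator[OF that] unfolding Z_def by measurable
    have R_meas: "R T \<in> borel_measurable (M T)" if "T \<ge> 1" for T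
      by (rule borel_measurable_integrable[OF R(1)[OF that]])
    have L_meas: "L T \<in> borel_measurable (M T)" if "T \<ge> 1" for T
      unfolding L[OF that, abs_def]
      by (intro borel_measurable_add borel_measurable_times X_meas R_meas Z_meas that)
    have d_inf: "filterlim d at_top sequentially"
      unfolding d_def filterlim_at_top
    proof
      fix k
      have "\<forall>\<^sub>F T in sequentially. k + 1 \<le> card (F T)"
        using f_inf unfolding filterlim_at_top by blast
      then show "\<forall>\<^sub>F T in sequentially. k \<le> card (F T) - 1" by eventually_elim simp
    qed
    have d_T: "(\<lambda>T. real (d T) / real T) \<longlonglongrightarrow> 0"
      by (rule tendsto_sandwich[OF _ _ tendsto_const f_T])
        (auto simp: d_def intro!: always_eventually divide_right_mono)
    have "conv_in_distr M L std_normal_distribution"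
    proof (rule conv_in_distr_char[OF prob L_meas real_dist_normal_dist])
      fix \<tau> :: real
      \<comment> \<open>The argument at which the unstandardised characteristic functions are
        compared; it satisfies \<open>d * s^2 = \<tau>^2 / 2\<close>.\<close>
      define s where "s T = \<tau> / sqrt (2 * real (d T))" for T
      have s0: "s \<longlonglongrightarrow> 0"
        unfolding s_def
        by (intro tendsto_divide_0[OF tendsto_const] filterlim_at_top_imp_at_infinity
            filterlim_compose[OF sqrt_at_top] filterlim_tendsto_pos_mult_at_top[OF tendsto_const]
            filterlim_compose[OF filterlim_real_sequentially d_inf]) simp
      \<comment> \<open>The bound for \<open>Q\<close> at \<open>s T\<close>, with
        \<open>\<rho> T\<close> replaced by 1 and each factor \<open>d * s^2\<close> by
        \<open>\<tau>^2 / 2\<close>. What is left depends on \<open>d / T\<close> and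
        \<open>s T\<close> only, and both tend to 0.\<close>
      define g where "g T = sqrt (real (d T) / real T) * ((64 / 3 + 1600 / 3 * C ^ 3) * (\<bar>s T\<bar> * (\<tau>\<^sup>2 / 2)) + (16 + C) * (\<tau>\<^sup>2 / 2))
          + 9 * C * (\<tau>\<^sup>2 / 2) * (real (d T) / real T) + (\<bar>s T\<bar> + 4 * (s T)\<^sup>2)" for T
      have "g \<longlonglongrightarrow> sqrt 0 * ((64 / 3 + 1600 / 3 * C ^ 3) * (\<bar>0\<bar> * (\<tau>\<^sup>2 / 2)) + (16 + C) * (\<tau>\<^sup>2 / 2))
          + 9 * C * (\<tau>\<^sup>2 / 2) * 0 + (\<bar>0\<bar> + 4 * 0\<^sup>2)"
        unfolding g_def by (intro tendsto_intros d_T s0)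
      then have g0: "g \<longlonglongrightarrow> 0" by simp
      let ?D = "\<lambda>n. distr (chi_square_distribution n) borel (\<lambda>x. (x - real n) / sqrt (2 * real n))"
      have "(\<lambda>T. (LINT \<omega>|M T. iexp (\<tau> * X T \<omega>)) - char (?D (d T)) \<tau>) \<longlonglongrightarrow> 0"
      proof (rule Lim_null_comparison[OF _ g0])
        show "\<forall>\<^sub>F T in sequentially. cmod ((LINT \<omega>|M T. iexp (\<tau> * X T \<omega>)) - char (?D (d T)) \<tau>) \<le> g T"
          using eventually_ge_at_top[of 1]
        proof eventually_elim
          case (elim T)
          \<comment> \<open>Centring multiplies both characteristic functions by the same number of
            modulus 1, so the modulus of their difference is unchanged.\<close>
          let ?e = "iexp (- (s T * real (d T)))"
          have "iexp (\<tau> * X T \<omega>) = ?e * iexp (s T * Q T \<omega>)" for \<omega>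
            by (simp add: X_def s_def exp_add[symmetric] algebra_simps diff_divide_distrib)
          then have "(LINT \<omega>|M T. iexp (\<tau> * X T \<omega>)) - char (?D (d T)) \<tau> =
              ?e * ((LINT \<omega>|M T. iexp (s T * Q T \<omega>)) - char (chi_square_distribution (d T)) (s T))"
            unfolding char_standardized_chi_square s_def[symmetric] by (simp add: right_diff_distrib)
          then have "cmod ((LINT \<omega>|M T. iexp (\<tau> * X T \<omega>)) - char (?D (d T)) \<tau>) =
              cmod ((LINT \<omega>|M T. iexp (s T * Q T \<omega>)) - char (chi_square_distribution (d T)) (s T))"
            by (simp only: norm_mult) simp
          also have "\<dots> \<le> ?bound T (s T) (\<rho> T)" by (rule \<rho>(4)[OF elim])
          \<comment> \<open>The Nyquist contribution is harmless at this scale: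
            \<open>\<rho> T\<close> is at most 1 and its factor \<open>|s T| + 4 * (s T)^2\<close>
            tends to 0.\<close>
          also have "\<dots> \<le> ?bound T (s T) 1"
            by (intro add_left_mono mult_right_mono \<rho>(2) elim) auto
          also have "\<dots> = g T"
          proof -
            have sd: "real (d T) * (s T)\<^sup>2 = \<tau>\<^sup>2 / 2"
              using d(1)[OF elim] by (simp add: s_def power_divide)
            have s3: "\<bar>s T\<bar> ^ 3 = \<bar>s T\<bar> * (s T)\<^sup>2"
              by (simp add: power3_eq_cube power2_eq_square)
            show ?thesis
              unfolding g_def sd[symmetric] s3 by (simp add: power2_eq_square algebra_simps)
          qed
          finally show ?case .
        qed
      qed
      moreover have "(\<lambda>T. char (?D (d T)) \<tau>) \<longlonglongrightarrow> char std_normal_distribution \<tau>"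
      proof -
        have "real_distribution (?D n)" for n
          using chi_square_real_distribution[of n]
          by (intro prob_space.real_distribution_distr) (auto simp: real_distribution_def real_distribution_axioms_def)
        then have "(\<lambda>n. char (?D n) \<tau>) \<longlonglongrightarrow> char std_normal_distribution \<tau>"
          by (rule levy_continuity1[OF _ real_dist_normal_dist chi_square_clt])
        then show ?thesis by (rule filterlim_compose[OF _ d_inf])
      qed
      moreover have "(\<lambda>T. (LINT \<omega>|M T. iexp (\<tau> * L T \<omega>)) - (LINT \<omega>|M T. iexp (\<tau> * X T \<omega>))) \<longlonglongrightarrow> 0"
        by (rule slutsky_char[OF prob X_meas L_meas Z_meas R L Z])
      ultimately have "(\<lambda>T. ((LINT \<omega>|M T. iexp (\<tau> * L T \<omega>)) - (LINT \<omega>|M T. iexp (\<tau> * X T \<omega>))) +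
          (((LINT \<omega>|M T. iexp (\<tau> * X T \<omega>)) - char (?D (d T)) \<tau>) + char (?D (d T)) \<tau>))
          \<longlonglongrightarrow> 0 + (0 + char std_normal_distribution \<tau>)"
        by (intro tendsto_add)
      then show "(\<lambda>T. LINT \<omega>|M T. iexp (\<tau> * L T \<omega>)) \<longlonglongrightarrow> char std_normal_distribution \<tau>"
        by simp
    qed
    then show "conv_in_distr M (\<lambda>T \<omega>. Lambda_inf T (p T) (F T) (\<lambda>t k. U T t k \<omega>) (s2hat T \<omega>))
         std_normal_distribution"
      by (simp add: L_def[abs_def])
  qed
qed

end
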